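(* If $\mathcal{C}\subseteq\mathrm{rep}_\beta(Q,R)$ is an irreducible component such that $\mathcal{C}$ is not the closure of a $\mathrm{GL}_\beta$-orbit and the coordinate ring $\mathbb{K}[\mathcal{C}]$ is a UFD, then the semi-invariant ring $\mathrm{SI}(Q,\mathcal{C})$ is not multiplicity free, i.e. there is a weight $\theta\in\mathbb{Z}^{Q_0}$ with $\dim_{\mathbb{K}}\mathrm{SI}(Q,\mathcal{C})_\theta\ge2$.
   Context: $\mathbb{K}$ is an algebraically closed field of characteristic zero, $Q=(Q_0,Q_1)$ is a finite quiver (an arrow $a$ has tail $ta$ and head $ha$), and $R$ is an admissible ideal of the path algebra $\mathbb{K}Q$ (it contains all paths of length $t$ for some $t\ge1$ and is generated by linear combinations of paths of length at least two). An element of $\mathbb{K}Q$ is uniform if it is a linear combination of paths with the same tail and the same head. For a dimension vector $\beta\in\mathbb{Z}_{\ge0}^{Q_0}$, $\mathrm{rep}_\beta(Q,R)$ is the affine variety of tuples $(V(a))_{a\in Q_1}\in\prod_{a}\mathrm{Hom}_{\mathbb{K}}(\mathbb{K}^{\beta(ta)},\mathbb{K}^{\beta(ha)})$ with $V(u)=0$ for every uniform $u\in R$. The group $\mathrm{GL}_\beta=\prod_{x\in Q_0}\mathrm{GL}_{\beta(x)}(\mathbb{K})$ acts by $g\cdot V=(g_{ha}V(a)g_{ta}^{-1})_a$, and $\mathrm{SL}_\beta=\prod_x\mathrm{SL}_{\beta(x)}(\mathbb{K})$. For an irreducible component $\mathcal{C}$, $\mathrm{GL}_\beta$ acts on $\mathbb{K}[\mathcal{C}]$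 by $(g\cdot f)(x)=f(g^{-1}x)$, and $\mathrm{SI}(Q,\mathcal{C})=\mathbb{K}[\mathcal{C}]^{\mathrm{SL}_\beta}$. A weight $\sigma\in\mathbb{Z}^{Q_0}$ defines the character $\chi_\sigma(g)=\prod_x\det(g_x)^{\sigma(x)}$, and $\mathrm{SI}(Q,\mathcal{C})_\sigma=\{f\in\mathbb{K}[\mathcal{C}]: g\cdot f=\chi_\sigma(g)f\ \forall g\in\mathrm{GL}_\beta\}$. $\mathrm{SI}(Q,\mathcal{C})$ is multiplicity free if $\dim_{\mathbb{K}}\mathrm{SI}(Q,\mathcal{C})_\theta\le1$ for every weight $\theta$. *)

theory Defs
  imports
    "HOL-Library.Poly_Mapping"
    "HOL-Library.Extended_Nat"
    "HOL-Analysis.Abstract_Topology"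
    "HOL-Algebra.Product_Groups"
    "HOL-Algebra.Ring_Divisibility"
    "HOL-Algebra.Embedded_Algebras"
    "HOL-Computational_Algebra.Polynomial"
    "Graph_Theory.Arc_Walk"
    "Jordan_Normal_Form.Determinant"
begin

text \<open>This notation of HOL-Algebra clashes with the topological closure operator.\<close>

no_notation eq_closure_of (\<open>closure'_of\<index>\<close>)

text \<open>
  A finite quiver is a \<^locale>\<open>fin_digraph\<close> (loops and multiple arrows are allowed).
  A path is a triple of its tail, its list of arrows in the order in which they are traversed,
  and its head; the triple \<open>(x, [], x)\<close> is the trivial path at \<open>x\<close>.
\<close>

type_synonym ('v, 'e) quiver_path = "'v \<times> 'e list \<times> 'v"

definition quiver_paths :: "('v, 'e) pre_digraph \<Rightarrow> ('v, 'e) quiver_path set" where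
  "quiver_paths Q = {(x, p, y). pre_digraph.awalk Q x p y}"

text \<open>
  The product of two paths is written like the composition of maps: in \<open>q \<cdot> p\<close> the path \<open>p\<close>
  is traversed first.
\<close>

definition path_mult ::
  "(('v, 'e) quiver_path \<Rightarrow>\<^sub>0 'k::comm_ring_1) \<Rightarrow> (('v, 'e) quiver_path \<Rightarrow>\<^sub>0 'k)
     \<Rightarrow> (('v, 'e) quiver_path \<Rightarrow>\<^sub>0 'k)" where
  "path_mult f g =
     (\<Sum>(y', q, z)\<in>Poly_Mapping.keys f. \<Sum>(x, p, y)\<in>Poly_Mapping.keys g.
        if y = y'
        then Poly_Mapping.single (x, p @ q, z)
               (Poly_Mapping.lookup f (y', q, z) * Poly_Mapping.lookup g (x, p, y))
        else 0)"

definition path_algebra ::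
  "('v, 'e) pre_digraph \<Rightarrow> (('v, 'e) quiver_path \<Rightarrow>\<^sub>0 'k::comm_ring_1) ring" where
  "path_algebra Q =
     \<lparr>carrier = {f. Poly_Mapping.keys f \<subseteq> quiver_paths Q},
      monoid.mult = path_mult,
      one = (\<Sum>x\<in>verts Q. Poly_Mapping.single (x, [], x) 1),
      ring.zero = 0,
      ring.add = (+)\<rparr>"

definition uniform ::
  "('v, 'e) pre_digraph \<Rightarrow> 'v \<Rightarrow> 'v \<Rightarrow> (('v, 'e) quiver_path \<Rightarrow>\<^sub>0 'k::comm_ring_1) \<Rightarrow> bool" where
  "uniform Q x y u \<longleftrightarrow> Poly_Mapping.keys u \<subseteq> {(x, p, y) | p. pre_digraph.awalk Q x p y}"

definition admissible_ideal ::
  "('v, 'e) pre_digraph \<Rightarrow> (('v, 'e) quiver_path \<Rightarrow>\<^sub>0 'k::comm_ring_1) set \<Rightarrow> bool" where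
  "admissible_ideal Q R \<longleftrightarrow>
     ideal R (path_algebra Q) \<and>
     (\<exists>t\<ge>1. \<forall>(x, p, y)\<in>quiver_paths Q. length p = t \<longrightarrow> Poly_Mapping.single (x, p, y) 1 \<in> R) \<and>
     (\<exists>S \<subseteq> carrier (path_algebra Q).
        (\<forall>u\<in>S. \<forall>(x, p, y)\<in>Poly_Mapping.keys u. 2 \<le> length p) \<and>
        R = genideal (path_algebra Q) S)"

definition rep_space :: "('v, 'e) pre_digraph \<Rightarrow> ('v \<Rightarrow> nat) \<Rightarrow> ('e \<Rightarrow> 'k::comm_ring_1 mat) set" where
  "rep_space Q \<beta> = (\<Pi>\<^sub>E a\<in>arcs Q. carrier_mat (\<beta> (head Q a)) (\<beta> (tail Q a)))"

primrec path_mat ::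
  "('v, 'e) pre_digraph \<Rightarrow> ('v \<Rightarrow> nat) \<Rightarrow> ('e \<Rightarrow> 'k::comm_ring_1 mat) \<Rightarrow> 'v \<Rightarrow> 'e list \<Rightarrow> 'k mat" where
  "path_mat Q \<beta> V x [] = 1\<^sub>m (\<beta> x)"
| "path_mat Q \<beta> V x (a # p) = path_mat Q \<beta> V (head Q a) p * V a"

text \<open>
  The matrix \<open>V(u)\<close> of an element \<open>u\<close> that is uniform with tail \<open>x\<close> and head \<open>y\<close>. The linear
  combination is taken entrywise because matrices of varying size do not form an additive monoid
  type.
\<close>

definition eval_uniform ::
  "('v, 'e) pre_digraph \<Rightarrow> ('v \<Rightarrow> nat) \<Rightarrow> ('e \<Rightarrow> 'k::comm_ring_1 mat) \<Rightarrow> 'v \<Rightarrow> 'v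
     \<Rightarrow> (('v, 'e) quiver_path \<Rightarrow>\<^sub>0 'k) \<Rightarrow> 'k mat" where
  "eval_uniform Q \<beta> V x y u =
     mat (\<beta> y) (\<beta> x)
       (\<lambda>ij. \<Sum>(s, p, t)\<in>Poly_Mapping.keys u.
          Poly_Mapping.lookup u (s, p, t) * path_mat Q \<beta> V s p $$ ij)"

definition rep_variety ::
  "('v, 'e) pre_digraph \<Rightarrow> (('v, 'e) quiver_path \<Rightarrow>\<^sub>0 'k::comm_ring_1) set \<Rightarrow> ('v \<Rightarrow> nat)
     \<Rightarrow> ('e \<Rightarrow> 'k mat) set" where
  "rep_variety Q R \<beta> =
     {V \<in> rep_space Q \<beta>. \<forall>x\<in>verts Q. \<forall>y\<in>verts Q. \<forall>u\<in>R.
        uniform Q x y u \<longrightarrow> eval_uniform Q \<beta> V x y u = 0\<^sub>m (\<beta> y) (\<beta> x)}"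

inductive_set poly_funs ::
  "('v, 'e) pre_digraph \<Rightarrow> ('v \<Rightarrow> nat) \<Rightarrow> (('e \<Rightarrow> 'k::comm_ring_1 mat) \<Rightarrow> 'k) set"
  for Q :: "('v, 'e) pre_digraph" and \<beta> :: "'v \<Rightarrow> nat" where
  const: "(\<lambda>V. c) \<in> poly_funs Q \<beta>"
| coord: "a \<in> arcs Q \<Longrightarrow> i < \<beta> (head Q a) \<Longrightarrow> j < \<beta> (tail Q a) \<Longrightarrow>
    (\<lambda>V. V a $$ (i, j)) \<in> poly_funs Q \<beta>"
| add: "f \<in> poly_funs Q \<beta> \<Longrightarrow> g \<in> poly_funs Q \<beta> \<Longrightarrow> (\<lambda>V. f V + g V) \<in> poly_funs Q \<beta>"
| mult: "f \<in> poly_funs Q \<beta> \<Longrightarrow> g \<in> poly_funs Q \<beta> \<Longrightarrow> (\<lambda>V. f V * g V) \<in> poly_funs Q \<beta>"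

definition zariski :: "('v, 'e) pre_digraph \<Rightarrow> ('v \<Rightarrow> nat) \<Rightarrow> ('e \<Rightarrow> 'k::field mat) topology" where
  "zariski Q \<beta> =
     topology (\<lambda>U. \<exists>F \<subseteq> poly_funs Q \<beta>. U = {V \<in> rep_space Q \<beta>. \<exists>f\<in>F. f V \<noteq> 0})"

definition irreducible_in :: "'a topology \<Rightarrow> 'a set \<Rightarrow> bool" where
  "irreducible_in T S \<longleftrightarrow>
     S \<subseteq> topspace T \<and> S \<noteq> {} \<and>
     (\<forall>A B. closedin T A \<and> closedin T B \<and> S \<subseteq> A \<union> B \<longrightarrow> S \<subseteq> A \<or> S \<subseteq> B)"

definition irreducible_component :: "'a topology \<Rightarrow> 'a set \<Rightarrow> bool" where
  "irreducible_component T C \<longleftrightarrow>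
     irreducible_in T C \<and> (\<forall>D. irreducible_in T D \<and> C \<subseteq> D \<longrightarrow> D = C)"

text \<open>
  \<open>\<bbbK>[C] = \<bbbK>[x]/I(C)\<close> is the ring of restrictions to \<open>C\<close> of polynomial functions; such a restriction
  is \<^const>\<open>undefined\<close> outside \<open>C\<close>, so that it is determined by its values on \<open>C\<close>.
\<close>

definition coord_ring ::
  "('v, 'e) pre_digraph \<Rightarrow> ('v \<Rightarrow> nat) \<Rightarrow> ('e \<Rightarrow> 'k::field mat) set
     \<Rightarrow> (('e \<Rightarrow> 'k mat) \<Rightarrow> 'k) ring" where
  "coord_ring Q \<beta> C =
     \<lparr>carrier = (\<lambda>f. restrict f C) ` poly_funs Q \<beta>,
      monoid.mult = (\<lambda>f g. \<lambda>V\<in>C. f V * g V),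
      one = (\<lambda>V\<in>C. 1),
      ring.zero = (\<lambda>V\<in>C. 0),
      ring.add = (\<lambda>f g. \<lambda>V\<in>C. f V + g V)\<rparr>"

definition constants :: "('e \<Rightarrow> 'k::field mat) set \<Rightarrow> (('e \<Rightarrow> 'k mat) \<Rightarrow> 'k) set" where
  "constants C = range (\<lambda>c. \<lambda>V\<in>C. c)"

definition GL :: "('v, 'e) pre_digraph \<Rightarrow> ('v \<Rightarrow> nat) \<Rightarrow> ('v \<Rightarrow> 'k::field mat) monoid" where
  "GL Q \<beta> = product_group (verts Q) (\<lambda>x. units_of (ring_mat TYPE('k) (\<beta> x) ()))"

definition SL :: "('v, 'e) pre_digraph \<Rightarrow> ('v \<Rightarrow> nat) \<Rightarrow> ('v \<Rightarrow> 'k::field mat) set" where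
  "SL Q \<beta> = {g \<in> carrier (GL Q \<beta>). \<forall>x\<in>verts Q. det (g x) = 1}"

definition act ::
  "('v, 'e) pre_digraph \<Rightarrow> ('v \<Rightarrow> nat) \<Rightarrow> ('v \<Rightarrow> 'k::field mat) \<Rightarrow> ('e \<Rightarrow> 'k mat) \<Rightarrow> ('e \<Rightarrow> 'k mat)"
  where
  "act Q \<beta> g V = (\<lambda>a\<in>arcs Q. g (head Q a) * V a * (inv\<^bsub>GL Q \<beta>\<^esub> g) (tail Q a))"

definition orbit ::
  "('v, 'e) pre_digraph \<Rightarrow> ('v \<Rightarrow> nat) \<Rightarrow> ('e \<Rightarrow> 'k::field mat) \<Rightarrow> ('e \<Rightarrow> 'k mat) set" where
  "orbit Q \<beta> V = (\<lambda>g. act Q \<beta> g V) ` carrier (GL Q \<beta>)"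

definition fun_act ::
  "('v, 'e) pre_digraph \<Rightarrow> ('v \<Rightarrow> nat) \<Rightarrow> ('e \<Rightarrow> 'k::field mat) set \<Rightarrow> ('v \<Rightarrow> 'k mat)
     \<Rightarrow> (('e \<Rightarrow> 'k mat) \<Rightarrow> 'k) \<Rightarrow> (('e \<Rightarrow> 'k mat) \<Rightarrow> 'k)" where
  "fun_act Q \<beta> C g f = (\<lambda>V\<in>C. f (act Q \<beta> (inv\<^bsub>GL Q \<beta>\<^esub> g) V))"

definition weight_char :: "('v, 'e) pre_digraph \<Rightarrow> ('v \<Rightarrow> int) \<Rightarrow> ('v \<Rightarrow> 'k::field mat) \<Rightarrow> 'k" where
  "weight_char Q \<sigma> g = (\<Prod>x\<in>verts Q. det (g x) powi \<sigma> x)"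

definition SI ::
  "('v, 'e) pre_digraph \<Rightarrow> ('v \<Rightarrow> nat) \<Rightarrow> ('e \<Rightarrow> 'k::field mat) set
     \<Rightarrow> (('e \<Rightarrow> 'k mat) \<Rightarrow> 'k) ring" where
  "SI Q \<beta> C = (coord_ring Q \<beta> C)
     \<lparr>carrier := {f \<in> carrier (coord_ring Q \<beta> C). \<forall>g\<in>SL Q \<beta>. fun_act Q \<beta> C g f = f}\<rparr>"

definition SI_weight ::
  "('v, 'e) pre_digraph \<Rightarrow> ('v \<Rightarrow> nat) \<Rightarrow> ('e \<Rightarrow> 'k::field mat) set \<Rightarrow> ('v \<Rightarrow> int)
     \<Rightarrow> (('e \<Rightarrow> 'k mat) \<Rightarrow> 'k) set" where
  "SI_weight Q \<beta> C \<sigma> =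
     {f \<in> carrier (coord_ring Q \<beta> C).
        \<forall>g\<in>carrier (GL Q \<beta>). fun_act Q \<beta> C g f = (\<lambda>V\<in>C. weight_char Q \<sigma> g * f V)}"

text \<open>
  The dimension over the subfield of constants, which is \<open>\<infinity>\<close> if there is no finite basis
  (the infimum of the empty set).
\<close>

definition SI_weight_dim ::
  "('v, 'e) pre_digraph \<Rightarrow> ('v \<Rightarrow> nat) \<Rightarrow> ('e \<Rightarrow> 'k::field mat) set \<Rightarrow> ('v \<Rightarrow> int) \<Rightarrow> enat" where
  "SI_weight_dim Q \<beta> C \<sigma> =
     Inf (enat ` {n. ring.dimension (coord_ring Q \<beta> C) n (constants C) (SI_weight Q \<beta> C \<sigma>)})"

definition SI_multiplicity_free ::
  "('v, 'e) pre_digraph \<Rightarrow> ('v \<Rightarrow> nat) \<Rightarrow> ('e \<Rightarrow> 'k::field mat) set \<Rightarrow> bool" where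
  "SI_multiplicity_free Q \<beta> C \<longleftrightarrow> (\<forall>\<theta>. SI_weight_dim Q \<beta> C \<theta> \<le> 1)"

lemma path_mult_supset:
  assumes "finite A" "finite B" "Poly_Mapping.keys f \<subseteq> A" "Poly_Mapping.keys g \<subseteq> B"
  shows "path_mult f g =
     (\<Sum>(y', q, z)\<in>A. \<Sum>(x, p, y)\<in>B.
        if y = y'
        then Poly_Mapping.single (x, p @ q, z)
               (Poly_Mapping.lookup f (y', q, z) * Poly_Mapping.lookup g (x, p, y))
        else 0)"
proof -
  have *: "(\<Sum>(x, p, y)\<in>Poly_Mapping.keys g.
        if y = y'
        then Poly_Mapping.single (x, p @ q, z) (c * Poly_Mapping.lookup g (x, p, y))
        else 0) =
      (\<Sum>(x, p, y)\<in>B.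
        if y = y'
        then Poly_Mapping.single (x, p @ q, z) (c * Poly_Mapping.lookup g (x, p, y))
        else 0)" for y' q z c
    using assms by (intro sum.mono_neutral_left) (auto simp: in_keys_iff)
  have "path_mult f g = (\<Sum>(y', q, z)\<in>Poly_Mapping.keys f. \<Sum>(x, p, y)\<in>B.
        if y = y'
        then Poly_Mapping.single (x, p @ q, z)
               (Poly_Mapping.lookup f (y', q, z) * Poly_Mapping.lookup g (x, p, y))
        else 0)"
    unfolding path_mult_def by (simp only: *)
  also have "\<dots> = (\<Sum>(y', q, z)\<in>A. \<Sum>(x, p, y)\<in>B.
        if y = y'
        then Poly_Mapping.single (x, p @ q, z)
               (Poly_Mapping.lookup f (y', q, z) * Poly_Mapping.lookup g (x, p, y))
        else 0)"
    using assms by (intro sum.mono_neutral_left) (auto simp: in_keys_iff intro!: sum.neutral)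
  finally show ?thesis .
qed

lemma path_mult_add_left: "path_mult (f + f') g = path_mult f g + path_mult f' g"
proof -
  let ?A = "Poly_Mapping.keys f \<union> Poly_Mapping.keys f'"
  let ?B = "Poly_Mapping.keys g"
  have A: "finite ?A" "finite ?B" "Poly_Mapping.keys (f + f') \<subseteq> ?A"
      "Poly_Mapping.keys f \<subseteq> ?A" "Poly_Mapping.keys f' \<subseteq> ?A" "?B \<subseteq> ?B"
    by (auto simp: keys_add)
  show ?thesis
    unfolding path_mult_supset[OF A(1,2,3,6)] path_mult_supset[OF A(1,2,4,6)]
      path_mult_supset[OF A(1,2,5,6)] sum.distrib[symmetric]
    by (intro sum.cong refl)
      (auto simp: sum.distrib[symmetric] lookup_add single_add distrib_right intro!: sum.cong)
qed

lemma path_mult_add_right: "path_mult f (g + g') = path_mult f g + path_mult f g'"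
proof -
  let ?B = "Poly_Mapping.keys g \<union> Poly_Mapping.keys g'"
  let ?A = "Poly_Mapping.keys f"
  have A: "finite ?A" "finite ?B" "Poly_Mapping.keys (g + g') \<subseteq> ?B"
      "Poly_Mapping.keys g \<subseteq> ?B" "Poly_Mapping.keys g' \<subseteq> ?B" "?A \<subseteq> ?A"
    by (auto simp: keys_add)
  show ?thesis
    unfolding path_mult_supset[OF A(1,2,6,3)] path_mult_supset[OF A(1,2,6,4)]
      path_mult_supset[OF A(1,2,6,5)] sum.distrib[symmetric]
    by (intro sum.cong refl)
      (auto simp: sum.distrib[symmetric] lookup_add single_add distrib_left intro!: sum.cong)
qed

lemma path_mult_zero [simp]: "path_mult 0 g = 0" "path_mult f 0 = 0"
  by (simp_all add: path_mult_def)

lemma path_mult_sum_left: "path_mult (sum F I) g = (\<Sum>i\<in>I. path_mult (F i) g)"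
  by (induction I rule: infinite_finite_induct) (simp_all add: path_mult_add_left)

lemma path_mult_sum_right: "path_mult f (sum G I) = (\<Sum>i\<in>I. path_mult f (G i))"
  by (induction I rule: infinite_finite_induct) (simp_all add: path_mult_add_right)

lemma path_mult_single [simp]:
  "path_mult (Poly_Mapping.single (y', q, z) c) (Poly_Mapping.single (x, p, y) d) =
     (if y = y' then Poly_Mapping.single (x, p @ q, z) (c * d) else 0)"
  by (subst path_mult_supset[where A = "{(y', q, z)}" and B = "{(x, p, y)}"]) auto

lemma poly_mapping_eq_sum_single:
  fixes f :: "'a \<Rightarrow>\<^sub>0 'b::comm_monoid_add"
  shows "f = (\<Sum>k\<in>Poly_Mapping.keys f. Poly_Mapping.single k (Poly_Mapping.lookup f k))"
  by (rule poly_mapping_eqI) (auto simp: lookup_sum lookup_single when_def in_keys_iff sum.delta)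

lemma poly_mapping_single_induct [case_names zero single add]:
  fixes f :: "'a \<Rightarrow>\<^sub>0 'b::comm_monoid_add"
  assumes "P 0" "\<And>k c. k \<in> Poly_Mapping.keys f \<Longrightarrow> P (Poly_Mapping.single k c)"
    "\<And>g h. P g \<Longrightarrow> P h \<Longrightarrow> P (g + h)"
  shows "P f"
proof -
  have "P (\<Sum>k\<in>A. Poly_Mapping.single k (Poly_Mapping.lookup f k))" 
    if "A \<subseteq> Poly_Mapping.keys f" for A
    using finite_subset[OF that finite_keys] that
    by (induction A rule: finite_induct) (auto intro: assms)
  then show ?thesis using poly_mapping_eq_sum_single[of f] by (metis order_refl)
qed

lemma path_mult_assoc: "path_mult (path_mult f g) h = path_mult f (path_mult g h)"
proof (induction f rule: poly_mapping_single_induct)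
  case f: (single k c)
  obtain x1 p1 y1 where k: "k = (x1, p1, y1)" by (cases k)
  show ?case
  proof (induction g rule: poly_mapping_single_induct)
    case g: (single l d)
    obtain x2 p2 y2 where l: "l = (x2, p2, y2)" by (cases l)
    show ?case
    proof (induction h rule: poly_mapping_single_induct)
      case (single m e)
      obtain x3 p3 y3 where m: "m = (x3, p3, y3)" by (cases m)
      show ?case by (simp add: k l m mult.assoc)
    qed (simp_all add: path_mult_add_right)
  qed (simp_all add: path_mult_add_left path_mult_add_right)
qed (simp_all add: path_mult_add_left)

lemma quiver_path_ends:
  assumes "wf_digraph Q" "(x, p, y) \<in> quiver_paths Q"
  shows "x \<in> verts Q" "y \<in> verts Q"
proof -
  interpret wf_digraph Q by fact
  show "x \<in> verts Q" "y \<in> verts Q"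
    using assms by (auto simp: quiver_paths_def)
qed

lemma quiver_path_append:
  assumes "wf_digraph Q" "(x, p, y) \<in> quiver_paths Q" "(y, q, z) \<in> quiver_paths Q"
  shows "(x, p @ q, z) \<in> quiver_paths Q"
proof -
  interpret wf_digraph Q by fact
  show ?thesis using assms by (auto simp: quiver_paths_def)
qed

lemma path_mult_closed:
  fixes f g :: "('v, 'e) quiver_path \<Rightarrow>\<^sub>0 'k::comm_ring_1"
  assumes Q: "wf_digraph Q"
    and f: "Poly_Mapping.keys f \<subseteq> quiver_paths Q" and g: "Poly_Mapping.keys g \<subseteq> quiver_paths Q"
  shows "Poly_Mapping.keys (path_mult f g) \<subseteq> quiver_paths Q"
proof -
  have s: "Poly_Mapping.keys (sum F I) \<subseteq> S" if "\<And>i. i \<in> I \<Longrightarrow> Poly_Mapping.keys (F i) \<subseteq> S"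
    for F :: "'d \<Rightarrow> (('v, 'e) quiver_path \<Rightarrow>\<^sub>0 'k)" and I S
    using keys_sum[of F I] that by blast
  have p: "Poly_Mapping.keys (Poly_Mapping.single (x, p @ q, z) c) \<subseteq> quiver_paths Q"
    if "(y, q, z) \<in> Poly_Mapping.keys f" "(x, p, y) \<in> Poly_Mapping.keys g" for x p y q z c
  proof -
    have "(x, p @ q, z) \<in> quiver_paths Q"
      using that f g by (blast intro: quiver_path_append[OF Q])
    then show ?thesis by simp
  qed
  show ?thesis
    unfolding path_mult_def
    unfolding split_beta by (rule s, rule s) (auto intro: p[THEN subsetD])
qed

lemma ring_path_algebra:
  assumes "fin_digraph Q"
  shows "ring (path_algebra Q :: (('v, 'e) quiver_path \<Rightarrow>\<^sub>0 'k::comm_ring_1) ring)"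
proof -
  interpret fin_digraph Q by fact
  let ?A = "path_algebra Q :: (('v, 'e) quiver_path \<Rightarrow>\<^sub>0 'k) ring"
  let ?e = "\<Sum>x\<in>verts Q. Poly_Mapping.single (x, [], x) 1 :: ('v, 'e) quiver_path \<Rightarrow>\<^sub>0 'k"
  have wf: "wf_digraph Q" by unfold_locales
  have triv: "(x, [], x) \<in> quiver_paths Q" if "x \<in> verts Q" for x
    using that by (simp add: quiver_paths_def awalk_Nil_iff)
  have one: "Poly_Mapping.keys ?e \<subseteq> quiver_paths Q"
    using keys_sum[of "\<lambda>x. Poly_Mapping.single (x, [], x) (1::'k)" "verts Q"] triv
    by (fastforce split: if_splits)
  have l: "path_mult ?e f = f" if "Poly_Mapping.keys f \<subseteq> quiver_paths Q" for f
  proof (induction f rule: poly_mapping_single_induct)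
    case (single k c)
    obtain x p y where k: "k = (x, p, y)" by (cases k)
    have "y \<in> verts Q" using single that quiver_path_ends[OF wf] k by blast
    then show ?case by (simp add: path_mult_sum_left k sum.delta)
  qed (simp_all add: path_mult_add_right)
  have r: "path_mult f ?e = f" if "Poly_Mapping.keys f \<subseteq> quiver_paths Q" for f
  proof (induction f rule: poly_mapping_single_induct)
    case (single k c)
    obtain x p y where k: "k = (x, p, y)" by (cases k)
    have "x \<in> verts Q" using single that quiver_path_ends[OF wf] k by blast
    then show ?case by (simp add: path_mult_sum_right k sum.delta)
  qed (simp_all add: path_mult_add_left)
  have neg: "\<exists>g. Poly_Mapping.keys g \<subseteq> quiver_paths Q \<and> g + f = 0"
    if "Poly_Mapping.keys f \<subseteq> quiver_paths Q" for f :: "('v, 'e) quiver_path \<Rightarrow>\<^sub>0 'k"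
    using that by (intro exI[of _ "- f"]) simp
  show ?thesis
  proof (rule ringI)
    show "abelian_group ?A"
    proof (rule abelian_groupI)
      fix f g h assume "f \<in> carrier ?A" "g \<in> carrier ?A"
      then show "f \<oplus>\<^bsub>?A\<^esub> g \<in> carrier ?A"
        using keys_add[of f g] by (auto simp: path_algebra_def)
      show "f \<oplus>\<^bsub>?A\<^esub> g = g \<oplus>\<^bsub>?A\<^esub> f"
        by (simp add: path_algebra_def add.commute)
      show "f \<oplus>\<^bsub>?A\<^esub> g \<oplus>\<^bsub>?A\<^esub> h = f \<oplus>\<^bsub>?A\<^esub> (g \<oplus>\<^bsub>?A\<^esub> h)"
        by (simp add: path_algebra_def add.assoc)
      show "\<exists>g\<in>carrier ?A. g \<oplus>\<^bsub>?A\<^esub> f = \<zero>\<^bsub>?A\<^esub>"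
        using neg[of f] \<open>f \<in> carrier ?A\<close> by (simp add: path_algebra_def)
    qed (simp_all add: path_algebra_def)
    show "Group.monoid ?A"
      by (rule monoidI) (simp_all add: path_algebra_def one l r path_mult_assoc path_mult_closed[OF wf])
  qed (simp_all add: path_algebra_def path_mult_add_left path_mult_add_right)
qed

lemma istopology_zariski:
  "istopology (\<lambda>U. \<exists>F \<subseteq> (poly_funs Q \<beta> :: (('e \<Rightarrow> 'k::field mat) \<Rightarrow> 'k) set).
     U = {V \<in> rep_space Q \<beta>. \<exists>f\<in>F. f V \<noteq> 0})"
proof -
  let ?D = "\<lambda>F :: (('e \<Rightarrow> 'k mat) \<Rightarrow> 'k) set. {V \<in> rep_space Q \<beta>. \<exists>f\<in>F. f V \<noteq> 0}"
  have "\<exists>H\<subseteq>poly_funs Q \<beta>. ?D F \<inter> ?D G = ?D H"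
    if FG: "F \<subseteq> poly_funs Q \<beta>" "G \<subseteq> poly_funs Q \<beta>" for F G
  proof -
    let ?H = "(\<lambda>(f, g). \<lambda>V. f V * g V) ` (F \<times> G)"
    have "?H \<subseteq> poly_funs Q \<beta>"
      using FG by (auto intro: poly_funs.mult)
    moreover have "(\<exists>h\<in>?H. h V \<noteq> 0) \<longleftrightarrow> (\<exists>f\<in>F. f V \<noteq> 0) \<and> (\<exists>g\<in>G. g V \<noteq> 0)" for V
      by (simp add: Bex_def) blast
    then have "?D F \<inter> ?D G = ?D ?H" by blast
    ultimately show ?thesis by blast
  qed
  moreover have "\<exists>H\<subseteq>poly_funs Q \<beta>. \<Union>\<K> = ?D H"
    if "\<forall>K\<in>\<K>. \<exists>F\<subseteq>poly_funs Q \<beta>. K = ?D F" for \<K>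
  proof -
    have "\<forall>K\<in>\<K>. \<exists>F. F \<subseteq> poly_funs Q \<beta> \<and> K = ?D F" using that by blast
    from bchoice[OF this] obtain F where "\<forall>K\<in>\<K>. F K \<subseteq> poly_funs Q \<beta> \<and> K = ?D (F K)" ..
    then have F: "\<And>K. K \<in> \<K> \<Longrightarrow> F K \<subseteq> poly_funs Q \<beta>" "\<And>K. K \<in> \<K> \<Longrightarrow> K = ?D (F K)"
      by blast+
    have "\<Union>\<K> = ?D (\<Union>K\<in>\<K>. F K)"
      using F(2) by blast
    then show ?thesis using F(1) by (intro exI[of _ "\<Union>K\<in>\<K>. F K"]) blast
  qed
  ultimately show ?thesis unfolding istopology_def by meson
qed

lemma openin_zariski:
  "openin (zariski Q \<beta>) U \<longleftrightarrow> (\<exists>F \<subseteq> poly_funs Q \<beta>. U = {V \<in> rep_space Q \<beta>. \<exists>f\<in>F. f V \<noteq> 0})"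
  unfolding zariski_def by (simp add: topology_inverse'[OF istopology_zariski])

lemma topspace_zariski: "topspace (zariski Q \<beta>) = rep_space Q \<beta>"
proof -
  have "openin (zariski Q \<beta>) (rep_space Q \<beta>)"
    unfolding openin_zariski by (intro exI[of _ "{\<lambda>V. 1}"]) (auto intro: poly_funs.const)
  then show ?thesis unfolding topspace_def openin_zariski by blast
qed

lemma closedin_zariski:
  "closedin (zariski Q \<beta>) Z \<longleftrightarrow> (\<exists>F \<subseteq> poly_funs Q \<beta>. Z = {V \<in> rep_space Q \<beta>. \<forall>f\<in>F. f V = 0})"
proof
  assume "closedin (zariski Q \<beta>) Z"
  then obtain F where F: "F \<subseteq> poly_funs Q \<beta>" "Z \<subseteq> rep_space Q \<beta>"
      "rep_space Q \<beta> - Z = {V \<in> rep_space Q \<beta>. \<exists>f\<in>F. f V \<noteq> 0}"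
    by (auto simp: closedin_def topspace_zariski openin_zariski)
  then have "Z = {V \<in> rep_space Q \<beta>. \<forall>f\<in>F. f V = 0}" by blast
  with F(1) show "\<exists>F \<subseteq> poly_funs Q \<beta>. Z = {V \<in> rep_space Q \<beta>. \<forall>f\<in>F. f V = 0}" by blast
next
  assume "\<exists>F \<subseteq> poly_funs Q \<beta>. Z = {V \<in> rep_space Q \<beta>. \<forall>f\<in>F. f V = 0}"
  then obtain F where "F \<subseteq> poly_funs Q \<beta>" "Z = {V \<in> rep_space Q \<beta>. \<forall>f\<in>F. f V = 0}" by blast
  then show "closedin (zariski Q \<beta>) Z"
    by (auto simp: closedin_def topspace_zariski openin_zariski intro!: exI[of _ F])
qed

lemma cring_coord_ring:
  fixes C :: "('e \<Rightarrow> 'k::field mat) set" and Q :: "('v, 'e) pre_digraph"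
  shows "cring (coord_ring Q \<beta> C)"
proof -
  have neg: "\<exists>g\<in>poly_funs Q \<beta>. (\<lambda>V\<in>C. g V + f V) = (\<lambda>V\<in>C. 0)"
    if "f \<in> poly_funs Q \<beta>" for f :: "('e \<Rightarrow> 'k mat) \<Rightarrow> 'k"
    using poly_funs.mult[OF poly_funs.const[of "- 1"] that]
    by (rule rev_bexI) auto
  have cl: "(\<lambda>V\<in>C. restrict f C V + restrict g C V) \<in> (\<lambda>f. restrict f C) ` poly_funs Q \<beta>"
       "(\<lambda>V\<in>C. restrict f C V * restrict g C V) \<in> (\<lambda>f. restrict f C) ` poly_funs Q \<beta>"
    if "f \<in> poly_funs Q \<beta>" "g \<in> poly_funs Q \<beta>" for f g :: "('e \<Rightarrow> 'k mat) \<Rightarrow> 'k"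
    by (rule image_eqI[OF _ poly_funs.add[OF that]] image_eqI[OF _ poly_funs.mult[OF that]];
        simp cong: restrict_cong)+
  have c: "(\<lambda>V\<in>C. c) \<in> (\<lambda>f. restrict f C) ` poly_funs Q \<beta>" for c :: 'k
    by (rule image_eqI[OF refl poly_funs.const])
  show ?thesis
  proof (rule cringI)
    show "abelian_group (coord_ring Q \<beta> C)"
    proof (rule abelian_groupI)
      fix f assume "f \<in> carrier (coord_ring Q \<beta> C)"
      then obtain h where h: "h \<in> poly_funs Q \<beta>" "f = restrict h C"
        by (auto simp: coord_ring_def)
      obtain g where "g \<in> poly_funs Q \<beta>" "(\<lambda>V\<in>C. g V + h V) = (\<lambda>V\<in>C. 0)"
        using neg[OF h(1)] by blast
      then show "\<exists>y\<in>carrier (coord_ring Q \<beta> C). y \<oplus>\<^bsub>coord_ring Q \<beta> C\<^esub> f = \<zero>\<^bsub>coord_ring Q \<beta> C\<^esub>"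
        by (intro bexI[of _ "restrict g C"]) (auto simp: coord_ring_def h(2) cong: restrict_cong)
    qed (use cl c in \<open>auto simp: coord_ring_def add.assoc add.commute cong: restrict_cong\<close>)
    show "comm_monoid (coord_ring Q \<beta> C)"
      by (rule comm_monoidI)
        (use cl c in \<open>auto simp: coord_ring_def mult.assoc mult.commute cong: restrict_cong\<close>)
  qed (auto simp: coord_ring_def distrib_right cong: restrict_cong)
qed

lemma subfield_constants:
  fixes C :: "('e \<Rightarrow> 'k::field mat) set"
  assumes "C \<noteq> {}"
  shows "subfield (constants C) (coord_ring Q \<beta> C)"
proof -
  interpret cring "coord_ring Q \<beta> C" by (rule cring_coord_ring)
  obtain W where W: "W \<in> C" using assms by blast
  have sub: "constants C \<subseteq> carrier (coord_ring Q \<beta> C)"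
    unfolding constants_def coord_ring_def by (auto intro: image_eqI[OF refl poly_funs.const])
  have neg: "\<ominus>\<^bsub>coord_ring Q \<beta> C\<^esub> (\<lambda>V\<in>C. c) = (\<lambda>V\<in>C. - c)" for c
  proof (rule minus_equality)
    show "(\<lambda>V\<in>C. c) \<in> carrier (coord_ring Q \<beta> C)" "(\<lambda>V\<in>C. - c) \<in> carrier (coord_ring Q \<beta> C)"
      using sub by (auto simp: constants_def)
  qed (auto simp: coord_ring_def)
  have sr: "subring (constants C) (coord_ring Q \<beta> C)"
  proof (rule subringI[OF sub])
    show "\<one>\<^bsub>coord_ring Q \<beta> C\<^esub> \<in> constants C"
      by (auto simp: coord_ring_def constants_def)
    fix f assume "f \<in> constants C"
    then obtain c where f: "f = (\<lambda>V\<in>C. c)" by (auto simp: constants_def)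
    show "\<ominus>\<^bsub>coord_ring Q \<beta> C\<^esub> f \<in> constants C"
      unfolding f neg by (auto simp: constants_def)
    fix g assume "g \<in> constants C"
    then obtain d where g: "g = (\<lambda>V\<in>C. d)" by (auto simp: constants_def)
    have "f \<otimes>\<^bsub>coord_ring Q \<beta> C\<^esub> g = (\<lambda>V\<in>C. c * d)" "f \<oplus>\<^bsub>coord_ring Q \<beta> C\<^esub> g = (\<lambda>V\<in>C. c + d)"
      by (auto simp: coord_ring_def f g)
    then show "f \<otimes>\<^bsub>coord_ring Q \<beta> C\<^esub> g \<in> constants C" "f \<oplus>\<^bsub>coord_ring Q \<beta> C\<^esub> g \<in> constants C"
      by (auto simp: constants_def)
  qed
  have "field (coord_ring Q \<beta> C \<lparr>carrier := constants C\<rparr>)"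
  proof (rule cring.cring_fieldI2)
    show "cring (coord_ring Q \<beta> C \<lparr>carrier := constants C\<rparr>)"
      using subcring_iff[OF sub] subcringI'[OF sr] by simp
    have "(\<lambda>V\<in>C. (0::'k)) \<noteq> (\<lambda>V\<in>C. 1)"
    proof
      assume "(\<lambda>V\<in>C. (0::'k)) = (\<lambda>V\<in>C. 1)"
      then have "(\<lambda>V\<in>C. (0::'k)) W = (\<lambda>V\<in>C. 1) W" by (rule fun_cong)
      then show False using W by simp
    qed
    then show "\<zero>\<^bsub>coord_ring Q \<beta> C \<lparr>carrier := constants C\<rparr>\<^esub> \<noteq> \<one>\<^bsub>coord_ring Q \<beta> C \<lparr>carrier := constants C\<rparr>\<^esub>"
      by (simp add: coord_ring_def)
    fix f assume "f \<in> carrier (coord_ring Q \<beta> C \<lparr>carrier := constants C\<rparr>)"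
      "f \<noteq> \<zero>\<^bsub>coord_ring Q \<beta> C \<lparr>carrier := constants C\<rparr>\<^esub>"
    then obtain c where c: "f = (\<lambda>V\<in>C. c)" "c \<noteq> 0"
      by (auto simp: constants_def coord_ring_def)
    show "\<exists>g\<in>carrier (coord_ring Q \<beta> C \<lparr>carrier := constants C\<rparr>).
        f \<otimes>\<^bsub>coord_ring Q \<beta> C \<lparr>carrier := constants C\<rparr>\<^esub> g = \<one>\<^bsub>coord_ring Q \<beta> C \<lparr>carrier := constants C\<rparr>\<^esub>"
      by (rule bexI[of _ "\<lambda>V\<in>C. inverse c"]) (auto simp: c coord_ring_def constants_def)
  qed
  then show ?thesis using subfield_iff(1)[OF _ sub] by blast
qed

lemma group_GL: "Group.group (GL Q \<beta> :: ('v \<Rightarrow> 'k::field mat) monoid)"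
proof -
  have "Group.group (units_of (ring_mat TYPE('k) n ()))" for n
    by (rule monoid.units_group[OF ring.is_monoid[OF ring_mat]])
  then show ?thesis unfolding GL_def by simp
qed

lemma GL_iff:
  fixes g :: "'v \<Rightarrow> 'k::field mat"
  shows "g \<in> carrier (GL Q \<beta>) \<longleftrightarrow>
     g \<in> extensional (verts Q) \<and> (\<forall>x\<in>verts Q. g x \<in> carrier_mat (\<beta> x) (\<beta> x) \<and> det (g x) \<noteq> 0)"
proof -
  have "A \<in> Units (ring_mat TYPE('k) n ()) \<longleftrightarrow> A \<in> carrier_mat n n \<and> det A \<noteq> 0" for A n
    using unit_imp_det_non_zero[of A n "()"] det_non_zero_imp_unit[of A n "()"]
    by (auto simp: Units_def ring_mat_simps)
  then show ?thesis by (auto simp: GL_def units_of_def PiE_iff)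
qed

lemma SI_weight_subset: "SI_weight Q \<beta> C \<sigma> \<subseteq> carrier (SI Q \<beta> C)"
proof
  fix f assume f: "f \<in> SI_weight Q \<beta> C \<sigma>"
  have "fun_act Q \<beta> C g f = f" if "g \<in> SL Q \<beta>" for g
  proof -
    have "weight_char Q \<sigma> g = 1" "g \<in> carrier (GL Q \<beta>)"
      using that by (simp_all add: SL_def weight_char_def)
    then have "fun_act Q \<beta> C g f = (\<lambda>V\<in>C. f V)"
      using f by (simp add: SI_weight_def)
    also have "\<dots> = f"
      using f by (auto simp: SI_weight_def coord_ring_def)
    finally show ?thesis .
  qed
  then show "f \<in> carrier (SI Q \<beta> C)"
    using f by (simp add: SI_def SI_weight_def)
qed

lemma not_SI_multiplicity_free_iff:
  "\<not> SI_multiplicity_free Q \<beta> C \<longleftrightarrow> (\<exists>\<theta>. SI_weight_dim Q \<beta> C \<theta> \<ge> 2)"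
proof -
  have "\<not> d \<le> 1 \<longleftrightarrow> d \<ge> 2" for d :: enat
    by (cases d) (auto simp: one_enat_def numeral_eq_enat)
  then show ?thesis by (simp add: SI_multiplicity_free_def)
qed

end

theory Submission
  imports Defs "HOL-Library.Function_Algebras"
begin

text \<open>
  The argument first produces a non-constant invariant rational function on \<open>C\<close> and then clears
  denominators. If no function \<open>\<Sum> c\<^sub>i(V) m\<^sub>i(W)\<close> other than zero on \<open>C \<times> C\<close> vanished at all pairs \<open>(V, gV)\<close>,
  an elementary form of Chevalley's theorem (extension of homomorphisms into an algebraically closed
  field) would give a dense orbit. So such a relation exists, and the ratios \<open>c / d\<close> of the coefficients
  of a shortest one are invariant and not all constant. As the coordinate ring is factorial, one can
  write \<open>c / d = p / q\<close> in lowest terms; then \<open>p\<close> divides each of its translates. Along transvections and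
  along one-parameter tori such a \<open>p\<close> is a Laurent polynomial without zeros, hence a monomial, so Gaussian
  elimination shows that \<open>p\<close> is a semi-invariant, and \<open>q\<close> has the same weight.
\<close>

section \<open>Extension of homomorphisms\<close>

text \<open>The graph relation takes the place of Rosenlicht's theorem on generic quotients. If only
  the zero function on C x C pulls back to zero under (g, V) \<mapsto> (V, gV), then evaluation at
  any pair (V, W) is well defined on the pulled-back functions. Extending it to the matrix entries
  of g, with all determinants kept nonzero, produces an element carrying V to W. This works wherever
  one nonzero function c(V, W) does not vanish, so for suitable V the orbit contains a nonempty open
  part of C.

  All rings are sets of functions and an element is zero once it vanishes pointwise. Their
  integrality carries the geometry: for C it is irreducibility, for GL it is seen on lines, and for
  GL x C it follows from the other two.

  Factoriality enters through coprimality: in (p o g) q = p (q o g) the factor p must divide p o g.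
  Hence the group preserves the zeros of p, and by inverses also its nonzeros. The pair p, q is as
  independent as c, d because c = e p and d = e q with a common factor e.\<close>

definition is_subring :: "'r::comm_ring_1 set \<Rightarrow> bool" where
  "is_subring B \<longleftrightarrow> 1 \<in> B \<and> (\<forall>x\<in>B. \<forall>y\<in>B. x - y \<in> B \<and> x * y \<in> B)"

text \<open>Integrality is asked of a subset because \<open>'r\<close> will be a type of functions,
  which has zero divisors.\<close>

definition is_subdomain :: "'r::comm_ring_1 set \<Rightarrow> bool" where
  "is_subdomain D \<longleftrightarrow> is_subring D \<and> (\<forall>x\<in>D. \<forall>y\<in>D. x * y = 0 \<longrightarrow> x = 0 \<or> y = 0)"

definition polys_over :: "'r::comm_ring_1 set \<Rightarrow> 'r poly set" where
  "polys_over B = {P. \<forall>i. coeff P i \<in> B}"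

definition adjoin :: "'r::comm_ring_1 set \<Rightarrow> 'r \<Rightarrow> 'r set" where
  "adjoin B y = (\<lambda>P. poly P y) ` polys_over B"

primrec adjoin_list :: "'r::comm_ring_1 set \<Rightarrow> 'r list \<Rightarrow> 'r set" where
  "adjoin_list B [] = B"
| "adjoin_list B (y # ys) = adjoin_list (adjoin B y) ys"

definition hom_on :: "'r::comm_ring_1 set \<Rightarrow> ('r \<Rightarrow> 'k::field) \<Rightarrow> bool" where
  "hom_on B \<phi> \<longleftrightarrow> \<phi> 1 = 1 \<and> (\<forall>x\<in>B. \<forall>y\<in>B. \<phi> (x + y) = \<phi> x + \<phi> y \<and> \<phi> (x * y) = \<phi> x * \<phi> y)"

lemma is_subringD:
  assumes "is_subring B"
  shows "1 \<in> B" "0 \<in> B" "x \<in> B \<Longrightarrow> y \<in> B \<Longrightarrow> x - y \<in> B" "x \<in> B \<Longrightarrow> y \<in> B \<Longrightarrow> x * y \<in> B"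
    "x \<in> B \<Longrightarrow> y \<in> B \<Longrightarrow> x + y \<in> B" "x \<in> B \<Longrightarrow> - x \<in> B"
proof -
  show 1: "1 \<in> B" using assms by (simp add: is_subring_def)
  show d: "x - y \<in> B" if "x \<in> B" "y \<in> B" for x y
    using assms that by (auto simp: is_subring_def)
  show z: "0 \<in> B" using d[OF 1 1] by simp
  show n: "- x \<in> B" if "x \<in> B" for x using d[OF z that] by simp
  show "x + y \<in> B" if "x \<in> B" "y \<in> B" for x y using d[OF that(1) n[OF that(2)]] by simp
  show "x * y \<in> B" if "x \<in> B" "y \<in> B" for x y using assms that by (auto simp: is_subring_def)
qed

lemma is_subring_sum:
  assumes "is_subring B" "\<And>i. i \<in> I \<Longrightarrow> f i \<in> B"
  shows "sum f I \<in> B"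
  using assms(2) by (induction I rule: infinite_finite_induct) (auto intro: is_subringD[OF assms(1)])

lemma is_subring_prod:
  assumes "is_subring B" "\<And>i. i \<in> I \<Longrightarrow> f i \<in> B"
  shows "prod f I \<in> B"
  using assms(2) by (induction I rule: infinite_finite_induct) (auto intro: is_subringD[OF assms(1)])

lemma is_subring_power: "is_subring B \<Longrightarrow> x \<in> B \<Longrightarrow> x ^ n \<in> B"
  by (induction n) (auto intro: is_subringD)

lemma is_subring_polys_over: "is_subring B \<Longrightarrow> is_subring (polys_over B)"
  unfolding is_subring_def[of "polys_over B"]
  by (auto simp: polys_over_def coeff_mult intro!: is_subring_sum is_subringD(1-4))

lemma polys_over_smult: "is_subring B \<Longrightarrow> c \<in> B \<Longrightarrow> P \<in> polys_over B \<Longrightarrow> smult c P \<in> polys_over B"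
  by (auto simp: polys_over_def intro: is_subringD)

lemma polys_over_monom: "is_subring B \<Longrightarrow> c \<in> B \<Longrightarrow> monom c n \<in> polys_over B"
  by (auto simp: polys_over_def intro: is_subringD)

lemma poly_in_subring: "is_subring B \<Longrightarrow> P \<in> polys_over B \<Longrightarrow> y \<in> B \<Longrightarrow> poly P y \<in> B"
  by (auto simp: poly_altdef polys_over_def intro!: is_subring_sum is_subringD(4) is_subring_power)

lemma is_subring_adjoin:
  assumes "is_subring B" shows "is_subring (adjoin B y)"
proof -
  note P = is_subringD[OF is_subring_polys_over[OF assms]]
  have "1 \<in> adjoin B y" unfolding adjoin_def by (rule image_eqI[OF _ P(1)]) simp
  moreover have "poly S y - poly T y \<in> adjoin B y" "poly S y * poly T y \<in> adjoin B y"
    if "S \<in> polys_over B" "T \<in> polys_over B" for S T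
    unfolding adjoin_def poly_diff[symmetric] poly_mult[symmetric] using P that by blast+
  ultimately show ?thesis by (auto simp: is_subring_def adjoin_def)
qed

lemma subset_adjoin: "is_subring B \<Longrightarrow> B \<subseteq> adjoin B y"
proof
  fix b assume "is_subring B" "b \<in> B"
  then show "b \<in> adjoin B y" unfolding adjoin_def
    by (intro image_eqI[of _ _ "monom b 0"] polys_over_monom) (auto simp: poly_monom)
qed

lemma in_adjoin: "is_subring B \<Longrightarrow> y \<in> adjoin B y"
  unfolding adjoin_def
  by (intro image_eqI[of _ _ "monom 1 1"] polys_over_monom is_subringD(1)) (auto simp: poly_monom)

lemma adjoin_subset: "is_subring D \<Longrightarrow> B \<subseteq> D \<Longrightarrow> y \<in> D \<Longrightarrow> adjoin B y \<subseteq> D"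
  unfolding adjoin_def by (force simp: polys_over_def intro: poly_in_subring)

lemma adjoin_list_facts:
  assumes "is_subring B"
  shows "is_subring (adjoin_list B ys)" "B \<subseteq> adjoin_list B ys" "set ys \<subseteq> adjoin_list B ys"
proof -
  have "is_subring (adjoin_list B ys) \<and> B \<subseteq> adjoin_list B ys \<and> set ys \<subseteq> adjoin_list B ys"
    using assms
  proof (induction ys arbitrary: B)
    case (Cons y ys)
    from Cons.IH[OF is_subring_adjoin[OF Cons.prems, of y]] subset_adjoin[OF Cons.prems, of y]
      in_adjoin[OF Cons.prems, of y]
    show ?case by auto
  qed auto
  then show "is_subring (adjoin_list B ys)" "B \<subseteq> adjoin_list B ys" "set ys \<subseteq> adjoin_list B ys"
    by auto
qed

lemma hom_onD:
  assumes "hom_on B \<phi>" "is_subring B"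
  shows "\<phi> 1 = 1" "\<phi> 0 = 0" "x \<in> B \<Longrightarrow> y \<in> B \<Longrightarrow> \<phi> (x + y) = \<phi> x + \<phi> y"
    "x \<in> B \<Longrightarrow> y \<in> B \<Longrightarrow> \<phi> (x * y) = \<phi> x * \<phi> y" "x \<in> B \<Longrightarrow> y \<in> B \<Longrightarrow> \<phi> (x - y) = \<phi> x - \<phi> y"
    "x \<in> B \<Longrightarrow> \<phi> (- x) = - \<phi> x"
proof -
  show a: "\<phi> (x + y) = \<phi> x + \<phi> y" if "x \<in> B" "y \<in> B" for x y
    using assms that by (auto simp: hom_on_def)
  have "\<phi> 0 + \<phi> 0 = \<phi> 0 + 0" using a[of 0 0] is_subringD(2)[OF assms(2)] by simp
  then show z: "\<phi> 0 = 0" by (rule add_left_imp_eq)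
  show n: "\<phi> (- x) = - \<phi> x" if "x \<in> B" for x
    using a[OF that is_subringD(6)[OF assms(2) that]] z by (simp add: eq_neg_iff_add_eq_0 add.commute)
  show "\<phi> (x - y) = \<phi> x - \<phi> y" if "x \<in> B" "y \<in> B" for x y
    using a[OF that(1) is_subringD(6)[OF assms(2) that(2)]] n[OF that(2)] by simp
qed (use assms in \<open>auto simp: hom_on_def\<close>)

lemma hom_on_sum:
  assumes "hom_on B \<phi>" "is_subring B" "\<And>i. i \<in> I \<Longrightarrow> f i \<in> B"
  shows "\<phi> (sum f I) = (\<Sum>i\<in>I. \<phi> (f i))"
  using assms(3)
  by (induction I rule: infinite_finite_induct)
    (auto simp: hom_onD[OF assms(1,2)] is_subring_sum[OF assms(2)])

lemma hom_on_prod: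
  assumes "hom_on B \<phi>" "is_subring B" "\<And>i. i \<in> I \<Longrightarrow> f i \<in> B"
  shows "\<phi> (prod f I) = (\<Prod>i\<in>I. \<phi> (f i))"
  using assms(3)
  by (induction I rule: infinite_finite_induct)
    (auto simp: hom_onD[OF assms(1,2)] is_subring_prod[OF assms(2)])

lemma hom_on_power: "hom_on B \<phi> \<Longrightarrow> is_subring B \<Longrightarrow> x \<in> B \<Longrightarrow> \<phi> (x ^ n) = \<phi> x ^ n"
  by (induction n) (auto simp: hom_onD is_subring_power)

lemma map_poly_hom_on:
  assumes "hom_on B \<phi>" "is_subring B" "P \<in> polys_over B" "S \<in> polys_over B"
  shows "map_poly \<phi> (P + S) = map_poly \<phi> P + map_poly \<phi> S"
    "map_poly \<phi> (P * S) = map_poly \<phi> P * map_poly \<phi> S"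
proof -
  note h = hom_onD[OF assms(1,2)]
  have c: "coeff P i \<in> B" "coeff S i \<in> B" for i using assms by (auto simp: polys_over_def)
  show "map_poly \<phi> (P + S) = map_poly \<phi> P + map_poly \<phi> S"
    by (rule poly_eqI) (simp add: coeff_map_poly h c)
  show "map_poly \<phi> (P * S) = map_poly \<phi> P * map_poly \<phi> S"
    by (rule poly_eqI)
      (simp add: coeff_map_poly coeff_mult h c hom_on_sum[OF assms(1,2)] is_subringD[OF assms(2)])
qed

text \<open>Evaluation at \<open>\<xi>\<close> descends from polynomials to B[y] because the
  difference of two polynomials representing the same element kills y, so \<open>wd\<close> makes
  the value independent of the choice.\<close>

lemma hom_on_extend_to:
  assumes \<phi>: "hom_on B \<phi>" and B: "is_subring B"
    and wd: "\<And>P. P \<in> polys_over B \<Longrightarrow> poly P y = 0 \<Longrightarrow> poly (map_poly \<phi> P) \<xi> = 0"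
  shows "\<exists>\<phi>'. hom_on (adjoin B y) \<phi>' \<and> (\<forall>b\<in>B. \<phi>' b = \<phi> b) \<and>
    (\<forall>P\<in>polys_over B. \<phi>' (poly P y) = poly (map_poly \<phi> P) \<xi>)"
proof -
  note PB = is_subringD[OF is_subring_polys_over[OF B]]
  define \<phi>' where "\<phi>' x = poly (map_poly \<phi> (SOME P. P \<in> polys_over B \<and> poly P y = x)) \<xi>" for x
  have eq: "poly (map_poly \<phi> P) \<xi> = poly (map_poly \<phi> S) \<xi>"
    if "P \<in> polys_over B" "S \<in> polys_over B" "poly P y = poly S y" for P S
  proof -
    have "poly (map_poly \<phi> (P - S)) \<xi> = 0" using wd[OF PB(3)[OF that(1,2)]] that(3) by simp
    moreover have "map_poly \<phi> P = map_poly \<phi> (P - S) + map_poly \<phi> S"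
      using map_poly_hom_on(1)[OF \<phi> B PB(3)[OF that(1,2)] that(2)] by simp
    ultimately show ?thesis by simp
  qed
  have e: "\<phi>' (poly P y) = poly (map_poly \<phi> P) \<xi>" if "P \<in> polys_over B" for P
  proof -
    have "\<exists>S. S \<in> polys_over B \<and> poly S y = poly P y" using that by blast
    from someI_ex[OF this] show ?thesis unfolding \<phi>'_def using eq that by blast
  qed
  have "\<phi>' b = \<phi> b" if "b \<in> B" for b
    using e[OF polys_over_monom[OF B that, of 0]] hom_onD(2)[OF \<phi> B]
    by (simp add: poly_monom map_poly_monom)
  moreover have "hom_on (adjoin B y) \<phi>'"
  proof -
    have "\<phi>' 1 = 1" using calculation[OF is_subringD(1)[OF B]] hom_onD(1)[OF \<phi> B] by simp
    moreover have "\<phi>' (poly P y + poly S y) = \<phi>' (poly P y) + \<phi>' (poly S y)"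
      "\<phi>' (poly P y * poly S y) = \<phi>' (poly P y) * \<phi>' (poly S y)"
      if "P \<in> polys_over B" "S \<in> polys_over B" for P S
      using e[OF PB(5)[OF that]] e[OF PB(4)[OF that]] e[OF that(1)] e[OF that(2)]
        map_poly_hom_on[OF \<phi> B that] by simp_all
    ultimately show ?thesis unfolding hom_on_def adjoin_def by blast
  qed
  ultimately show ?thesis using e by blast
qed

text \<open>Coefficientwise control is needed because the type \<open>'r\<close> itself may have zero divisors.\<close>

lemma pseudo_division_over:
  assumes B: "is_subring B" and T: "T \<in> polys_over B" "T \<noteq> 0" and "P \<in> polys_over B"
  shows "\<exists>k S R. S \<in> polys_over B \<and> R \<in> polys_over B \<and> smult (lead_coeff T ^ k) P = S * T + R \<and>
    (R = 0 \<or> degree R < degree T) \<and> degree S \<le> degree P - degree T"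
  using assms(4)
\<comment> \<open>The measure separates the zero polynomial from nonzero constants, which have the
  same \<open>degree\<close>; this matters when T is constant.\<close>
proof (induction "if P = 0 then 0 else Suc (degree P)" arbitrary: P rule: less_induct)
  case less
  note PB = is_subringD[OF is_subring_polys_over[OF B]]
  let ?t = "lead_coeff T" and ?m = "degree T" and ?n = "degree P"
  show ?case
  proof (cases "P = 0 \<or> ?n < ?m")
    case True
    then show ?thesis using less.prems PB(2)
      by (intro exI[of _ 0] exI[of _ 0] exI[of _ P]) auto
  next
    case False
    then have P: "P \<noteq> 0" "?m \<le> ?n" by auto
    have tB: "?t \<in> B" "lead_coeff P \<in> B" using T less.prems by (auto simp: polys_over_def)
    define M where "M = monom (lead_coeff P) (?n - ?m)"
    define P' where "P' = smult ?t P - M * T"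
    have M: "M \<in> polys_over B" unfolding M_def by (rule polys_over_monom[OF B tB(2)])
    have P'B: "P' \<in> polys_over B"
      unfolding P'_def by (intro PB polys_over_smult[OF B] tB M less.prems T)
    have dM: "degree M \<le> ?n - ?m" unfolding M_def by (rule degree_monom_le)
    have dMT: "degree (M * T) \<le> ?n" using degree_mult_le[of M T] dM P by linarith
    have dP': "degree P' \<le> ?n"
      unfolding P'_def using dMT degree_smult_le[of ?t P] by (intro degree_diff_le)
    have c0: "coeff P' ?n = 0"
    proof -
      have "coeff (M * T) ?n = coeff M (?n - ?m) * coeff T ?m"
      proof -
        have "coeff (M * T) ?n = (if ?n < ?n - ?m then 0 else lead_coeff P * coeff T (?n - (?n - ?m)))"
          unfolding M_def by (simp add: coeff_monom_mult)
        then show ?thesis using P unfolding M_def by simp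
      qed
      then show ?thesis unfolding P'_def M_def by (simp add: mult.commute)
    qed
    have lt: "(if P' = 0 then 0 else Suc (degree P')) < (if P = 0 then 0 else Suc ?n)"
    proof (cases "P' = 0")
      case False
      then have "degree P' \<noteq> ?n" using c0 leading_coeff_0_iff by metis
      then show ?thesis using False P dP' by simp
    qed (use P in simp)
    from less.hyps[OF lt P'B] obtain k S R where IH: "S \<in> polys_over B" "R \<in> polys_over B"
      "smult (?t ^ k) P' = S * T + R" "R = 0 \<or> degree R < ?m" "degree S \<le> degree P' - ?m" by blast
    have "smult (?t ^ Suc k) P = smult (?t ^ k) P' + smult (?t ^ k) (M * T)"
      unfolding P'_def by (simp add: smult_diff_right smult_smult mult.commute)
    also have "\<dots> = (S + smult (?t ^ k) M) * T + R"
      unfolding IH(3) by (simp add: algebra_simps)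
    finally have "smult (?t ^ Suc k) P = (S + smult (?t ^ k) M) * T + R" .
    moreover have "S + smult (?t ^ k) M \<in> polys_over B"
      by (intro PB IH polys_over_smult[OF B] is_subring_power[OF B] tB M)
    \<comment> \<open>The bound on the quotient is kept because it later forces a quotient to vanish
      by minimality of a degree.\<close>
    moreover have "degree (S + smult (?t ^ k) M) \<le> ?n - ?m"
    proof (rule degree_add_le)
      show "degree S \<le> ?n - ?m" using IH(5) dP' by linarith
      show "degree (smult (?t ^ k) M) \<le> ?n - ?m" using degree_smult_le[of "?t ^ k" M] dM by linarith
    qed
    ultimately show ?thesis using IH(2,4) by blast
  qed
qed

lemma is_subdomain_power_nonzero: "is_subdomain D \<Longrightarrow> x \<in> D \<Longrightarrow> x \<noteq> 0 \<Longrightarrow> (x::'r::comm_ring_1) ^ n \<noteq> 0"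
proof (induction n)
  case (Suc n)
  then show ?case by (auto simp: is_subdomain_def dest: is_subring_power[of D x n])
qed simp

text \<open>One generator of Chevalley's extension theorem. If y is transcendental over B, it is
  sent to a non-root of the image of a polynomial representing v; such a point exists because the
  field is infinite. If y is algebraic, it is sent to a root of the image of an annihilating
  polynomial P of least degree. In that case v divides a nonzero element c of B inside B[y], and v
  survives as soon as c does.\<close>

lemma hom_on_adjoin:
  fixes B D :: "'r::comm_ring_1 set"
  assumes D: "is_subdomain D" and B: "is_subring B" "B \<subseteq> D" and y: "y \<in> D"
    and v: "v \<in> adjoin B y" "v \<noteq> 0"
  shows "\<exists>c\<in>B. c \<noteq> 0 \<and> (\<forall>\<phi> :: 'r \<Rightarrow> 'k::{alg_closed_field,field_char_0}. hom_on B \<phi> \<and> \<phi> c \<noteq> 0 \<longrightarrow>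
    (\<exists>\<phi>'. hom_on (adjoin B y) \<phi>' \<and> (\<forall>b\<in>B. \<phi>' b = \<phi> b) \<and> \<phi>' v \<noteq> 0))"
proof -
  note PB = is_subringD[OF is_subring_polys_over[OF B(1)]]
  have Dr: "is_subring D" and dom: "\<And>x z. x \<in> D \<Longrightarrow> z \<in> D \<Longrightarrow> x * z = 0 \<Longrightarrow> x = 0 \<or> z = 0"
    using D by (auto simp: is_subdomain_def)
  have pD: "poly P y \<in> D" if "P \<in> polys_over B" for P
    using that B(2) y by (intro poly_in_subring[OF Dr]) (auto simp: polys_over_def)
  have lcB: "lead_coeff P \<in> B" if "P \<in> polys_over B" for P
    using that by (auto simp: polys_over_def)
  obtain Qv where Qv: "Qv \<in> polys_over B" "poly Qv y = v" using v(1) by (auto simp: adjoin_def)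
  show ?thesis
  proof (cases "\<exists>P\<in>polys_over B. P \<noteq> 0 \<and> poly P y = 0")
    case False
    have "Qv \<noteq> 0" using Qv v by auto
    show ?thesis
    proof (intro bexI[of _ "lead_coeff Qv"] conjI allI impI)
      fix \<phi> :: "'r \<Rightarrow> 'k" assume \<phi>: "hom_on B \<phi> \<and> \<phi> (lead_coeff Qv) \<noteq> 0"
      then have h: "hom_on B \<phi>" by simp
      have "coeff (map_poly \<phi> Qv) (degree Qv) \<noteq> 0"
        using \<phi> hom_onD(2)[OF h B(1)] by (simp add: coeff_map_poly)
      then have "map_poly \<phi> Qv \<noteq> 0" by auto
      then have "finite {\<xi>. poly (map_poly \<phi> Qv) \<xi> = 0}" by (rule poly_roots_finite)
      then obtain \<xi> where \<xi>: "poly (map_poly \<phi> Qv) \<xi> \<noteq> 0"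
        using infinite_UNIV_char_0[where ?'a='k] by (metis (mono_tags, lifting) UNIV_eq_I mem_Collect_eq)
      have "poly (map_poly \<phi> P) \<xi> = 0" if "P \<in> polys_over B" "poly P y = 0" for P
        using False that by auto
      from hom_on_extend_to[OF h B(1) this] obtain \<phi>' where
        "hom_on (adjoin B y) \<phi>'" "\<forall>b\<in>B. \<phi>' b = \<phi> b"
        "\<forall>P\<in>polys_over B. \<phi>' (poly P y) = poly (map_poly \<phi> P) \<xi>" by blast
      then show "\<exists>\<phi>'. hom_on (adjoin B y) \<phi>' \<and> (\<forall>b\<in>B. \<phi>' b = \<phi> b) \<and> \<phi>' v \<noteq> 0"
        using \<xi> Qv by (intro exI[of _ \<phi>']) auto
    qed (use \<open>Qv \<noteq> 0\<close> lcB Qv in auto)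
  next
    case True
    define isP where "isP P \<longleftrightarrow> P \<in> polys_over B \<and> P \<noteq> 0 \<and> poly P y = 0" for P
    obtain P where P: "isP P" and minP: "\<And>S. isP S \<Longrightarrow> degree P \<le> degree S"
      using ex_has_least_nat[of isP _ degree] True unfolding isP_def by blast
    then have P': "P \<in> polys_over B" "P \<noteq> 0" "poly P y = 0" by (auto simp: isP_def)
    have minP0: "S = 0" if "S \<in> polys_over B" "poly S y = 0" "degree S < degree P" for S
      using minP[of S] that by (auto simp: isP_def)
    have lP: "lead_coeff P \<in> B" "lead_coeff P \<noteq> 0" using lcB P' by auto
    have degP: "0 < degree P"
    proof (rule ccontr)
      assume "\<not> 0 < degree P"
      then obtain c where c: "P = [:c:]" by (metis degree_eq_zeroE neq0_conv)
      then show False using P' by simp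
    qed
    \<comment> \<open>These polynomials take a value at y that is a nonzero multiple of v in B[y].
      One of degree 0 is an element of B divisible by v, so the aim is to show that the least degree
      is 0.\<close>
    define isT where "isT T \<longleftrightarrow> T \<in> polys_over B \<and> poly T y \<noteq> 0 \<and>
      (\<exists>U\<in>polys_over B. poly T y = poly U y * v)" for T
    have "isT Qv" unfolding isT_def using Qv v PB(1) by (auto intro!: bexI[of _ 1])
    then obtain T where T: "isT T" and minT: "\<And>S. isT S \<Longrightarrow> degree T \<le> degree S"
      using ex_has_least_nat[of isT _ degree] by blast
    obtain U where T': "T \<in> polys_over B" "poly T y \<noteq> 0" "U \<in> polys_over B" "poly T y = poly U y * v"
      using T by (auto simp: isT_def)
    have T0: "T \<noteq> 0" using T' by auto
    \<comment> \<open>The pseudo-remainder of T by P has the same value at y up to a power of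
      \<open>lead_coeff P\<close>, which is nonzero in the domain D.\<close>
    have degT: "degree T < degree P"
    proof -
      obtain k S R where R: "S \<in> polys_over B" "R \<in> polys_over B"
        "smult (lead_coeff P ^ k) T = S * P + R" "R = 0 \<or> degree R < degree P"
        using pseudo_division_over[OF B(1) P'(1,2) T'(1)] by blast
      have "poly R y = lead_coeff P ^ k * poly T y"
        using arg_cong[OF R(3), of "\<lambda>X. poly X y"] P'(3) by simp
      moreover have "lead_coeff P ^ k * poly T y \<noteq> 0"
        using dom[OF is_subring_power[OF Dr] pD[OF T'(1)]] lP B(2) T'(2)
          is_subdomain_power_nonzero[OF D] by blast
      ultimately have "isT R"
        unfolding isT_def using R(2) T' is_subring_power[OF B(1) lP(1)]
        by (auto intro!: bexI[of _ "smult (lead_coeff P ^ k) U"] polys_over_smult[OF B(1)] simp: mult.assoc)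
      then have "degree T \<le> degree R" "R \<noteq> 0" using minT by (auto simp: isT_def)
      then show ?thesis using R(4) by auto
    qed
    \<comment> \<open>Otherwise divide P by T. The remainder satisfies R(y) = - S(y) T(y), again a
      multiple of v but of smaller degree than T, so R(y) = 0. Then S(y) = 0, and S = 0 since its
      degree is below that of P. A nonzero multiple of P would equal R, whose degree is too
      small.\<close>
    have "degree T = 0"
    proof (rule ccontr)
      assume d: "degree T \<noteq> 0"
      obtain k S R where R: "S \<in> polys_over B" "R \<in> polys_over B"
        "smult (lead_coeff T ^ k) P = S * T + R" "R = 0 \<or> degree R < degree T"
        "degree S \<le> degree P - degree T"
        using pseudo_division_over[OF B(1) T'(1) T0 P'(1)] by blast
      have Ry: "poly R y = - poly S y * poly T y"
        using arg_cong[OF R(3), of "\<lambda>X. poly X y"] P'(3) by (simp add: eq_neg_iff_add_eq_0 add.commute)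
      have "poly R y = 0"
      proof (rule ccontr)
        assume "poly R y \<noteq> 0"
        then have "isT R"
          unfolding isT_def using R Ry T' by (auto intro!: bexI[of _ "- S * U"] PB simp: mult.assoc)
        with minT have "degree T \<le> degree R" by auto
        then show False using R(4) d \<open>poly R y \<noteq> 0\<close> by auto
      qed
      then have "poly S y = 0"
        using Ry dom[OF pD[OF R(1)] pD[OF T'(1)]] T'(2) by auto
      then have "S = 0" using minP0[OF R(1)] R(5) d degT by auto
      then have "coeff (smult (lead_coeff T ^ k) P) (degree P) = coeff R (degree P)" using R(3) by simp
      also have "\<dots> = 0" using R(4) degT by (auto intro: coeff_eq_0)
      finally have "lead_coeff T ^ k * lead_coeff P = 0" by simp
      then show False
        using dom[OF is_subring_power[OF Dr]] lcB[OF T'(1)] lP B(2)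
          is_subdomain_power_nonzero[OF D, of "lead_coeff T" k] T0 by (metis leading_coeff_0_iff subsetD)
    qed
    then obtain c where c: "T = [:c:]" by (metis degree_eq_zeroE)
    have cB: "c \<in> B" "c \<noteq> 0" using T'(1) T0 c lcB[of T] by auto
    have cv: "c = poly U y * v" using T'(4) c by simp
    show ?thesis
    \<comment> \<open>The first factor keeps the image of P nonconstant, so that it has a root, and
      allows cancellation in the check of well-definedness. The second factor keeps v from being
      sent to 0.\<close>
    proof (intro bexI[of _ "lead_coeff P * c"] conjI allI impI)
      show "lead_coeff P * c \<noteq> 0" using dom lP cB B(2) by blast
      show "lead_coeff P * c \<in> B" using is_subringD(4)[OF B(1)] lP cB by blast
      fix \<phi> :: "'r \<Rightarrow> 'k" assume \<phi>: "hom_on B \<phi> \<and> \<phi> (lead_coeff P * c) \<noteq> 0"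
      then have h: "hom_on B \<phi>" by simp
      have nz: "\<phi> (lead_coeff P) \<noteq> 0" "\<phi> c \<noteq> 0" using \<phi> hom_onD(4)[OF h B(1)] lP cB by auto
      have "coeff (map_poly \<phi> P) (degree P) \<noteq> 0"
        using nz hom_onD(2)[OF h B(1)] by (simp add: coeff_map_poly)
      then have "0 < degree (map_poly \<phi> P)" using degP le_degree by fastforce
      from alg_closed_imp_poly_has_root[OF this] obtain \<xi> where \<xi>: "poly (map_poly \<phi> P) \<xi> = 0" by blast
      have wd: "poly (map_poly \<phi> S) \<xi> = 0" if S: "S \<in> polys_over B" "poly S y = 0" for S
      proof -
        obtain k W R where R: "W \<in> polys_over B" "R \<in> polys_over B"
          "smult (lead_coeff P ^ k) S = W * P + R" "R = 0 \<or> degree R < degree P"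
          using pseudo_division_over[OF B(1) P'(1,2) S(1)] by blast
        have "poly R y = 0" using arg_cong[OF R(3), of "\<lambda>X. poly X y"] P'(3) S(2) by simp
        then have "R = 0" using minP0[OF R(2)] R(4) by auto
        \<comment> \<open>The scalar is written as a constant polynomial so that multiplicativity of
          \<open>map_poly \<phi>\<close> applies.\<close>
        have "monom (lead_coeff P ^ k) 0 * S = W * P"
          using R(3) \<open>R = 0\<close> by (simp add: monom_0)
        then have "map_poly \<phi> (monom (lead_coeff P ^ k) 0) * map_poly \<phi> S = map_poly \<phi> W * map_poly \<phi> P"
          using map_poly_hom_on(2)[OF h B(1) polys_over_monom[OF B(1) is_subring_power[OF B(1) lP(1)]] S(1)]
            map_poly_hom_on(2)[OF h B(1) R(1) P'(1)] by metis
        then have "poly (map_poly \<phi> (monom (lead_coeff P ^ k) 0)) \<xi> * poly (map_poly \<phi> S) \<xi> = 0"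
          using \<xi> by (metis mult_zero_right poly_mult)
        then show ?thesis
          using nz hom_onD(2)[OF h B(1)] hom_on_power[OF h B(1) lP(1)]
          by (simp add: map_poly_monom poly_monom)
      qed
      from hom_on_extend_to[OF h B(1) wd] obtain \<phi>' where e:
        "hom_on (adjoin B y) \<phi>'" "\<forall>b\<in>B. \<phi>' b = \<phi> b" by blast
      have "\<phi>' c = \<phi>' (poly U y) * \<phi>' v"
        unfolding cv using hom_onD(4)[OF e(1) is_subring_adjoin[OF B(1)]] T'(3) v(1)
        by (auto simp: adjoin_def)
      then have "\<phi>' v \<noteq> 0" using e(2) cB nz by auto
      then show "\<exists>\<phi>'. hom_on (adjoin B y) \<phi>' \<and> (\<forall>b\<in>B. \<phi>' b = \<phi> b) \<and> \<phi>' v \<noteq> 0" using e by blast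
    qed
  qed
qed

text \<open>The element of B[y] that must survive for the remaining generators takes the role of v
  in the step for the first generator y.\<close>

lemma hom_on_adjoin_list:
  fixes B D :: "'r::comm_ring_1 set"
  assumes D: "is_subdomain D" and "is_subring B" "B \<subseteq> D" "set ys \<subseteq> D"
    and "v \<in> adjoin_list B ys" "v \<noteq> 0"
  shows "\<exists>c\<in>B. c \<noteq> 0 \<and> (\<forall>\<phi> :: 'r \<Rightarrow> 'k::{alg_closed_field,field_char_0}. hom_on B \<phi> \<and> \<phi> c \<noteq> 0 \<longrightarrow>
    (\<exists>\<phi>'. hom_on (adjoin_list B ys) \<phi>' \<and> (\<forall>b\<in>B. \<phi>' b = \<phi> b) \<and> \<phi>' v \<noteq> 0))"
  using assms(2-)
proof (induction ys arbitrary: B)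
  case Nil
  then show ?case by (auto intro!: bexI[of _ v])
next
  case (Cons y ys)
  let ?B' = "adjoin B y"
  have Dr: "is_subring D" using D by (simp add: is_subdomain_def)
  have "\<exists>c\<in>?B'. c \<noteq> 0 \<and> (\<forall>\<phi> :: 'r \<Rightarrow> 'k. hom_on ?B' \<phi> \<and> \<phi> c \<noteq> 0 \<longrightarrow>
    (\<exists>\<phi>'. hom_on (adjoin_list ?B' ys) \<phi>' \<and> (\<forall>b\<in>?B'. \<phi>' b = \<phi> b) \<and> \<phi>' v \<noteq> 0))"
    using Cons.prems by (intro Cons.IH is_subring_adjoin adjoin_subset[OF Dr]) auto
  then obtain c' where c': "c' \<in> ?B'" "c' \<noteq> 0"
    "\<And>\<phi> :: 'r \<Rightarrow> 'k. hom_on ?B' \<phi> \<Longrightarrow> \<phi> c' \<noteq> 0 \<Longrightarrow>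
    (\<exists>\<phi>'. hom_on (adjoin_list ?B' ys) \<phi>' \<and> (\<forall>b\<in>?B'. \<phi>' b = \<phi> b) \<and> \<phi>' v \<noteq> 0)" by blast
  obtain c where c: "c \<in> B" "c \<noteq> 0" "\<And>\<phi> :: 'r \<Rightarrow> 'k. hom_on B \<phi> \<Longrightarrow> \<phi> c \<noteq> 0 \<Longrightarrow>
    (\<exists>\<phi>'. hom_on ?B' \<phi>' \<and> (\<forall>b\<in>B. \<phi>' b = \<phi> b) \<and> \<phi>' c' \<noteq> 0)"
    using hom_on_adjoin[OF D Cons.prems(1,2) _ c'(1,2), where ?'k = 'k] Cons.prems by auto
  show ?case
  proof (intro bexI[OF _ c(1)] conjI c(2) allI impI)
    fix \<phi> :: "'r \<Rightarrow> 'k" assume "hom_on B \<phi> \<and> \<phi> c \<noteq> 0"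
    then obtain \<phi>1 where 1: "hom_on ?B' \<phi>1" "\<forall>b\<in>B. \<phi>1 b = \<phi> b" "\<phi>1 c' \<noteq> 0" using c(3) by blast
    then obtain \<phi>2 where 2: "hom_on (adjoin_list ?B' ys) \<phi>2" "\<forall>b\<in>?B'. \<phi>2 b = \<phi>1 b" "\<phi>2 v \<noteq> 0"
      using c'(3) by blast
    then show "\<exists>\<phi>'. hom_on (adjoin_list B (y # ys)) \<phi>' \<and> (\<forall>b\<in>B. \<phi>' b = \<phi> b) \<and> \<phi>' v \<noteq> 0"
      using 1 subset_adjoin[OF Cons.prems(1), of y] by (intro exI[of _ \<phi>2]) auto
  qed
qed

section \<open>The group action\<close>

text \<open>Subalgebras of the functions on a set, over the constants. Regularity along varying data
  (points, lines, GL x C, one-parameter groups) becomes membership in such a subalgebra, which needs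
  checking on matrix entries only.\<close>

definition fun_alg :: "('z \<Rightarrow> 'k::comm_ring_1) set \<Rightarrow> bool" where
  "fun_alg S \<longleftrightarrow> (\<forall>c. (\<lambda>_. c) \<in> S) \<and>
    (\<forall>f\<in>S. \<forall>g\<in>S. (\<lambda>z. f z + g z) \<in> S \<and> (\<lambda>z. f z * g z) \<in> S)"

lemma fun_algD:
  assumes "fun_alg S"
  shows "(\<lambda>_. c) \<in> S" "f \<in> S \<Longrightarrow> g \<in> S \<Longrightarrow> (\<lambda>z. f z + g z) \<in> S"
    "f \<in> S \<Longrightarrow> g \<in> S \<Longrightarrow> (\<lambda>z. f z * g z) \<in> S"
  using assms by (auto simp: fun_alg_def)

lemma fun_alg_diff:
  assumes S: "fun_alg S" and f: "f \<in> S" "g \<in> S"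
  shows "(\<lambda>z. f z - g z) \<in> S"
  using fun_algD(2)[OF S f(1) fun_algD(3)[OF S fun_algD(1)[OF S, of "-1"] f(2)]] by simp

lemma fun_alg_sum:
  assumes S: "fun_alg S" and "\<And>i. i \<in> I \<Longrightarrow> f i \<in> S"
  shows "(\<lambda>z. \<Sum>i\<in>I. f i z) \<in> S"
  using assms(2) by (induction I rule: infinite_finite_induct) (auto intro: fun_algD[OF S])

lemma fun_alg_prod:
  assumes S: "fun_alg S" and "\<And>i. i \<in> I \<Longrightarrow> f i \<in> S"
  shows "(\<lambda>z. \<Prod>i\<in>I. f i z) \<in> S"
  using assms(2) by (induction I rule: infinite_finite_induct) (auto intro: fun_algD[OF S])

lemma fun_alg_det:
  assumes S: "fun_alg S" and "\<And>z. M z \<in> carrier_mat n n"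
    and "\<And>i j. i < n \<Longrightarrow> j < n \<Longrightarrow> (\<lambda>z. M z $$ (i, j)) \<in> S"
  shows "(\<lambda>z. det (M z)) \<in> S"
proof -
  have eq: "det (M z) = (\<Sum>p\<in>{p. p permutes {0..<n}}. signof p * (\<Prod>i\<in>{0..<n}. M z $$ (i, p i)))" for z
    by (rule det_def'[OF assms(2)])
  show ?thesis
    unfolding eq
  proof (intro fun_alg_sum[OF S] fun_algD(3)[OF S fun_algD(1)[OF S]] fun_alg_prod[OF S])
    fix p i assume "p \<in> {p. p permutes {0..<n}}" "i \<in> {0..<n}"
    then show "(\<lambda>z. M z $$ (i, p i)) \<in> S"
      using assms(3)[of i "p i"] by (auto dest: permutes_in_image[of p "{0..<n}" i])
  qed
qed

lemma mult3_index:
  assumes "A \<in> carrier_mat n m" "B \<in> carrier_mat m l" "C \<in> carrier_mat l r" "i < n" "j < r"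
  shows "(A * B * C) $$ (i, j) = (\<Sum>k<m. \<Sum>q<l. A $$ (i, k) * B $$ (k, q) * C $$ (q, j))"
proof -
  have "(A * B * C) $$ (i, j) = (\<Sum>q<l. (\<Sum>k<m. A $$ (i, k) * B $$ (k, q)) * C $$ (q, j))"
    using assms by (auto simp: scalar_prod_def atLeast0LessThan simp del: assoc_mult_mat intro!: sum.cong)
  also have "\<dots> = (\<Sum>q<l. \<Sum>k<m. A $$ (i, k) * B $$ (k, q) * C $$ (q, j))"
    by (simp add: sum_distrib_right)
  also have "\<dots> = (\<Sum>k<m. \<Sum>q<l. A $$ (i, k) * B $$ (k, q) * C $$ (q, j))"
    by (rule sum.swap)
  finally show ?thesis .
qed

lemma fun_alg_poly_funs: "fun_alg (poly_funs Q \<beta>)"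
  by (auto simp: fun_alg_def intro: poly_funs.intros)

lemma fun_alg_compose_poly_fun:
  assumes f: "f \<in> poly_funs Q \<beta>" and S: "fun_alg S"
    and "\<And>a i j. a \<in> arcs Q \<Longrightarrow> i < \<beta> (head Q a) \<Longrightarrow> j < \<beta> (tail Q a) \<Longrightarrow> (\<lambda>z. \<Phi> z a $$ (i, j)) \<in> S"
  shows "(\<lambda>z. f (\<Phi> z)) \<in> S"
  using f by induction (auto intro: fun_algD[OF S] assms(3))

text \<open>The action and products of matrices are given by polynomial formulas only at tuples of
  the correct dimensions. Outside X nothing is known, hence agreement on X instead of
  equality.\<close>

lemma fun_alg_agree:
  assumes "fun_alg S"
  shows "fun_alg {F. \<exists>f\<in>S. \<forall>z\<in>X. F z = f z}"
  unfolding fun_alg_def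
proof (intro conjI allI ballI CollectI)
  fix c
  show "\<exists>f\<in>S. \<forall>z\<in>X. c = f z" by (rule bexI[OF _ fun_algD(1)[OF assms, of c]]) simp
next
  fix f g
  assume "f \<in> {F. \<exists>f\<in>S. \<forall>z\<in>X. F z = f z}" "g \<in> {F. \<exists>f\<in>S. \<forall>z\<in>X. F z = f z}"
  then obtain f' g' where *: "f' \<in> S" "g' \<in> S" "\<forall>z\<in>X. f z = f' z" "\<forall>z\<in>X. g z = g' z" by blast
  show "\<exists>h\<in>S. \<forall>z\<in>X. f z + g z = h z"
    by (rule bexI[OF _ fun_algD(2)[OF assms *(1,2)]]) (use * in simp)
  show "\<exists>h\<in>S. \<forall>z\<in>X. f z * g z = h z"
    by (rule bexI[OF _ fun_algD(3)[OF assms *(1,2)]]) (use * in simp)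
qed

section \<open>The group GL and its action on representations\<close>

locale quiver = fin_digraph Q for Q :: "('v, 'e) pre_digraph" +
  fixes \<beta> :: "'v \<Rightarrow> nat"
begin

lemma GL_carrier:
  fixes g :: "'v \<Rightarrow> 'k::field mat"
  assumes "g \<in> carrier (GL Q \<beta>)" "x \<in> verts Q"
  shows "g x \<in> carrier_mat (\<beta> x) (\<beta> x)" "det (g x) \<noteq> 0"
  using assms by (auto simp: GL_iff)

lemma GL_mult_apply: "x \<in> verts Q \<Longrightarrow> (g \<otimes>\<^bsub>GL Q \<beta>\<^esub> h) x = g x * (h x :: 'k::field mat)"
  by (simp add: GL_def product_group_def units_of_def ring_mat_simps)

lemma GL_one_apply: "x \<in> verts Q \<Longrightarrow> (\<one>\<^bsub>GL Q \<beta>\<^esub>) x = (1\<^sub>m (\<beta> x) :: 'k::field mat)"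
  by (simp add: GL_def product_group_def units_of_def ring_mat_simps)

lemma GL_inv:
  fixes g :: "'v \<Rightarrow> 'k::field mat"
  assumes "g \<in> carrier (GL Q \<beta>)"
  shows "inv\<^bsub>GL Q \<beta>\<^esub> g \<in> carrier (GL Q \<beta>)"
    "x \<in> verts Q \<Longrightarrow> (inv\<^bsub>GL Q \<beta>\<^esub> g) x \<in> carrier_mat (\<beta> x) (\<beta> x)"
    "x \<in> verts Q \<Longrightarrow> g x * (inv\<^bsub>GL Q \<beta>\<^esub> g) x = 1\<^sub>m (\<beta> x)"
    "x \<in> verts Q \<Longrightarrow> (inv\<^bsub>GL Q \<beta>\<^esub> g) x * g x = 1\<^sub>m (\<beta> x)"
proof -
  interpret G: group "GL Q \<beta> :: ('v \<Rightarrow> 'k mat) monoid" by (rule group_GL)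
  show i: "inv\<^bsub>GL Q \<beta>\<^esub> g \<in> carrier (GL Q \<beta>)" using assms by simp
  show "x \<in> verts Q \<Longrightarrow> (inv\<^bsub>GL Q \<beta>\<^esub> g) x \<in> carrier_mat (\<beta> x) (\<beta> x)" by (rule GL_carrier[OF i])
  show "x \<in> verts Q \<Longrightarrow> g x * (inv\<^bsub>GL Q \<beta>\<^esub> g) x = 1\<^sub>m (\<beta> x)"
    using G.r_inv[OF assms] by (metis GL_mult_apply GL_one_apply)
  show "x \<in> verts Q \<Longrightarrow> (inv\<^bsub>GL Q \<beta>\<^esub> g) x * g x = 1\<^sub>m (\<beta> x)"
    using G.l_inv[OF assms] by (metis GL_mult_apply GL_one_apply)
qed

lemma rep_spaceD: "V \<in> rep_space Q \<beta> \<Longrightarrow> a \<in> arcs Q \<Longrightarrow> V a \<in> carrier_mat (\<beta> (head Q a)) (\<beta> (tail Q a))"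
  by (auto simp: rep_space_def)

lemma rep_space_eqI:
  assumes "V \<in> rep_space Q \<beta>" "W \<in> rep_space Q \<beta>" "\<And>a. a \<in> arcs Q \<Longrightarrow> V a = W a"
  shows "V = W"
  using assms unfolding rep_space_def by (auto intro: PiE_ext)

lemma act_apply: "a \<in> arcs Q \<Longrightarrow> act Q \<beta> g V a = g (head Q a) * V a * (inv\<^bsub>GL Q \<beta>\<^esub> g) (tail Q a)"
  by (simp add: act_def)

lemma act_in_rep_space:
  fixes g :: "'v \<Rightarrow> 'k::field mat"
  assumes "g \<in> carrier (GL Q \<beta>)" "V \<in> rep_space Q \<beta>"
  shows "act Q \<beta> g V \<in> rep_space Q \<beta>"
proof -
  have "act Q \<beta> g V a \<in> carrier_mat (\<beta> (head Q a)) (\<beta> (tail Q a))" if a: "a \<in> arcs Q" for a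
    unfolding act_apply[OF a]
    by (rule mult_carrier_mat[OF mult_carrier_mat[OF GL_carrier(1)[OF assms(1)] rep_spaceD[OF assms(2) a]]
          GL_inv(2)[OF assms(1)]]) (use a in auto)
  then show ?thesis unfolding rep_space_def act_def by (auto simp: PiE_iff)
qed

text \<open>Removing the inverse leaves an intertwining condition that is bilinear in g and the
  representation. It chains along paths and is preserved by ring homomorphisms applied to matrix
  entries.\<close>

lemma act_eq_iff:
  fixes g :: "'v \<Rightarrow> 'k::field mat"
  assumes g: "g \<in> carrier (GL Q \<beta>)" and V: "V \<in> rep_space Q \<beta>" and W: "W \<in> rep_space Q \<beta>"
  shows "act Q \<beta> g V = W \<longleftrightarrow> (\<forall>a\<in>arcs Q. g (head Q a) * V a = W a * g (tail Q a))"
proof -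
  have "act Q \<beta> g V a = W a \<longleftrightarrow> g (head Q a) * V a = W a * g (tail Q a)" if a: "a \<in> arcs Q" for a
  proof -
    let ?n = "\<beta> (head Q a)" and ?m = "\<beta> (tail Q a)" and ?h = "(inv\<^bsub>GL Q \<beta>\<^esub> g) (tail Q a)"
    have c: "g (head Q a) \<in> carrier_mat ?n ?n" "V a \<in> carrier_mat ?n ?m" "W a \<in> carrier_mat ?n ?m"
      "g (tail Q a) \<in> carrier_mat ?m ?m" "?h \<in> carrier_mat ?m ?m"
      using GL_carrier(1)[OF g] GL_inv(2)[OF g] rep_spaceD[OF V] rep_spaceD[OF W] a by auto
    have i: "g (tail Q a) * ?h = 1\<^sub>m ?m" "?h * g (tail Q a) = 1\<^sub>m ?m"
      using GL_inv(3,4)[OF g] a by auto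
    have "g (head Q a) * V a * ?h * g (tail Q a) = g (head Q a) * V a * (?h * g (tail Q a))"
      using c by (intro assoc_mult_mat[of _ ?n ?m _ ?m _ ?m] mult_carrier_mat) auto
    moreover have "W a * g (tail Q a) * ?h = W a * (g (tail Q a) * ?h)"
      using c by (intro assoc_mult_mat) auto
    moreover have "g (head Q a) * V a \<in> carrier_mat ?n ?m" using c by (intro mult_carrier_mat)
    ultimately show ?thesis using c i a unfolding act_apply[OF a] by (metis right_mult_one_mat)
  qed
  then show ?thesis
    using rep_space_eqI[OF act_in_rep_space[OF g V] W] by auto
qed

lemma act_mult:
  fixes g h :: "'v \<Rightarrow> 'k::field mat"
  assumes g: "g \<in> carrier (GL Q \<beta>)" and h: "h \<in> carrier (GL Q \<beta>)" and V: "V \<in> rep_space Q \<beta>"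
  shows "act Q \<beta> (g \<otimes>\<^bsub>GL Q \<beta>\<^esub> h) V = act Q \<beta> g (act Q \<beta> h V)"
proof -
  interpret G: group "GL Q \<beta> :: ('v \<Rightarrow> 'k mat) monoid" by (rule group_GL)
  note W = act_in_rep_space[OF h V]
  note U = act_in_rep_space[OF g W]
  show ?thesis unfolding act_eq_iff[OF G.m_closed[OF g h] V U]
  proof
    fix a assume a: "a \<in> arcs Q"
    let ?n = "\<beta> (head Q a)" and ?m = "\<beta> (tail Q a)" and ?x = "head Q a" and ?y = "tail Q a"
    have v: "?x \<in> verts Q" "?y \<in> verts Q" using a by auto
    note c = GL_carrier(1)[OF g v(1)] GL_carrier(1)[OF h v(1)] GL_carrier(1)[OF g v(2)] GL_carrier(1)[OF h v(2)]
      rep_spaceD[OF V a] rep_spaceD[OF W a] rep_spaceD[OF U a]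
    have "g ?x * h ?x * V a = g ?x * (h ?x * V a)"
      using c by (intro assoc_mult_mat)
    also have "h ?x * V a = act Q \<beta> h V a * h ?y"
      using act_eq_iff[OF h V W] a by blast
    also have "g ?x * (act Q \<beta> h V a * h ?y) = g ?x * act Q \<beta> h V a * h ?y"
      using c by (intro assoc_mult_mat[symmetric])
    also have "g ?x * act Q \<beta> h V a = act Q \<beta> g (act Q \<beta> h V) a * g ?y"
      using act_eq_iff[OF g W U] a by blast
    also have "\<dots> * h ?y = act Q \<beta> g (act Q \<beta> h V) a * (g ?y * h ?y)"
      using c by (intro assoc_mult_mat)
    finally show "(g \<otimes>\<^bsub>GL Q \<beta>\<^esub> h) ?x * V a = act Q \<beta> g (act Q \<beta> h V) a * (g \<otimes>\<^bsub>GL Q \<beta>\<^esub> h) ?y"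
      using v by (simp add: GL_mult_apply)
  qed
qed

lemma act_one: "V \<in> rep_space Q \<beta> \<Longrightarrow> act Q \<beta> \<one>\<^bsub>GL Q \<beta>\<^esub> V = (V :: 'e \<Rightarrow> 'k::field mat)"
proof -
  interpret G: group "GL Q \<beta> :: ('v \<Rightarrow> 'k mat) monoid" by (rule group_GL)
  assume V: "V \<in> rep_space Q \<beta>"
  have "1\<^sub>m (\<beta> (head Q a)) * V a = V a * 1\<^sub>m (\<beta> (tail Q a))" if "a \<in> arcs Q" for a
    using rep_spaceD[OF V that] by (metis left_mult_one_mat right_mult_one_mat)
  then show ?thesis
    by (simp add: act_eq_iff[OF G.one_closed V V] GL_one_apply)
qed

lemma act_inv:
  fixes g :: "'v \<Rightarrow> 'k::field mat"
  assumes g: "g \<in> carrier (GL Q \<beta>)" and V: "V \<in> rep_space Q \<beta>"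
  shows "act Q \<beta> (inv\<^bsub>GL Q \<beta>\<^esub> g) (act Q \<beta> g V) = V" "act Q \<beta> g (act Q \<beta> (inv\<^bsub>GL Q \<beta>\<^esub> g) V) = V"
proof -
  interpret G: group "GL Q \<beta> :: ('v \<Rightarrow> 'k mat) monoid" by (rule group_GL)
  show "act Q \<beta> (inv\<^bsub>GL Q \<beta>\<^esub> g) (act Q \<beta> g V) = V"
    unfolding act_mult[OF G.inv_closed[OF g] g V, symmetric] G.l_inv[OF g] by (rule act_one[OF V])
  show "act Q \<beta> g (act Q \<beta> (inv\<^bsub>GL Q \<beta>\<^esub> g) V) = V"
    unfolding act_mult[OF g G.inv_closed[OF g] V, symmetric] G.r_inv[OF g] by (rule act_one[OF V])
qed

lemma act_index:
  fixes g :: "'v \<Rightarrow> 'k::field mat"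
  assumes g: "g \<in> carrier (GL Q \<beta>)" and V: "V \<in> rep_space Q \<beta>"
    and a: "a \<in> arcs Q" and ij: "i < \<beta> (head Q a)" "j < \<beta> (tail Q a)"
  shows "act Q \<beta> g V a $$ (i, j) = (\<Sum>k<\<beta> (head Q a). \<Sum>l<\<beta> (tail Q a).
    g (head Q a) $$ (i, k) * V a $$ (k, l) * (inv\<^bsub>GL Q \<beta>\<^esub> g) (tail Q a) $$ (l, j))"
  unfolding act_apply[OF a]
  by (rule mult3_index[OF GL_carrier(1)[OF g] rep_spaceD[OF V a] GL_inv(2)[OF g] ij]) (use a in auto)

lemma poly_fun_act:
  fixes g :: "'v \<Rightarrow> 'k::field mat"
  assumes f: "f \<in> poly_funs Q \<beta>" and g: "g \<in> carrier (GL Q \<beta>)"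
  shows "\<exists>f'\<in>poly_funs Q \<beta>. \<forall>V\<in>rep_space Q \<beta>. f (act Q \<beta> g V) = f' V"
proof -
  note P = fun_alg_poly_funs
  have "(\<lambda>V. f (act Q \<beta> g V)) \<in> {F. \<exists>f\<in>poly_funs Q \<beta>. \<forall>z\<in>rep_space Q \<beta>. F z = f z}"
  proof (rule fun_alg_compose_poly_fun[OF f fun_alg_agree[OF P]])
    fix a i j assume a: "a \<in> arcs Q" and ij: "i < \<beta> (head Q a)" "j < \<beta> (tail Q a)"
    have *: "(\<lambda>V. \<Sum>k<\<beta> (head Q a). \<Sum>l<\<beta> (tail Q a).
      g (head Q a) $$ (i, k) * V a $$ (k, l) * (inv\<^bsub>GL Q \<beta>\<^esub> g) (tail Q a) $$ (l, j)) \<in> poly_funs Q \<beta>"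
      by (intro fun_alg_sum[OF P] poly_funs.mult poly_funs.const poly_funs.coord a) auto
    then show "(\<lambda>V. act Q \<beta> g V a $$ (i, j)) \<in> {F. \<exists>f\<in>poly_funs Q \<beta>. \<forall>z\<in>rep_space Q \<beta>. F z = f z}"
      by (intro CollectI bexI[OF _ *] ballI) (rule act_index[OF g _ a ij])
  qed
  then show ?thesis by simp
qed

definition line :: "('v \<Rightarrow> 'k::field mat) \<Rightarrow> ('v \<Rightarrow> 'k mat) \<Rightarrow> 'k \<Rightarrow> 'v \<Rightarrow> 'k mat" where
  "line g h t = (\<lambda>x\<in>verts Q. mat (\<beta> x) (\<beta> x) (\<lambda>ij. g x $$ ij + t * (h x $$ ij - g x $$ ij)))"

text \<open>The common denominator of the entries of all inverses. Its zeros are the parameters at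
  which a line leaves GL.\<close>

definition det_prod :: "('v \<Rightarrow> 'k::field mat) \<Rightarrow> 'k" where
  "det_prod g = (\<Prod>x\<in>verts Q. det (g x))"

text \<open>This replaces the coordinate ring of \<open>GL\<close>: restricting to lines reduces its lack of zero divisors
  to polynomials in one variable.\<close>

definition GL_reg :: "(('v \<Rightarrow> 'k::field mat) \<Rightarrow> 'k) set" where
  "GL_reg = {F. \<forall>g\<in>carrier (GL Q \<beta>). \<forall>h\<in>carrier (GL Q \<beta>). \<exists>k p. \<forall>t.
     line g h t \<in> carrier (GL Q \<beta>) \<longrightarrow> F (line g h t) * det_prod (line g h t) ^ k = poly p t}"

lemma fun_alg_polys: "fun_alg {F :: 'k::comm_ring_1 \<Rightarrow> 'k. \<exists>p. \<forall>t. F t = poly p t}"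
proof -
  have "\<exists>p. \<forall>t. c = poly p t" for c :: 'k by (rule exI[of _ "[:c:]"]) simp
  moreover have "\<exists>r. \<forall>t. poly p t + poly q t = poly r t" "\<exists>r. \<forall>t. poly p t * poly q t = poly r t"
    for p q :: "'k poly"
    by (rule exI[of _ "p + q"], simp) (rule exI[of _ "p * q"], simp)
  ultimately show ?thesis by (auto simp: fun_alg_def)
qed

lemma line_carrier: "x \<in> verts Q \<Longrightarrow> line g h t x \<in> carrier_mat (\<beta> x) (\<beta> x)"
  by (simp add: line_def)

lemma line_in_GL: "line g h t \<in> carrier (GL Q \<beta>) \<longleftrightarrow> det_prod (line g h t) \<noteq> 0"
  by (auto simp: GL_iff det_prod_def line_def)

lemma line_0: "g \<in> carrier (GL Q \<beta>) \<Longrightarrow> line g h 0 = g"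
proof
  fix x assume g: "g \<in> carrier (GL Q \<beta>)"
  show "line g h 0 x = g x"
  proof (cases "x \<in> verts Q")
    case True
    then show ?thesis using GL_carrier(1)[OF g True] by (intro eq_matI) (auto simp: line_def)
  next
    case False
    then show ?thesis using g by (simp add: line_def GL_iff extensional_def)
  qed
qed

lemma line_1: "h \<in> carrier (GL Q \<beta>) \<Longrightarrow> line g h 1 = h"
proof
  fix x assume h: "h \<in> carrier (GL Q \<beta>)"
  show "line g h 1 x = h x"
  proof (cases "x \<in> verts Q")
    case True
    then show ?thesis using GL_carrier(1)[OF h True] by (intro eq_matI) (auto simp: line_def)
  next
    case False
    then show ?thesis using h by (simp add: line_def GL_iff extensional_def)
  qed
qed

lemma line_index_poly:
  assumes "x \<in> verts Q" "i < \<beta> x" "j < \<beta> x"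
  shows "(\<lambda>t. line g h t x $$ (i, j)) \<in> {F. \<exists>p. \<forall>t. F t = poly p t}"
  using assms
  by (intro CollectI exI[of _ "[:g x $$ (i, j), h x $$ (i, j) - g x $$ (i, j):]"] allI) (simp add: line_def)

lemma det_line_poly:
  assumes "x \<in> verts Q"
  shows "(\<lambda>t. det (line g h t x)) \<in> {F. \<exists>p. \<forall>t. F t = poly p t}"
proof (rule fun_alg_det[OF fun_alg_polys])
  show "line g h z x \<in> carrier_mat (\<beta> x) (\<beta> x)" for z by (rule line_carrier[OF assms])
qed (rule line_index_poly[OF assms])

lemma det_prod_line_poly: "\<exists>p. \<forall>t. det_prod (line g h t) = poly p t"
proof -
  have "(\<lambda>t. \<Prod>x\<in>verts Q. det (line g h t x)) \<in> {F. \<exists>p. \<forall>t. F t = poly p t}"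
    by (rule fun_alg_prod[OF fun_alg_polys det_line_poly])
  then show ?thesis unfolding det_prod_def by simp
qed

lemma GL_regE:
  assumes "F \<in> GL_reg" "g \<in> carrier (GL Q \<beta>)" "h \<in> carrier (GL Q \<beta>)"
  obtains k p where "\<And>t. line g h t \<in> carrier (GL Q \<beta>) \<Longrightarrow> F (line g h t) * det_prod (line g h t) ^ k = poly p t"
proof -
  have "\<forall>g\<in>carrier (GL Q \<beta>). \<forall>h\<in>carrier (GL Q \<beta>). \<exists>k p. \<forall>t.
     line g h t \<in> carrier (GL Q \<beta>) \<longrightarrow> F (line g h t) * det_prod (line g h t) ^ k = poly p t"
    using assms(1) unfolding GL_reg_def by (rule CollectD)
  from bspec[OF bspec[OF this assms(2)] assms(3)] that show thesis by iprover
qed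

lemma GL_reg_const: "(\<lambda>_. c) \<in> (GL_reg :: (('v \<Rightarrow> 'k::field mat) \<Rightarrow> 'k) set)"
  unfolding GL_reg_def
proof (rule CollectI, intro ballI, rule exI[where x = 0], rule exI[where x = "[:c:]"], rule allI, rule impI)
  fix g h :: "'v \<Rightarrow> 'k mat" and t
  show "c * det_prod (line g h t) ^ 0 = poly [:c:] t" by simp
qed

lemma GL_reg_add_mult:
  fixes F H :: "('v \<Rightarrow> 'k::field mat) \<Rightarrow> 'k"
  assumes F: "F \<in> GL_reg" and H: "H \<in> GL_reg"
  shows "(\<lambda>g. F g + H g) \<in> GL_reg" "(\<lambda>g. F g * H g) \<in> GL_reg"
proof -
  have *: "\<exists>k p. \<forall>t. line g h t \<in> carrier (GL Q \<beta>) \<longrightarrow> (F (line g h t) + H (line g h t)) * det_prod (line g h t) ^ k = poly p t"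
    "\<exists>k p. \<forall>t. line g h t \<in> carrier (GL Q \<beta>) \<longrightarrow> (F (line g h t) * H (line g h t)) * det_prod (line g h t) ^ k = poly p t"
    if gh: "g \<in> carrier (GL Q \<beta>)" "h \<in> carrier (GL Q \<beta>)" for g h
  proof -
    obtain k p where p: "\<And>t. line g h t \<in> carrier (GL Q \<beta>) \<Longrightarrow> F (line g h t) * det_prod (line g h t) ^ k = poly p t"
      by (rule GL_regE[OF F gh], rule that)
    obtain l q where q: "\<And>t. line g h t \<in> carrier (GL Q \<beta>) \<Longrightarrow> H (line g h t) * det_prod (line g h t) ^ l = poly q t"
      by (rule GL_regE[OF H gh], rule that)
    obtain d where d: "\<And>t. det_prod (line g h t) = poly d t" using det_prod_line_poly by blast
    have "(F (line g h t) + H (line g h t)) * det_prod (line g h t) ^ (k + l) = poly (p * d ^ l + q * d ^ k) t"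
      if "line g h t \<in> carrier (GL Q \<beta>)" for t
      unfolding poly_add poly_mult poly_power p[OF that, symmetric] q[OF that, symmetric] d[symmetric]
      by (simp add: power_add algebra_simps)
    then show "\<exists>k p. \<forall>t. line g h t \<in> carrier (GL Q \<beta>) \<longrightarrow> (F (line g h t) + H (line g h t)) * det_prod (line g h t) ^ k = poly p t"
      by iprover
    have "(F (line g h t) * H (line g h t)) * det_prod (line g h t) ^ (k + l) = poly (p * q) t"
      if "line g h t \<in> carrier (GL Q \<beta>)" for t
      unfolding poly_mult p[OF that, symmetric] q[OF that, symmetric]
      by (simp add: power_add algebra_simps)
    then show "\<exists>k p. \<forall>t. line g h t \<in> carrier (GL Q \<beta>) \<longrightarrow> (F (line g h t) * H (line g h t)) * det_prod (line g h t) ^ k = poly p t"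
      by iprover
  qed
  show "(\<lambda>g. F g + H g) \<in> GL_reg" unfolding GL_reg_def using *(1) by (intro CollectI ballI)
  show "(\<lambda>g. F g * H g) \<in> GL_reg" unfolding GL_reg_def using *(2) by (intro CollectI ballI)
qed

lemma fun_alg_GL_reg: "fun_alg (GL_reg :: (('v \<Rightarrow> 'k::field mat) \<Rightarrow> 'k) set)"
  unfolding fun_alg_def by (simp add: GL_reg_const GL_reg_add_mult)

lemma GL_reg_index:
  assumes "x \<in> verts Q" "i < \<beta> x" "j < \<beta> x"
  shows "(\<lambda>g. g x $$ (i, j)) \<in> (GL_reg :: (('v \<Rightarrow> 'b::field mat) \<Rightarrow> 'b) set)"
proof -
  have "\<exists>k p. \<forall>t. line g h t \<in> carrier (GL Q \<beta>) \<longrightarrow>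
    line g h t x $$ (i, j) * det_prod (line g h t) ^ k = poly p t" for g h :: "'v \<Rightarrow> 'b mat"
  proof -
    obtain p where "\<And>t. line g h t x $$ (i, j) = poly p t"
      using line_index_poly[OF assms, of g h] by auto
    then have "line g h t x $$ (i, j) * det_prod (line g h t) ^ 0 = poly p t" for t by simp
    then show ?thesis by iprover
  qed
  then show ?thesis unfolding GL_reg_def by (intro CollectI ballI)
qed

lemma GL_inv_adj:
  fixes g :: "'v \<Rightarrow> 'k::field mat"
  assumes g: "g \<in> carrier (GL Q \<beta>)" and x: "x \<in> verts Q"
  shows "det (g x) \<cdot>\<^sub>m (inv\<^bsub>GL Q \<beta>\<^esub> g) x = adj_mat (g x)"
proof -
  let ?n = "\<beta> x" and ?h = "(inv\<^bsub>GL Q \<beta>\<^esub> g) x"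
  note c = GL_carrier(1)[OF g x] GL_inv(2)[OF g x] adj_mat(1)[OF GL_carrier(1)[OF g x]]
  have "adj_mat (g x) = adj_mat (g x) * (g x * ?h)"
    using GL_inv(3)[OF g x] c by simp
  also have "\<dots> = adj_mat (g x) * g x * ?h"
    using c by (intro assoc_mult_mat[symmetric])
  also have "\<dots> = det (g x) \<cdot>\<^sub>m ?h"
    using adj_mat(3)[OF c(1)] c by (simp add: mult_smult_assoc_mat[of _ ?n ?n])
  finally show ?thesis ..
qed

text \<open>By Cramer's rule the entry is a cofactor divided by \<open>det (g x)\<close>.
  Multiplying the cofactor by the determinants at the other vertices turns the denominator into the
  first power of \<open>det_prod\<close>.\<close>

lemma GL_reg_inv_index:
  assumes x: "x \<in> verts Q" and ij: "i < \<beta> x" "j < \<beta> x"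
  shows "(\<lambda>g. (inv\<^bsub>GL Q \<beta>\<^esub> g) x $$ (i, j)) \<in> (GL_reg :: (('v \<Rightarrow> 'k::field mat) \<Rightarrow> 'k) set)"
  unfolding GL_reg_def
proof (intro CollectI ballI)
  fix g h :: "'v \<Rightarrow> 'k mat"
  let ?P = "{F :: 'k \<Rightarrow> 'k. \<exists>p. \<forall>t. F t = poly p t}"
  have "(\<lambda>t. det (mat_delete (line g h t x) j i)) \<in> ?P"
  proof (rule fun_alg_det[OF fun_alg_polys, where n = "\<beta> x - 1"])
    show "mat_delete (line g h z x) j i \<in> carrier_mat (\<beta> x - 1) (\<beta> x - 1)" for z
      by (rule mat_delete_carrier[OF line_carrier[OF x]])
    fix i' j' assume ij': "i' < \<beta> x - 1" "j' < \<beta> x - 1"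
    have "(\<lambda>t. line g h t x $$ (if i' < j then i' else Suc i', if j' < i then j' else Suc j')) \<in> ?P"
      using ij' by (intro line_index_poly[OF x]) auto
    then show "(\<lambda>z. mat_delete (line g h z x) j i $$ (i', j')) \<in> ?P"
      using ij' x by (simp add: mat_delete_def line_def)
  qed
  from fun_algD(3)[OF fun_alg_polys fun_algD(1)[OF fun_alg_polys, of "(-1)^(j + i)"] this]
  have "(\<lambda>t. adj_mat (line g h t x) $$ (i, j)) \<in> ?P"
    using ij x by (simp add: adj_mat_def cofactor_def line_def)
  moreover have "(\<lambda>t. \<Prod>y\<in>verts Q - {x}. det (line g h t y)) \<in> ?P"
    by (intro fun_alg_prod[OF fun_alg_polys] det_line_poly) auto
  ultimately have "(\<lambda>t. adj_mat (line g h t x) $$ (i, j) * (\<Prod>y\<in>verts Q - {x}. det (line g h t y))) \<in> ?P"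
    by (rule fun_algD(3)[OF fun_alg_polys])
  then obtain p where p: "\<And>t. adj_mat (line g h t x) $$ (i, j) * (\<Prod>y\<in>verts Q - {x}. det (line g h t y)) = poly p t"
    by auto
  have "(inv\<^bsub>GL Q \<beta>\<^esub> (line g h t)) x $$ (i, j) * det_prod (line g h t) = poly p t"
    if G: "line g h t \<in> carrier (GL Q \<beta>)" for t
  proof -
    have "adj_mat (line g h t x) $$ (i, j) = det (line g h t x) * (inv\<^bsub>GL Q \<beta>\<^esub> (line g h t)) x $$ (i, j)"
      unfolding GL_inv_adj[OF G x, symmetric] using GL_inv(2)[OF G x] ij by simp
    moreover have "det_prod (line g h t) = det (line g h t x) * (\<Prod>y\<in>verts Q - {x}. det (line g h t y))"
      unfolding det_prod_def by (rule prod.remove) (use x in auto)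
    ultimately show ?thesis unfolding p[symmetric] by (simp add: algebra_simps)
  qed
  then have "line g h t \<in> carrier (GL Q \<beta>) \<Longrightarrow>
    (inv\<^bsub>GL Q \<beta>\<^esub> (line g h t)) x $$ (i, j) * det_prod (line g h t) ^ 1 = poly p t" for t
    by simp
  then show "\<exists>k p. \<forall>t. line g h t \<in> carrier (GL Q \<beta>) \<longrightarrow>
    (inv\<^bsub>GL Q \<beta>\<^esub> line g h t) x $$ (i, j) * det_prod (line g h t) ^ k = poly p t"
    by iprover
qed

lemma GL_reg_cong:
  assumes "F \<in> GL_reg" "\<And>g. g \<in> carrier (GL Q \<beta>) \<Longrightarrow> F g = H g"
  shows "H \<in> GL_reg"
  using assms unfolding GL_reg_def by simp

lemma GL_reg_act:
  fixes V :: "'e \<Rightarrow> 'k::field mat"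
  assumes f: "f \<in> poly_funs Q \<beta>" and V: "V \<in> rep_space Q \<beta>"
  shows "(\<lambda>g. f (act Q \<beta> g V)) \<in> GL_reg"
proof (rule fun_alg_compose_poly_fun[OF f fun_alg_GL_reg])
  fix a i j assume a: "a \<in> arcs Q" and ij: "i < \<beta> (head Q a)" "j < \<beta> (tail Q a)"
  have "(\<lambda>g. \<Sum>k<\<beta> (head Q a). \<Sum>l<\<beta> (tail Q a).
    g (head Q a) $$ (i, k) * V a $$ (k, l) * (inv\<^bsub>GL Q \<beta>\<^esub> g) (tail Q a) $$ (l, j)) \<in> GL_reg"
    using a ij
    by (intro fun_alg_sum[OF fun_alg_GL_reg] fun_algD[OF fun_alg_GL_reg] GL_reg_index GL_reg_inv_index) auto
  then show "(\<lambda>g. act Q \<beta> g V a $$ (i, j)) \<in> GL_reg"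
    by (rule GL_reg_cong) (simp add: act_index[OF _ V a ij])
qed

text \<open>Join a point where F is nonzero to a point where H is nonzero. On this line F, H and
  \<open>det_prod\<close> come from nonzero polynomials in t, and over an infinite field some t
  avoids all their roots.\<close>

lemma GL_reg_domain:
  fixes F H :: "('v \<Rightarrow> 'k::field_char_0 mat) \<Rightarrow> 'k"
  assumes F: "F \<in> GL_reg" and H: "H \<in> GL_reg" and z: "\<And>g. g \<in> carrier (GL Q \<beta>) \<Longrightarrow> F g * H g = 0"
  shows "(\<forall>g\<in>carrier (GL Q \<beta>). F g = 0) \<or> (\<forall>g\<in>carrier (GL Q \<beta>). H g = 0)"
proof (rule ccontr)
  assume "\<not> ?thesis"
  then obtain g h where g: "g \<in> carrier (GL Q \<beta>)" "F g \<noteq> 0" and h: "h \<in> carrier (GL Q \<beta>)" "H h \<noteq> 0" by blast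
  obtain k p where p: "\<And>t. line g h t \<in> carrier (GL Q \<beta>) \<Longrightarrow> F (line g h t) * det_prod (line g h t) ^ k = poly p t"
    by (rule GL_regE[OF F g(1) h(1)], rule that)
  obtain l q where q: "\<And>t. line g h t \<in> carrier (GL Q \<beta>) \<Longrightarrow> H (line g h t) * det_prod (line g h t) ^ l = poly q t"
    by (rule GL_regE[OF H g(1) h(1)], rule that)
  obtain d where d: "\<And>t. det_prod (line g h t) = poly d t" using det_prod_line_poly by blast
  have "poly p 0 \<noteq> 0" "poly d 0 \<noteq> 0"
    using p[of 0] d[of 0] g line_0[OF g(1)] line_in_GL[of g h 0] by auto
  moreover have "poly q 1 \<noteq> 0"
    using q[of 1] h line_1[OF h(1)] line_in_GL[of g h 1] by auto
  ultimately have "p * q * d \<noteq> 0" by auto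
  then have "finite {t. poly (p * q * d) t = 0}" by (rule poly_roots_finite)
  then obtain t where t: "poly (p * q * d) t \<noteq> 0"
    using infinite_UNIV_char_0[where ?'a='k] by (metis (mono_tags, lifting) UNIV_eq_I mem_Collect_eq)
  then have L: "line g h t \<in> carrier (GL Q \<beta>)" using d[of t] by (auto simp: line_in_GL)
  have "F (line g h t) \<noteq> 0" using p[OF L] t by auto
  moreover have "H (line g h t) \<noteq> 0" using q[OF L] t by auto
  ultimately show False using z[OF L] by simp
qed

end

section \<open>Irreducible components of the representation variety\<close>

context quiver
begin

lemma closedin_subtopology_zariski:
  fixes X :: "('e \<Rightarrow> 'k::field mat) set"
  assumes X: "X \<subseteq> rep_space Q \<beta>"
  shows "closedin (subtopology (zariski Q \<beta>) X) A \<longleftrightarrow>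
    (\<exists>F\<subseteq>poly_funs Q \<beta>. A = {V \<in> X. \<forall>f\<in>F. f V = 0})"
proof -
  have "{V \<in> rep_space Q \<beta>. \<forall>f\<in>F. f V = 0} \<inter> X = {V \<in> X. \<forall>f\<in>F. f V = 0}" for F
    using X by auto
  then show ?thesis
    unfolding closedin_subtopology closedin_zariski by (auto simp only: ex_simps simp_thms)
qed

lemma openin_zariskiE:
  fixes U :: "('e \<Rightarrow> 'k::field mat) set"
  assumes "openin (zariski Q \<beta>) U"
  obtains F where "F \<subseteq> poly_funs Q \<beta>" "U = {V \<in> rep_space Q \<beta>. \<exists>f\<in>F. f V \<noteq> 0}"
  using iffD1[OF openin_zariski assms] by (elim exE conjE) (rule that)

text \<open>A closed set not containing S lies in a hypersurface not containing S, so coverings by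
  two closed sets reduce to coverings by two hypersurfaces, that is, to products of functions
  vanishing on S.\<close>

lemma irreducible_in_zariski_iff:
  fixes X :: "('e \<Rightarrow> 'k::field mat) set"
  assumes X: "X \<subseteq> rep_space Q \<beta>"
  shows "irreducible_in (subtopology (zariski Q \<beta>) X) S \<longleftrightarrow> S \<subseteq> X \<and> S \<noteq> {} \<and>
    (\<forall>f\<in>poly_funs Q \<beta>. \<forall>h\<in>poly_funs Q \<beta>. (\<forall>V\<in>S. f V * h V = 0) \<longrightarrow>
      (\<forall>V\<in>S. f V = 0) \<or> (\<forall>V\<in>S. h V = 0))" (is "?L \<longleftrightarrow> ?R")
proof -
  let ?T = "subtopology (zariski Q \<beta>) X"
  have top: "topspace ?T = X" using X by (auto simp: topspace_zariski)
  note cl = closedin_subtopology_zariski[OF X]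
  have clE: thesis if "closedin ?T A"
    "\<And>F. F \<subseteq> poly_funs Q \<beta> \<Longrightarrow> A = {V \<in> X. \<forall>f\<in>F. f V = 0} \<Longrightarrow> thesis" for A thesis
    using iffD1[OF cl that(1)] by (elim exE conjE) (rule that(2))
  show ?thesis
  proof
    assume L: ?L
    have "(\<forall>V\<in>S. f V = 0) \<or> (\<forall>V\<in>S. h V = 0)"
      if f: "f \<in> poly_funs Q \<beta>" "h \<in> poly_funs Q \<beta>" and z: "\<forall>V\<in>S. f V * h V = 0" for f h
    proof -
      have c1: "closedin ?T {V \<in> X. f V = 0}" if "f \<in> poly_funs Q \<beta>" for f
        unfolding cl by (rule exI[where x = "{f}"]) (use that in simp)
      have "closedin ?T {V \<in> X. f V = 0}" "closedin ?T {V \<in> X. h V = 0}"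
        using c1 f by simp_all
      moreover have "S \<subseteq> {V \<in> X. f V = 0} \<union> {V \<in> X. h V = 0}"
        using z L unfolding irreducible_in_def top by auto
      ultimately have "S \<subseteq> {V \<in> X. f V = 0} \<or> S \<subseteq> {V \<in> X. h V = 0}"
        using L unfolding irreducible_in_def by blast
      then show ?thesis by auto
    qed
    moreover have "S \<subseteq> X" "S \<noteq> {}" using L unfolding irreducible_in_def top by simp_all
    ultimately show ?R by (intro conjI ballI impI)
  next
    assume R: ?R
    then have SX: "S \<subseteq> X" "S \<noteq> {}" by simp_all
    have dom: "(\<forall>V\<in>S. f V = 0) \<or> (\<forall>V\<in>S. h V = 0)"
      if "f \<in> poly_funs Q \<beta>" "h \<in> poly_funs Q \<beta>" "\<forall>V\<in>S. f V * h V = 0" for f h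
      using bspec[OF bspec[OF R[THEN conjunct2, THEN conjunct2] that(1)] that(2)] that(3) by (rule mp)
    have "S \<subseteq> A \<or> S \<subseteq> B" if AB: "closedin ?T A" "closedin ?T B" "S \<subseteq> A \<union> B" for A B
    proof (rule ccontr)
      assume n: "\<not> (S \<subseteq> A \<or> S \<subseteq> B)"
      obtain F where F: "F \<subseteq> poly_funs Q \<beta>" "A = {V \<in> X. \<forall>f\<in>F. f V = 0}"
        by (rule clE[OF AB(1)], rule that)
      obtain H where H: "H \<subseteq> poly_funs Q \<beta>" "B = {V \<in> X. \<forall>f\<in>H. f V = 0}"
        by (rule clE[OF AB(2)], rule that)
      obtain V f where V: "V \<in> S" "f \<in> F" "f V \<noteq> 0" using n F(2) SX(1) by auto
      obtain W h where W: "W \<in> S" "h \<in> H" "h W \<noteq> 0" using n H(2) SX(1) by auto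
      have "\<forall>V\<in>S. f V * h V = 0"
      proof
        fix U assume "U \<in> S"
        then have "U \<in> A \<or> U \<in> B" using AB(3) by blast
        then show "f U * h U = 0" using F(2) H(2) V(2) W(2) by auto
      qed
      moreover have "f \<in> poly_funs Q \<beta>" "h \<in> poly_funs Q \<beta>" using F(1) H(1) V(2) W(2) by auto
      ultimately have "(\<forall>V\<in>S. f V = 0) \<or> (\<forall>V\<in>S. h V = 0)" by (intro dom)
      then show False using V W by blast
    qed
    then show ?L unfolding irreducible_in_def top using SX by simp
  qed
qed

lemma poly_fun_actE:
  fixes g :: "'v \<Rightarrow> 'k::field mat"
  assumes f: "f \<in> poly_funs Q \<beta>" and g: "g \<in> carrier (GL Q \<beta>)"
  obtains f' where "f' \<in> poly_funs Q \<beta>" "\<And>V. V \<in> rep_space Q \<beta> \<Longrightarrow> f (act Q \<beta> g V) = f' V"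
proof -
  obtain f' where f': "f' \<in> poly_funs Q \<beta>" "\<forall>V\<in>rep_space Q \<beta>. f (act Q \<beta> g V) = f' V"
    using poly_fun_act[OF f g] by (elim bexE) (rule that)
  show thesis by (rule that[OF f'(1) bspec[OF f'(2)]])
qed

lemma zariski_closure_of:
  fixes S :: "('e \<Rightarrow> 'k::field mat) set"
  shows "zariski Q \<beta> closure_of S =
    {V \<in> rep_space Q \<beta>. \<forall>f\<in>poly_funs Q \<beta>. (\<forall>W\<in>S \<inter> rep_space Q \<beta>. f W = 0) \<longrightarrow> f V = 0}" (is "?L = ?R")
proof
  show "?L \<subseteq> ?R"
  proof
    fix V assume "V \<in> ?L"
    then have V: "V \<in> rep_space Q \<beta>"
        "\<And>U. V \<in> U \<Longrightarrow> openin (zariski Q \<beta>) U \<Longrightarrow> \<exists>W\<in>S. W \<in> U"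
      unfolding in_closure_of topspace_zariski by auto
    have "f V = 0" if f: "f \<in> poly_funs Q \<beta>" "\<forall>W\<in>S \<inter> rep_space Q \<beta>. f W = 0" for f
    proof (rule ccontr)
      assume nz: "f V \<noteq> 0"
      have "openin (zariski Q \<beta>) {W \<in> rep_space Q \<beta>. f W \<noteq> 0}"
        unfolding openin_zariski by (rule exI[where x = "{f}"]) (use f(1) in simp)
      from V(2)[OF _ this] have "\<exists>W\<in>S. W \<in> {W \<in> rep_space Q \<beta>. f W \<noteq> 0}"
        using V(1) nz by simp
      then show False using f by auto
    qed
    then show "V \<in> ?R" using V(1) by simp
  qed
  show "?R \<subseteq> ?L"
  proof
    fix V assume V: "V \<in> ?R"
    have "\<exists>W\<in>S. W \<in> U" if U: "V \<in> U" "openin (zariski Q \<beta>) U" for U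
    proof -
      obtain F where F: "F \<subseteq> poly_funs Q \<beta>" "U = {V \<in> rep_space Q \<beta>. \<exists>f\<in>F. f V \<noteq> 0}"
        by (rule openin_zariskiE[OF U(2)])
      then obtain f where f: "f \<in> F" "f V \<noteq> 0" using U(1) by auto
      then obtain W where W: "W \<in> S \<inter> rep_space Q \<beta>" "f W \<noteq> 0" using V F(1) by auto
      then have "W \<in> U" unfolding F(2) using f(1) by auto
      then show ?thesis using W(1) by auto
    qed
    then show "V \<in> ?L" using V unfolding in_closure_of topspace_zariski by auto
  qed
qed

section \<open>The locus of the relations is stable under GL and closed\<close>

lemma path_mat_carrier:
  fixes V :: "'e \<Rightarrow> 'k::field mat"
  assumes V: "V \<in> rep_space Q \<beta>"
  shows "awalk x p y \<Longrightarrow> path_mat Q \<beta> V x p \<in> carrier_mat (\<beta> y) (\<beta> x)"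
proof (induction p arbitrary: x)
  case Nil
  then show ?case by (auto simp: awalk_Nil_iff)
next
  case (Cons a p)
  then have a: "a \<in> arcs Q" "tail Q a = x" "awalk (head Q a) p y" by (auto simp: awalk_Cons_iff)
  then show ?case using Cons.IH[OF a(3)] rep_spaceD[OF V a(1)] by auto
qed

text \<open>In this form without inverses the group elements at intermediate vertices cancel along
  the path.\<close>

lemma path_mat_act:
  fixes V :: "'e \<Rightarrow> 'k::field mat"
  assumes V: "V \<in> rep_space Q \<beta>" and g: "g \<in> carrier (GL Q \<beta>)"
  shows "awalk x p y \<Longrightarrow> path_mat Q \<beta> (act Q \<beta> g V) x p * g x = g y * path_mat Q \<beta> V x p"
proof (induction p arbitrary: x)
  case Nil
  then show ?case using GL_carrier(1)[OF g, of x] by (auto simp: awalk_Nil_iff)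
next
  case (Cons a p)
  then have a: "a \<in> arcs Q" "tail Q a = x" "awalk (head Q a) p y" by (auto simp: awalk_Cons_iff)
  let ?W = "act Q \<beta> g V" and ?h = "head Q a"
  note W = act_in_rep_space[OF g V]
  have v: "?h \<in> verts Q" "x \<in> verts Q" "y \<in> verts Q" using a by auto
  note c = path_mat_carrier[OF V a(3)] path_mat_carrier[OF W a(3)] rep_spaceD[OF V a(1), unfolded a(2)]
    rep_spaceD[OF W a(1), unfolded a(2)] GL_carrier(1)[OF g v(1)] GL_carrier(1)[OF g v(2)] GL_carrier(1)[OF g v(3)]
  have "path_mat Q \<beta> ?W ?h p * ?W a * g x = path_mat Q \<beta> ?W ?h p * (?W a * g x)"
    using c by (intro assoc_mult_mat)
  also have "?W a * g x = g ?h * V a" using act_eq_iff[OF g V W] a by metis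
  also have "path_mat Q \<beta> ?W ?h p * (g ?h * V a) = path_mat Q \<beta> ?W ?h p * g ?h * V a"
    using c by (intro assoc_mult_mat[symmetric])
  also have "\<dots> = g y * path_mat Q \<beta> V ?h p * V a" unfolding Cons.IH[OF a(3)] ..
  also have "\<dots> = g y * (path_mat Q \<beta> V ?h p * V a)" using c by (intro assoc_mult_mat)
  finally show ?case by simp
qed

lemma path_mat_act_eq:
  fixes V :: "'e \<Rightarrow> 'k::field mat"
  assumes V: "V \<in> rep_space Q \<beta>" and g: "g \<in> carrier (GL Q \<beta>)" and w: "awalk x p y"
  shows "path_mat Q \<beta> (act Q \<beta> g V) x p = g y * path_mat Q \<beta> V x p * (inv\<^bsub>GL Q \<beta>\<^esub> g) x"
proof -
  have x: "x \<in> verts Q" using w by auto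
  note c = path_mat_carrier[OF act_in_rep_space[OF g V] w]
  have "path_mat Q \<beta> (act Q \<beta> g V) x p = path_mat Q \<beta> (act Q \<beta> g V) x p * (g x * (inv\<^bsub>GL Q \<beta>\<^esub> g) x)"
    using GL_inv(3)[OF g x] c by simp
  also have "\<dots> = path_mat Q \<beta> (act Q \<beta> g V) x p * g x * (inv\<^bsub>GL Q \<beta>\<^esub> g) x"
    by (rule assoc_mult_mat[OF c GL_carrier(1)[OF g x] GL_inv(2)[OF g x], symmetric])
  finally show ?thesis unfolding path_mat_act[OF V g w] .
qed

lemma rep_varietyD:
  fixes V :: "'e \<Rightarrow> 'k::field mat"
  assumes "V \<in> rep_variety Q R \<beta>" "x \<in> verts Q" "y \<in> verts Q" "u \<in> R" "uniform Q x y u" "i < \<beta> y" "j < \<beta> x"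
  shows "(\<Sum>(s, p, t)\<in>Poly_Mapping.keys u. Poly_Mapping.lookup u (s, p, t) * path_mat Q \<beta> V s p $$ (i, j)) = 0"
proof -
  have "eval_uniform Q \<beta> V x y u $$ (i, j) = 0\<^sub>m (\<beta> y) (\<beta> x) $$ (i, j)"
    using assms unfolding rep_variety_def by auto
  then show ?thesis using assms(6,7) by (simp add: eval_uniform_def)
qed

lemma rep_varietyI:
  fixes V :: "'e \<Rightarrow> 'k::field mat"
  assumes "V \<in> rep_space Q \<beta>"
    and "\<And>x y u i j. x \<in> verts Q \<Longrightarrow> y \<in> verts Q \<Longrightarrow> u \<in> R \<Longrightarrow> uniform Q x y u \<Longrightarrow> i < \<beta> y \<Longrightarrow> j < \<beta> x \<Longrightarrow>
      (\<Sum>(s, p, t)\<in>Poly_Mapping.keys u. Poly_Mapping.lookup u (s, p, t) * path_mat Q \<beta> V s p $$ (i, j)) = 0"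
  shows "V \<in> rep_variety Q R \<beta>"
  unfolding rep_variety_def using assms by (auto simp: eval_uniform_def intro!: eq_matI)

lemma uniform_keysD:
  assumes "uniform Q x y u" "(s, p, t) \<in> Poly_Mapping.keys u"
  shows "s = x" "t = y" "awalk x p y"
  using assms by (auto simp: uniform_def)

text \<open>A uniform relation has one tail and one head, so its value at gV is g_y V(u) g_x^-1.
  Each entry is a linear combination of entries of V(u), which vanish.\<close>

lemma act_in_rep_variety:
  fixes V :: "'e \<Rightarrow> 'k::field mat"
  assumes V: "V \<in> rep_variety Q R \<beta>" and g: "g \<in> carrier (GL Q \<beta>)"
  shows "act Q \<beta> g V \<in> rep_variety Q R \<beta>"
proof (rule rep_varietyI)
  have Vs: "V \<in> rep_space Q \<beta>" using V by (simp add: rep_variety_def)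
  show "act Q \<beta> g V \<in> rep_space Q \<beta>" by (rule act_in_rep_space[OF g Vs])
  fix x y u i j
  assume x: "x \<in> verts Q" and y: "y \<in> verts Q" and u: "u \<in> R" "uniform Q x y u" and ij: "i < \<beta> y" "j < \<beta> x"
  let ?c = "Poly_Mapping.lookup u" and ?h = "(inv\<^bsub>GL Q \<beta>\<^esub> g) x"
  have "(\<Sum>(s, p, t)\<in>Poly_Mapping.keys u. ?c (s, p, t) * path_mat Q \<beta> (act Q \<beta> g V) s p $$ (i, j))
    = (\<Sum>(s, p, t)\<in>Poly_Mapping.keys u. \<Sum>k<\<beta> y. \<Sum>l<\<beta> x.
        g y $$ (i, k) * (?c (s, p, t) * path_mat Q \<beta> V s p $$ (k, l)) * ?h $$ (l, j))"
  proof (rule sum.cong[OF refl], clarify)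
    fix s p t assume k: "(s, p, t) \<in> Poly_Mapping.keys u"
    note w = uniform_keysD[OF u(2) k]
    have "path_mat Q \<beta> (act Q \<beta> g V) x p $$ (i, j) = (\<Sum>k<\<beta> y. \<Sum>l<\<beta> x.
        g y $$ (i, k) * path_mat Q \<beta> V x p $$ (k, l) * ?h $$ (l, j))"
      unfolding path_mat_act_eq[OF Vs g w(3)]
      by (rule mult3_index[OF GL_carrier(1)[OF g y] path_mat_carrier[OF Vs w(3)] GL_inv(2)[OF g x] ij])
    then show "?c (s, p, t) * path_mat Q \<beta> (act Q \<beta> g V) s p $$ (i, j) = (\<Sum>k<\<beta> y. \<Sum>l<\<beta> x.
        g y $$ (i, k) * (?c (s, p, t) * path_mat Q \<beta> V s p $$ (k, l)) * ?h $$ (l, j))"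
      unfolding w(1) by (simp add: sum_distrib_left mult_ac)
  qed
  also have "\<dots> = (\<Sum>k<\<beta> y. \<Sum>l<\<beta> x. \<Sum>(s, p, t)\<in>Poly_Mapping.keys u.
        g y $$ (i, k) * (?c (s, p, t) * path_mat Q \<beta> V s p $$ (k, l)) * ?h $$ (l, j))"
    unfolding split_beta by (subst sum.swap, rule sum.cong[OF refl], rule sum.swap)
  also have "\<dots> = (\<Sum>k<\<beta> y. \<Sum>l<\<beta> x. g y $$ (i, k) * (\<Sum>(s, p, t)\<in>Poly_Mapping.keys u.
        ?c (s, p, t) * path_mat Q \<beta> V s p $$ (k, l)) * ?h $$ (l, j))"
    by (simp add: sum_distrib_left sum_distrib_right split_beta)
  also have "\<dots> = 0"
    using rep_varietyD[OF V x y u] by (intro sum.neutral ballI) simp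
  finally show "(\<Sum>(s, p, t)\<in>Poly_Mapping.keys u. ?c (s, p, t) * path_mat Q \<beta> (act Q \<beta> g V) s p $$ (i, j)) = 0" .
qed

lemma path_mat_poly_fun:
  "awalk x p y \<Longrightarrow> i < \<beta> y \<Longrightarrow> j < \<beta> x \<Longrightarrow>
    (\<lambda>V :: 'e \<Rightarrow> 'k::field mat. path_mat Q \<beta> V x p $$ (i, j)) \<in>
      {F. \<exists>f\<in>poly_funs Q \<beta>. \<forall>V\<in>rep_space Q \<beta>. F V = f V}"
proof (induction p arbitrary: x j)
  case Nil
  then show ?case by (intro CollectI bexI[OF _ poly_funs.const[of "1\<^sub>m (\<beta> x) $$ (i, j)"]]) simp
next
  case (Cons a p)
  then have a: "a \<in> arcs Q" "tail Q a = x" "awalk (head Q a) p y" by (auto simp: awalk_Cons_iff)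
  note A = fun_alg_agree[OF fun_alg_poly_funs[of Q \<beta>], of "rep_space Q \<beta> :: ('e \<Rightarrow> 'k mat) set"]
  have "(\<lambda>V :: 'e \<Rightarrow> 'k mat. \<Sum>k<\<beta> (head Q a). path_mat Q \<beta> V (head Q a) p $$ (i, k) * V a $$ (k, j)) \<in>
      {F. \<exists>f\<in>poly_funs Q \<beta>. \<forall>V\<in>rep_space Q \<beta>. F V = f V}"
  proof (rule fun_alg_sum[OF A], rule fun_algD(3)[OF A])
    fix k assume k: "k \<in> {..<\<beta> (head Q a)}"
    then show "(\<lambda>V :: 'e \<Rightarrow> 'k mat. path_mat Q \<beta> V (head Q a) p $$ (i, k)) \<in>
      {F. \<exists>f\<in>poly_funs Q \<beta>. \<forall>V\<in>rep_space Q \<beta>. F V = f V}"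
      using Cons.IH[OF a(3) Cons.prems(2)] by auto
    have "(\<lambda>V :: 'e \<Rightarrow> 'k mat. V a $$ (k, j)) \<in> poly_funs Q \<beta>"
      using k a Cons.prems by (intro poly_funs.coord) auto
    then show "(\<lambda>V :: 'e \<Rightarrow> 'k mat. V a $$ (k, j)) \<in> {F. \<exists>f\<in>poly_funs Q \<beta>. \<forall>V\<in>rep_space Q \<beta>. F V = f V}"
      by (intro CollectI bexI[where x = "\<lambda>V. V a $$ (k, j)"]) simp_all
  qed
  then obtain f where f: "f \<in> poly_funs Q \<beta>" "\<And>V :: 'e \<Rightarrow> 'k mat. V \<in> rep_space Q \<beta> \<Longrightarrow>
    (\<Sum>k<\<beta> (head Q a). path_mat Q \<beta> V (head Q a) p $$ (i, k) * V a $$ (k, j)) = f V" by auto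
  have "path_mat Q \<beta> V x (a # p) $$ (i, j) = f V" if V: "V \<in> rep_space Q \<beta>" for V :: "'e \<Rightarrow> 'k mat"
    unfolding f(2)[OF V, symmetric]
    using path_mat_carrier[OF V a(3)] rep_spaceD[OF V a(1)] Cons.prems a(2)
    by (auto simp: scalar_prod_def atLeast0LessThan intro!: sum.cong)
  then show ?case using f(1) by blast
qed

text \<open>The entries of V(u) agree on the representation space with polynomial functions that
  vanish on the variety, so the hypothesis applies to each of them.\<close>

lemma rep_variety_closed:
  fixes V :: "'e \<Rightarrow> 'k::field mat"
  assumes V: "V \<in> rep_space Q \<beta>"
    and z: "\<And>f. f \<in> poly_funs Q \<beta> \<Longrightarrow> (\<forall>W\<in>rep_variety Q R \<beta>. f W = 0) \<Longrightarrow> f V = 0"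
  shows "V \<in> rep_variety Q R \<beta>"
proof (rule rep_varietyI[OF V])
  fix x y u i j
  assume x: "x \<in> verts Q" and y: "y \<in> verts Q" and u: "u \<in> R" "uniform Q x y u" and ij: "i < \<beta> y" "j < \<beta> x"
  let ?F = "\<lambda>V :: 'e \<Rightarrow> 'k mat. \<Sum>(s, p, t)\<in>Poly_Mapping.keys u. Poly_Mapping.lookup u (s, p, t) * path_mat Q \<beta> V s p $$ (i, j)"
  note A = fun_alg_agree[OF fun_alg_poly_funs[of Q \<beta>], of "rep_space Q \<beta> :: ('e \<Rightarrow> 'k mat) set"]
  have "?F \<in> {F. \<exists>f\<in>poly_funs Q \<beta>. \<forall>V\<in>rep_space Q \<beta>. F V = f V}"
    unfolding split_beta
  proof (rule fun_alg_sum[OF A], rule fun_algD(3)[OF A fun_algD(1)[OF A]])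
    fix k assume k: "k \<in> Poly_Mapping.keys u"
    then have w: "fst k = x" "awalk x (fst (snd k)) y"
      using uniform_keysD[OF u(2), of "fst k" "fst (snd k)" "snd (snd k)"] by auto
    show "(\<lambda>V :: 'e \<Rightarrow> 'k mat. path_mat Q \<beta> V (fst k) (fst (snd k)) $$ (i, j)) \<in> {F. \<exists>f\<in>poly_funs Q \<beta>. \<forall>V\<in>rep_space Q \<beta>. F V = f V}"
      unfolding w(1) by (rule path_mat_poly_fun[OF w(2) ij])
  qed
  then obtain f where f: "f \<in> poly_funs Q \<beta>" "\<And>V. V \<in> rep_space Q \<beta> \<Longrightarrow> ?F V = f V" by auto
  have "f W = 0" if "W \<in> rep_variety Q R \<beta>" for W
    using rep_varietyD[OF that x y u ij] f(2)[of W] that by (simp add: rep_variety_def)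
  then show "?F V = 0" using z[OF f(1)] f(2)[OF V] by simp
qed

end

section \<open>Stability and closedness of an irreducible component\<close>

locale quiver_component = quiver Q \<beta> for Q :: "('v, 'e) pre_digraph" and \<beta> +
  fixes R :: "(('v, 'e) quiver_path \<Rightarrow>\<^sub>0 'k::{alg_closed_field, field_char_0}) set"
    and C :: "('e \<Rightarrow> 'k mat) set"
  assumes component: "irreducible_component (subtopology (zariski Q \<beta>) (rep_variety Q R \<beta>)) C"
begin

lemma variety_subset: "rep_variety Q R \<beta> \<subseteq> rep_space Q \<beta>"
  by (auto simp: rep_variety_def)

lemma irreducible_C:
  shows C_variety: "C \<subseteq> rep_variety Q R \<beta>" and C_nonempty: "C \<noteq> {}"
    and C_domain: "f \<in> poly_funs Q \<beta> \<Longrightarrow> h \<in> poly_funs Q \<beta> \<Longrightarrow> (\<And>V. V \<in> C \<Longrightarrow> f V * h V = 0) \<Longrightarrow>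
      (\<forall>V\<in>C. f V = 0) \<or> (\<forall>V\<in>C. h V = 0)"
  using component unfolding irreducible_component_def irreducible_in_zariski_iff[OF variety_subset] by blast+

lemma C_rep_space: "V \<in> C \<Longrightarrow> V \<in> rep_space Q \<beta>"
  using C_variety variety_subset by blast

lemma C_maximal:
  assumes "C \<subseteq> D" "D \<subseteq> rep_variety Q R \<beta>"
    and "\<And>f h. f \<in> poly_funs Q \<beta> \<Longrightarrow> h \<in> poly_funs Q \<beta> \<Longrightarrow> (\<And>V. V \<in> D \<Longrightarrow> f V * h V = 0) \<Longrightarrow>
      (\<forall>V\<in>D. f V = 0) \<or> (\<forall>V\<in>D. h V = 0)"
  shows "D = C"
proof -
  have "irreducible_in (subtopology (zariski Q \<beta>) (rep_variety Q R \<beta>)) D"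
    unfolding irreducible_in_zariski_iff[OF variety_subset] using assms C_nonempty by blast
  then show ?thesis using component assms(1) unfolding irreducible_component_def by blast
qed

text \<open>The union D of all translates of C is irreducible, so maximality gives D = C. If f is
  nonzero at g1 V1 and h at g2 V2, irreducibility of C yields one V with f(g1 V) and h(g2 V) both
  nonzero. Then f and h are nonzero functions on GL along the orbit of V, and their product cannot
  vanish there.\<close>

lemma act_in_C:
  assumes V: "V \<in> C" and g: "g \<in> carrier (GL Q \<beta>)"
  shows "act Q \<beta> g V \<in> C"
proof -
  interpret G: group "GL Q \<beta> :: ('v \<Rightarrow> 'k mat) monoid" by (rule group_GL)
  define D where "D = (\<Union>g\<in>carrier (GL Q \<beta>). act Q \<beta> g ` C)"
  have "D = C"
  proof (rule C_maximal)
    show "C \<subseteq> D"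
    proof
      fix V assume "V \<in> C"
      then show "V \<in> D"
        unfolding D_def
        by (intro UN_I[OF G.one_closed] image_eqI[of _ _ V] act_one[OF C_rep_space, symmetric])
    qed
    show "D \<subseteq> rep_variety Q R \<beta>"
      unfolding D_def using act_in_rep_variety C_variety by auto
    fix f h :: "('e \<Rightarrow> 'k mat) \<Rightarrow> 'k"
    assume f: "f \<in> poly_funs Q \<beta>" and h: "h \<in> poly_funs Q \<beta>" and z: "\<And>V. V \<in> D \<Longrightarrow> f V * h V = 0"
    show "(\<forall>V\<in>D. f V = 0) \<or> (\<forall>V\<in>D. h V = 0)"
    proof (rule ccontr)
      assume "\<not> ?thesis"
      then obtain g1 g2 V1 V2 where 1: "g1 \<in> carrier (GL Q \<beta>)" "V1 \<in> C" "f (act Q \<beta> g1 V1) \<noteq> 0"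
        and 2: "g2 \<in> carrier (GL Q \<beta>)" "V2 \<in> C" "h (act Q \<beta> g2 V2) \<noteq> 0"
        unfolding D_def by auto
      obtain f' where f': "f' \<in> poly_funs Q \<beta>" "\<And>V. V \<in> rep_space Q \<beta> \<Longrightarrow> f (act Q \<beta> g1 V) = f' V"
        by (rule poly_fun_actE[OF f 1(1)], rule that)
      obtain h' where h': "h' \<in> poly_funs Q \<beta>" "\<And>V. V \<in> rep_space Q \<beta> \<Longrightarrow> h (act Q \<beta> g2 V) = h' V"
        by (rule poly_fun_actE[OF h 2(1)], rule that)
      have "f' V1 \<noteq> 0" "h' V2 \<noteq> 0" using 1 2 f' h' C_rep_space by auto
      then obtain V where W: "V \<in> C" "f' V * h' V \<noteq> 0"
        using C_domain[OF f'(1) h'(1)] 1(2) 2(2) by auto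
      note Ws = C_rep_space[OF W(1)]
      have "f (act Q \<beta> g V) * h (act Q \<beta> g V) = 0" if "g \<in> carrier (GL Q \<beta>)" for g
        using z[of "act Q \<beta> g V"] W(1) that unfolding D_def by auto
      from GL_reg_domain[OF GL_reg_act[OF f Ws] GL_reg_act[OF h Ws] this]
      show False using W(2) f'(2)[OF Ws] h'(2)[OF Ws] 1(1) 2(1) by auto
    qed
  qed
  moreover have "act Q \<beta> g V \<in> D" using V g unfolding D_def by auto
  ultimately show ?thesis by simp
qed

text \<open>The closure of C inside the representation space is again irreducible and lies in the
  variety, so it adds nothing to a component.\<close>

lemma C_closed:
  assumes V: "V \<in> rep_space Q \<beta>"
    and z: "\<And>f. f \<in> poly_funs Q \<beta> \<Longrightarrow> (\<forall>W\<in>C. f W = 0) \<Longrightarrow> f V = 0"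
  shows "V \<in> C"
proof -
  define D where "D = {V \<in> rep_space Q \<beta>. \<forall>f\<in>poly_funs Q \<beta>. (\<forall>W\<in>C. f W = 0) \<longrightarrow> f V = 0}"
  have "D = C"
  proof (rule C_maximal)
    show CD: "C \<subseteq> D" unfolding D_def using C_rep_space by auto
    show "D \<subseteq> rep_variety Q R \<beta>"
    proof
      fix V assume "V \<in> D"
      then show "V \<in> rep_variety Q R \<beta>"
        unfolding D_def using C_variety by (intro rep_variety_closed) (simp_all add: subset_iff)
    qed
    fix f h :: "('e \<Rightarrow> 'k mat) \<Rightarrow> 'k"
    assume f: "f \<in> poly_funs Q \<beta>" and h: "h \<in> poly_funs Q \<beta>" and z: "\<And>V. V \<in> D \<Longrightarrow> f V * h V = 0"
    then have "(\<forall>V\<in>C. f V = 0) \<or> (\<forall>V\<in>C. h V = 0)" using CD by (intro C_domain) auto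
    then show "(\<forall>V\<in>D. f V = 0) \<or> (\<forall>V\<in>D. h V = 0)" unfolding D_def using f h by auto
  qed
  moreover have "V \<in> D" unfolding D_def using V z by auto
  ultimately show ?thesis by simp
qed

lemma orbit_closure_eqI:
  assumes V: "V \<in> C"
    and d: "\<And>f. f \<in> poly_funs Q \<beta> \<Longrightarrow> (\<forall>g\<in>carrier (GL Q \<beta>). f (act Q \<beta> g V) = 0) \<Longrightarrow> \<forall>W\<in>C. f W = 0"
  shows "C = zariski Q \<beta> closure_of orbit Q \<beta> V"
proof
  have o: "orbit Q \<beta> V \<subseteq> C" unfolding orbit_def using act_in_C[OF V] by blast
  then have o': "orbit Q \<beta> V \<inter> rep_space Q \<beta> = orbit Q \<beta> V" using C_rep_space by blast
  show "C \<subseteq> zariski Q \<beta> closure_of orbit Q \<beta> V"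
    unfolding zariski_closure_of o'
  proof (intro subsetI CollectI conjI ballI impI)
    fix W f assume W: "W \<in> C" and f: "f \<in> poly_funs Q \<beta>" and z: "\<forall>W\<in>orbit Q \<beta> V. f W = 0"
    from z have "\<forall>g\<in>carrier (GL Q \<beta>). f (act Q \<beta> g V) = 0" by (simp add: orbit_def)
    from d[OF f this] W show "f W = 0" by simp
  qed (rule C_rep_space)
  show "zariski Q \<beta> closure_of orbit Q \<beta> V \<subseteq> C"
    unfolding zariski_closure_of o'
  proof
    fix W assume W: "W \<in> {V' \<in> rep_space Q \<beta>. \<forall>f\<in>poly_funs Q \<beta>. (\<forall>W\<in>orbit Q \<beta> V. f W = 0) \<longrightarrow> f V' = 0}"
    show "W \<in> C"
    proof (rule C_closed)
      fix f assume "f \<in> poly_funs Q \<beta>" "\<forall>W\<in>C. f W = 0"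
      moreover from this have "\<forall>W\<in>orbit Q \<beta> V. f W = 0" using o by (simp add: subset_iff)
      ultimately show "f W = 0" using W by simp
    qed (use W in simp)
  qed
qed

end

section \<open>Dense orbits\<close>

text \<open>The list stands for a tensor, the sum of the terms c \<otimes> m, viewed as a function
  of two points. Different lists may give the same function.\<close>

definition bilin :: "(('r \<Rightarrow> 'k::comm_ring_1) \<times> ('r \<Rightarrow> 'k)) list \<Rightarrow> 'r \<Rightarrow> 'r \<Rightarrow> 'k" where
  "bilin L V W = (\<Sum>(c, m)\<leftarrow>L. c V * m W)"

lemma bilin_simps [simp]:
  "bilin [] V W = 0" "bilin ((c, m) # L) V W = c V * m W + bilin L V W"
  "bilin (L @ L') V W = bilin L V W + bilin L' V W"
  by (simp_all add: bilin_def)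

lemma bilin_scale: "bilin (map (\<lambda>(c', m'). (\<lambda>V. c V * c' V, \<lambda>W. m W * m' W)) L) V W = c V * m W * bilin L V W"
  by (induction L) (auto simp: algebra_simps)

lemma bilin_uminus: "bilin (map (\<lambda>(c, m). (\<lambda>V. - c V, m)) L) V W = - bilin L V W"
  by (induction L) auto

lemma bilin_mult:
  assumes S: "fun_alg S" and "set L \<subseteq> S \<times> S" "set L' \<subseteq> S \<times> S"
  shows "\<exists>L''. set L'' \<subseteq> S \<times> S \<and> (\<forall>V W. bilin L'' V W = bilin L V W * bilin L' V W)"
  using assms(2)
proof (induction L)
  case Nil
  then show ?case by (intro exI[of _ "[]"]) simp
next
  case (Cons a L)
  obtain c m where a: "a = (c, m)" by (cases a)
  obtain L'' where L'': "set L'' \<subseteq> S \<times> S" "\<forall>V W. bilin L'' V W = bilin L V W * bilin L' V W"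
    using Cons by auto
  let ?M = "map (\<lambda>(c', m'). (\<lambda>V. c V * c' V, \<lambda>W. m W * m' W)) L'"
  have "set ?M \<subseteq> S \<times> S" using assms(3) Cons.prems a by (auto intro!: fun_algD(3)[OF S])
  moreover have "bilin (?M @ L'') V W = bilin (a # L) V W * bilin L' V W" for V W
    unfolding a bilin_simps bilin_scale using L''(2) by (simp add: distrib_right)
  ultimately show ?case using L''(1) by (intro exI[of _ "?M @ L''"]) simp
qed

lemma fun_alg_is_subring: "fun_alg S \<Longrightarrow> is_subring S"
  unfolding is_subring_def
  by (auto simp: one_fun_def fun_diff_def times_fun_def intro: fun_algD fun_alg_diff)

lemma is_subring_fun_alg: "is_subring S \<Longrightarrow> (\<And>c. (\<lambda>_. c) \<in> S) \<Longrightarrow> fun_alg S"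
  using is_subringD(4,5)[of S] by (auto simp: fun_alg_def plus_fun_def times_fun_def)

lemma sum_apply: "(\<Sum>i\<in>I. f i) z = (\<Sum>i\<in>I. f i z)"
  by (induction I rule: infinite_finite_induct) auto

lemma prod_apply: "(\<Prod>i\<in>I. f i) z = (\<Prod>i\<in>I. f i z)"
  by (induction I rule: infinite_finite_induct) auto

lemma hom_on_fun_alg:
  assumes \<phi>: "hom_on S \<phi>" and S: "fun_alg S"
  shows "f \<in> S \<Longrightarrow> h \<in> S \<Longrightarrow> \<phi> (\<lambda>z. f z * h z) = \<phi> f * \<phi> h"
    "(\<And>i. i \<in> I \<Longrightarrow> F i \<in> S) \<Longrightarrow> \<phi> (\<lambda>z. \<Sum>i\<in>I. F i z) = (\<Sum>i\<in>I. \<phi> (F i))"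
    "(\<And>i. i \<in> I \<Longrightarrow> F i \<in> S) \<Longrightarrow> \<phi> (\<lambda>z. \<Prod>i\<in>I. F i z) = (\<Prod>i\<in>I. \<phi> (F i))"
proof -
  note r = fun_alg_is_subring[OF S]
  show "f \<in> S \<Longrightarrow> h \<in> S \<Longrightarrow> \<phi> (\<lambda>z. f z * h z) = \<phi> f * \<phi> h"
    using hom_onD(4)[OF \<phi> r] by (simp add: times_fun_def)
  have "(\<lambda>z. \<Sum>i\<in>I. F i z) = (\<Sum>i\<in>I. F i)" "(\<lambda>z. \<Prod>i\<in>I. F i z) = (\<Prod>i\<in>I. F i)"
    by (simp_all add: fun_eq_iff sum_apply prod_apply)
  note eq = this
  show "\<phi> (\<lambda>z. \<Sum>i\<in>I. F i z) = (\<Sum>i\<in>I. \<phi> (F i))" if "\<And>i. i \<in> I \<Longrightarrow> F i \<in> S"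
    unfolding eq(1) by (rule hom_on_sum[OF \<phi> r that])
  show "\<phi> (\<lambda>z. \<Prod>i\<in>I. F i z) = (\<Prod>i\<in>I. \<phi> (F i))" if "\<And>i. i \<in> I \<Longrightarrow> F i \<in> S"
    unfolding eq(2) by (rule hom_on_prod[OF \<phi> r that])
qed

lemma hom_on_det:
  assumes \<phi>: "hom_on S \<phi>" and S: "fun_alg S" and c: "\<And>c. \<phi> (\<lambda>_. c) = c"
    and M: "\<And>z. M z \<in> carrier_mat n n"
    and e: "\<And>i j. i < n \<Longrightarrow> j < n \<Longrightarrow> (\<lambda>z. M z $$ (i, j)) \<in> S"
  shows "\<phi> (\<lambda>z. det (M z)) = det (mat n n (\<lambda>(i, j). \<phi> (\<lambda>z. M z $$ (i, j))))"
proof -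
  have p: "i \<in> {0..<n} \<Longrightarrow> p permutes {0..<n} \<Longrightarrow> i < n \<and> p i < n" for p i
    by (auto dest: permutes_in_image[of p "{0..<n}" i])
  have eq: "det (M z) = (\<Sum>p\<in>{p. p permutes {0..<n}}. signof p * (\<Prod>i\<in>{0..<n}. M z $$ (i, p i)))" for z
    by (rule det_def'[OF M])
  have "\<phi> (\<lambda>z. det (M z)) =
    (\<Sum>p\<in>{p. p permutes {0..<n}}. \<phi> (\<lambda>z. signof p * (\<Prod>i\<in>{0..<n}. M z $$ (i, p i))))"
    unfolding eq
    by (rule hom_on_fun_alg(2)[OF \<phi> S], rule fun_algD(3)[OF S fun_algD(1)[OF S] fun_alg_prod[OF S]])
      (use p e in auto)
  also have "\<dots> = (\<Sum>p\<in>{p. p permutes {0..<n}}. signof p * (\<Prod>i\<in>{0..<n}. \<phi> (\<lambda>z. M z $$ (i, p i))))"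
  proof (rule sum.cong[OF refl])
    fix p assume "p \<in> {p. p permutes {0..<n}}"
    then have pe: "\<And>i. i \<in> {0..<n} \<Longrightarrow> (\<lambda>z. M z $$ (i, p i)) \<in> S" using p e by auto
    have a: "(\<lambda>z. \<Prod>i\<in>{0..<n}. M z $$ (i, p i)) \<in> S" by (rule fun_alg_prod[OF S pe])
    show "\<phi> (\<lambda>z. signof p * (\<Prod>i\<in>{0..<n}. M z $$ (i, p i))) =
        signof p * (\<Prod>i\<in>{0..<n}. \<phi> (\<lambda>z. M z $$ (i, p i)))"
      unfolding hom_on_fun_alg(1)[OF \<phi> S fun_algD(1)[OF S, of "signof p"] a] c
      by (rule arg_cong, rule hom_on_fun_alg(3)[OF \<phi> S pe])
  qed
  also have "\<dots> = det (mat n n (\<lambda>(i, j). \<phi> (\<lambda>z. M z $$ (i, j))))"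
    unfolding det_def'[OF mat_carrier]
    by (intro sum.cong refl arg_cong2[where f = "(*)"] prod.cong) (use p in auto)
  finally show ?thesis .
qed

section \<open>Functions on GL x C and the graph of the action\<close>

context quiver_component
begin

text \<open>A retraction of the whole product type onto GL x C, with the identity and a chosen point
  of C as default.\<close>

definition base_pt :: "('v \<Rightarrow> 'k mat) \<times> ('e \<Rightarrow> 'k mat) \<Rightarrow> ('v \<Rightarrow> 'k mat) \<times> ('e \<Rightarrow> 'k mat)" where
  "base_pt z = (if fst z \<in> carrier (GL Q \<beta>) \<and> snd z \<in> C then z
     else (\<one>\<^bsub>GL Q \<beta>\<^esub>, SOME V. V \<in> C))"

abbreviation "gp z \<equiv> fst (base_pt z)"
abbreviation "vp z \<equiv> snd (base_pt z)"
abbreviation "wp z \<equiv> act Q \<beta> (gp z) (vp z)"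

lemma base_pt_in: "gp z \<in> carrier (GL Q \<beta>)" "vp z \<in> C" "wp z \<in> C" "vp z \<in> rep_space Q \<beta>" "wp z \<in> rep_space Q \<beta>"
proof -
  interpret G: group "GL Q \<beta> :: ('v \<Rightarrow> 'k mat) monoid" by (rule group_GL)
  show 1: "gp z \<in> carrier (GL Q \<beta>)" "vp z \<in> C"
    using C_nonempty by (auto simp: base_pt_def some_in_eq)
  then show "wp z \<in> C" "vp z \<in> rep_space Q \<beta>" "wp z \<in> rep_space Q \<beta>"
    using act_in_C[OF 1(2,1)] C_rep_space by auto
qed

lemma base_pt_id: "g \<in> carrier (GL Q \<beta>) \<Longrightarrow> V \<in> C \<Longrightarrow> base_pt (g, V) = (g, V)"
  by (simp add: base_pt_def)

lemma base_pt_idem: "base_pt (base_pt z) = base_pt z"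
  using base_pt_id[OF base_pt_in(1,2), of z z] by simp

definition C_reg :: "(('e \<Rightarrow> 'k mat) \<Rightarrow> 'k) set" where
  "C_reg = {H. \<exists>f\<in>poly_funs Q \<beta>. \<forall>V\<in>C. H V = f V}"

lemma fun_alg_C_reg: "fun_alg C_reg"
  unfolding C_reg_def by (rule fun_alg_agree[OF fun_alg_poly_funs])

text \<open>A model of the coordinate ring of \<open>GL \<times> C\<close>. Functions are extended to the full product type
  through \<^const>\<open>base_pt\<close>, so that the ring unit is the constant function and \<open>0\<close> is detected on
  \<open>GL \<times> C\<close>.\<close>

definition GLC_reg :: "(('v \<Rightarrow> 'k mat) \<times> ('e \<Rightarrow> 'k mat) \<Rightarrow> 'k) set" where
  "GLC_reg = {F. (\<forall>z. F (base_pt z) = F z) \<and>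
     (\<forall>g\<in>carrier (GL Q \<beta>). (\<lambda>V. F (g, V)) \<in> C_reg) \<and> (\<forall>V\<in>C. (\<lambda>g. F (g, V)) \<in> GL_reg)}"

lemma GLC_regD:
  assumes "F \<in> GLC_reg"
  shows "F (base_pt z) = F z" "g \<in> carrier (GL Q \<beta>) \<Longrightarrow> (\<lambda>V. F (g, V)) \<in> C_reg"
    "V \<in> C \<Longrightarrow> (\<lambda>g. F (g, V)) \<in> GL_reg"
proof -
  have *: "(\<forall>z. F (base_pt z) = F z)" "\<forall>g\<in>carrier (GL Q \<beta>). (\<lambda>V. F (g, V)) \<in> C_reg"
    "\<forall>V\<in>C. (\<lambda>g. F (g, V)) \<in> GL_reg"
    using CollectD[OF assms[unfolded GLC_reg_def]] by - (elim conjE, assumption)+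
  show "F (base_pt z) = F z" by (rule spec[OF *(1)])
  show "g \<in> carrier (GL Q \<beta>) \<Longrightarrow> (\<lambda>V. F (g, V)) \<in> C_reg" by (rule bspec[OF *(2)])
  show "V \<in> C \<Longrightarrow> (\<lambda>g. F (g, V)) \<in> GL_reg" by (rule bspec[OF *(3)])
qed

lemma GLC_regI:
  assumes "\<And>z. F (base_pt z) = F z" "\<And>g. g \<in> carrier (GL Q \<beta>) \<Longrightarrow> (\<lambda>V. F (g, V)) \<in> C_reg"
    "\<And>V. V \<in> C \<Longrightarrow> (\<lambda>g. F (g, V)) \<in> GL_reg"
  shows "F \<in> GLC_reg"
  unfolding GLC_reg_def by (rule CollectI, intro conjI allI ballI assms)

lemma fun_alg_GLC_reg: "fun_alg GLC_reg"
proof -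
  note 1 = fun_alg_C_reg and 2 = fun_alg_GL_reg
  have "(\<lambda>_. c) \<in> GLC_reg" for c
    by (rule GLC_regI) (rule refl, rule fun_algD(1)[OF 1], rule fun_algD(1)[OF 2])
  moreover have "(\<lambda>z. F z + H z) \<in> GLC_reg" "(\<lambda>z. F z * H z) \<in> GLC_reg"
    if F: "F \<in> GLC_reg" and H: "H \<in> GLC_reg" for F H
  proof -
    note F' = GLC_regD[OF F] and H' = GLC_regD[OF H]
    show "(\<lambda>z. F z + H z) \<in> GLC_reg"
      by (rule GLC_regI) (simp only: F' H', rule fun_algD(2)[OF 1 F'(2) H'(2)], assumption+,
        rule fun_algD(2)[OF 2 F'(3) H'(3)], assumption+)
    show "(\<lambda>z. F z * H z) \<in> GLC_reg"
      by (rule GLC_regI) (simp only: F' H', rule fun_algD(3)[OF 1 F'(2) H'(2)], assumption+,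
        rule fun_algD(3)[OF 2 F'(3) H'(3)], assumption+)
  qed
  ultimately show ?thesis unfolding fun_alg_def by simp
qed

text \<open>Regularity in each variable separately suffices. Take slices on C through a nonzero of F
  and through a nonzero of H; irreducibility of C gives a common V at which both are nonzero, and
  integrality on GL then applies to the slice at V.\<close>

lemma is_subdomain_GLC_reg: "is_subdomain GLC_reg"
  unfolding is_subdomain_def
proof (intro conjI ballI impI fun_alg_is_subring fun_alg_GLC_reg)
  fix F H assume F: "F \<in> GLC_reg" and H: "H \<in> GLC_reg" and "F * H = 0"
  then have z: "F x * H x = 0" for x by (metis times_fun_apply zero_fun_apply)
  show "F = 0 \<or> H = 0"
  proof (rule ccontr)
    assume "\<not> (F = 0 \<or> H = 0)"
    then obtain z1 z2 where "F z1 \<noteq> 0" "H z2 \<noteq> 0" by (auto simp: fun_eq_iff)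
    then have nz: "F (gp z1, vp z1) \<noteq> 0" "H (gp z2, vp z2) \<noteq> 0"
      using GLC_regD(1)[OF F] GLC_regD(1)[OF H] by simp_all
    obtain f where f: "f \<in> poly_funs Q \<beta>" "\<forall>V\<in>C. F (gp z1, V) = f V"
      using GLC_regD(2)[OF F base_pt_in(1)[of z1]] unfolding C_reg_def by auto
    obtain h where h: "h \<in> poly_funs Q \<beta>" "\<forall>V\<in>C. H (gp z2, V) = h V"
      using GLC_regD(2)[OF H base_pt_in(1)[of z2]] unfolding C_reg_def by auto
    have "f (vp z1) \<noteq> 0" "h (vp z2) \<noteq> 0"
      using nz bspec[OF f(2) base_pt_in(2)] bspec[OF h(2) base_pt_in(2)] by metis+
    then obtain V where V: "V \<in> C" "f V * h V \<noteq> 0"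
      using C_domain[OF f(1) h(1)] base_pt_in(2)[of z1] base_pt_in(2)[of z2] by auto
    have "F (gp z1, V) \<noteq> 0" "H (gp z2, V) \<noteq> 0" using V f(2) h(2) by auto
    then show False
      using GL_reg_domain[OF GLC_regD(3)[OF F V(1)] GLC_regD(3)[OF H V(1)] z] base_pt_in(1)[of z1] base_pt_in(1)[of z2] by auto
  qed
qed

lemma GLC_reg_gens:
  shows "f \<in> poly_funs Q \<beta> \<Longrightarrow> (\<lambda>z. f (vp z)) \<in> GLC_reg"
    and "f \<in> poly_funs Q \<beta> \<Longrightarrow> (\<lambda>z. f (wp z)) \<in> GLC_reg"
    and "x \<in> verts Q \<Longrightarrow> i < \<beta> x \<Longrightarrow> j < \<beta> x \<Longrightarrow> (\<lambda>z. gp z x $$ (i, j)) \<in> GLC_reg"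
proof -
  have cong: "(\<lambda>V. F (base_pt (g, V))) \<in> C_reg"
    if "g \<in> carrier (GL Q \<beta>)" "f \<in> poly_funs Q \<beta>" "\<And>V. V \<in> C \<Longrightarrow> F (g, V) = f V" for F g f
    unfolding C_reg_def by (rule CollectI, rule bexI[OF _ that(2)], rule ballI) (simp add: base_pt_id that)
  have cong': "(\<lambda>g. F (base_pt (g, V))) \<in> GL_reg"
    if "V \<in> C" "(\<lambda>g. F (g, V)) \<in> GL_reg" for F :: "_ \<Rightarrow> 'k" and V
    by (rule GL_reg_cong[OF that(2)]) (simp add: base_pt_id that)
  have I: "(\<lambda>z. F (base_pt z)) \<in> GLC_reg"
    if "\<And>g. g \<in> carrier (GL Q \<beta>) \<Longrightarrow> (\<lambda>V. F (base_pt (g, V))) \<in> C_reg"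
      "\<And>V. V \<in> C \<Longrightarrow> (\<lambda>g. F (g, V)) \<in> GL_reg" for F :: "_ \<Rightarrow> 'k"
    by (rule GLC_regI, simp only: base_pt_idem, rule that(1), assumption, rule cong', assumption, rule that(2))
  show "(\<lambda>z. f (vp z)) \<in> GLC_reg" if f: "f \<in> poly_funs Q \<beta>"
    by (rule I[of "\<lambda>z. f (snd z)"], rule cong[OF _ f, of _ "\<lambda>z. f (snd z)"])
      (simp_all add: GL_reg_const)
  show "(\<lambda>z. f (wp z)) \<in> GLC_reg" if f: "f \<in> poly_funs Q \<beta>"
  proof (rule I[of "\<lambda>z. f (act Q \<beta> (fst z) (snd z))"])
    fix g :: "'v \<Rightarrow> 'k mat" assume g: "g \<in> carrier (GL Q \<beta>)"
    obtain f' where f': "f' \<in> poly_funs Q \<beta>" "\<And>V. V \<in> rep_space Q \<beta> \<Longrightarrow> f (act Q \<beta> g V) = f' V"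
      by (rule poly_fun_actE[OF f g], rule that)
    show "(\<lambda>V. f (wp (g, V))) \<in> C_reg"
      by (rule cong[OF g f'(1), of "\<lambda>z. f (act Q \<beta> (fst z) (snd z))"]) (simp add: f'(2) C_rep_space)
  next
    fix V assume "V \<in> C"
    then show "(\<lambda>g. f (act Q \<beta> (fst (g, V)) (snd (g, V)))) \<in> GL_reg"
      using GL_reg_act[OF f C_rep_space] by simp
  qed
  show "(\<lambda>z. gp z x $$ (i, j)) \<in> GLC_reg" if "x \<in> verts Q" "i < \<beta> x" "j < \<beta> x"
  proof (rule I[of "\<lambda>z. fst z x $$ (i, j)"])
    fix g :: "'v \<Rightarrow> 'k mat" assume g: "g \<in> carrier (GL Q \<beta>)"
    show "(\<lambda>V. gp (g, V) x $$ (i, j)) \<in> C_reg"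
      by (rule cong[OF g poly_funs.const[of "g x $$ (i, j)"], of "\<lambda>z. fst z x $$ (i, j)"]) simp
  next
    fix V show "(\<lambda>g. fst (g, V) x $$ (i, j)) \<in> GL_reg"
      using GL_reg_index[OF that] by simp
  qed
qed

text \<open>The comorphism of (g, V) \<mapsto> (V, gV), applied to a tensor.\<close>

definition pullback :: "((('e \<Rightarrow> 'k mat) \<Rightarrow> 'k) \<times> (('e \<Rightarrow> 'k mat) \<Rightarrow> 'k)) list \<Rightarrow>
    ('v \<Rightarrow> 'k mat) \<times> ('e \<Rightarrow> 'k mat) \<Rightarrow> 'k" where
  "pullback L = (\<lambda>z. bilin L (vp z) (wp z))"

abbreviation "tensors \<equiv> {L. set L \<subseteq> poly_funs Q \<beta> \<times> (poly_funs Q \<beta> :: (('e \<Rightarrow> 'k mat) \<Rightarrow> 'k) set)}"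

lemma fun_alg_pullback: "fun_alg (pullback ` tensors)"
  unfolding fun_alg_def
proof (intro conjI allI ballI)
  fix c
  show "(\<lambda>_. c) \<in> pullback ` tensors"
    by (rule image_eqI[where x = "[(\<lambda>_. c, \<lambda>_. 1)]"]) (auto simp: pullback_def intro: poly_funs.const)
next
  fix f g assume "f \<in> pullback ` tensors" "g \<in> pullback ` tensors"
  then obtain L L' where L: "L \<in> tensors" "f = pullback L" "L' \<in> tensors" "g = pullback L'" by auto
  show "(\<lambda>z. f z + g z) \<in> pullback ` tensors"
    by (rule image_eqI[where x = "L @ L'"]) (use L in \<open>auto simp: pullback_def\<close>)
  obtain L'' where L'': "set L'' \<subseteq> poly_funs Q \<beta> \<times> poly_funs Q \<beta>"
    "\<forall>V W. bilin L'' V W = bilin L V W * bilin L' V W"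
    using bilin_mult[OF fun_alg_poly_funs, of L Q \<beta> L'] L by auto
  show "(\<lambda>z. f z * g z) \<in> pullback ` tensors"
    by (rule image_eqI[where x = L'']) (use L L'' in \<open>auto simp: pullback_def\<close>)
qed

lemma pullback_subset: "pullback ` tensors \<subseteq> GLC_reg"
proof
  fix F assume "F \<in> pullback ` tensors"
  then obtain L where L: "set L \<subseteq> poly_funs Q \<beta> \<times> poly_funs Q \<beta>" "F = pullback L" by auto
  have "(\<lambda>z. bilin L (vp z) (wp z)) \<in> GLC_reg" using L(1)
  proof (induction L)
    case Nil
    then show ?case using fun_algD(1)[OF fun_alg_GLC_reg] by simp
  next
    case (Cons a L)
    obtain c m where a: "a = (c, m)" by (cases a)
    have "(\<lambda>z. c (vp z) * m (wp z) + bilin L (vp z) (wp z)) \<in> GLC_reg"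
      using Cons a by (intro fun_algD(2,3)[OF fun_alg_GLC_reg] GLC_reg_gens(1,2)) auto
    then show ?case by (simp add: a)
  qed
  then show "F \<in> GLC_reg" by (simp add: L(2) pullback_def)
qed

lemma bilin_poly_fun: "L \<in> tensors \<Longrightarrow> (\<lambda>W. bilin L V W) \<in> poly_funs Q \<beta>"
proof (induction L)
  case Nil
  then show ?case using poly_funs.const[of 0] by (simp add: bilin_def)
next
  case (Cons a L)
  obtain c m where a: "a = (c, m)" by (cases a)
  have "(\<lambda>W. c V * m W + bilin L V W) \<in> poly_funs Q \<beta>"
    using Cons by (intro poly_funs.add poly_funs.mult poly_funs.const) (auto simp: a)
  moreover have "(\<lambda>W. bilin (a # L) V W) = (\<lambda>W. c V * m W + bilin L V W)" by (simp add: a)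
  ultimately show ?case by (simp only:)
qed

text \<open>The hypothesis says that \<open>(g, V) \<mapsto> (gV, V)\<close> is dominant. Extending evaluation at \<open>(W, V)\<close> to the
  matrix entries of \<open>g\<close> produces a group element that carries \<open>V\<close> to \<open>W\<close>.\<close>

lemma dense_orbit_exists:
  assumes inj: "\<And>L V W. L \<in> tensors \<Longrightarrow>
      (\<And>g V. g \<in> carrier (GL Q \<beta>) \<Longrightarrow> V \<in> C \<Longrightarrow> bilin L V (act Q \<beta> g V) = 0) \<Longrightarrow>
      V \<in> C \<Longrightarrow> W \<in> C \<Longrightarrow> bilin L V W = 0"
  shows "\<exists>V\<in>C. C = zariski Q \<beta> closure_of orbit Q \<beta> V"
proof -
  define B where "B = pullback ` tensors"
  have Ba: "fun_alg B" unfolding B_def by (rule fun_alg_pullback)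
  note Br = fun_alg_is_subring[OF Ba]
  \<comment> \<open>The coordinate functions of g. Adjoining these finitely many functions to B
    gives the ring A to which evaluations are extended.\<close>
  define Y where "Y = (\<Union>x\<in>verts Q. (\<lambda>(i, j) z. gp z x $$ (i, j)) ` ({..<\<beta> x} \<times> {..<\<beta> x}))"
  have "finite Y" unfolding Y_def by auto
  then obtain ys where ys: "set ys = Y" using finite_list by blast
  define A where "A = adjoin_list B ys"
  note Af = adjoin_list_facts[OF Br, of ys, folded A_def]
  have Aa: "fun_alg A"
    by (rule is_subring_fun_alg[OF Af(1)]) (use Af(2) fun_algD(1)[OF Ba] in blast)
  have YA: "(\<lambda>z. gp z x $$ (i, j)) \<in> A" if "x \<in> verts Q" "i < \<beta> x" "j < \<beta> x" for x i j
    using Af(3) that unfolding ys Y_def by force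
  \<comment> \<open>Keeping v nonzero under the extended homomorphism makes the matrices it produces
    invertible.\<close>
  define v where "v = (\<lambda>z. det_prod (gp z))"
  have detA: "(\<lambda>z. det (gp z x)) \<in> A" if x: "x \<in> verts Q" for x
    by (rule fun_alg_det[OF Aa, where n = "\<beta> x"]) (use YA x GL_carrier(1)[OF base_pt_in(1) x] in auto)
  have vA: "v \<in> A" unfolding v_def det_prod_def by (rule fun_alg_prod[OF Aa detA])
  have "v z \<noteq> 0" for z
    unfolding v_def det_prod_def using GL_carrier(2)[OF base_pt_in(1)] by simp
  then have v0: "v \<noteq> 0" by (metis zero_fun_apply)
  have YD: "set ys \<subseteq> GLC_reg" unfolding ys Y_def using GLC_reg_gens(3) by auto
  obtain c where c: "c \<in> B" "c \<noteq> 0" "\<And>\<phi> :: _ \<Rightarrow> 'k. hom_on B \<phi> \<Longrightarrow> \<phi> c \<noteq> 0 \<Longrightarrow>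
    \<exists>\<phi>'. hom_on A \<phi>' \<and> (\<forall>b\<in>B. \<phi>' b = \<phi> b) \<and> \<phi>' v \<noteq> 0"
    using hom_on_adjoin_list[OF is_subdomain_GLC_reg Br pullback_subset[folded B_def] YD vA[unfolded A_def] v0,
        folded A_def, where ?'k = 'k] by auto
  obtain L where L: "L \<in> tensors" "c = pullback L" using c(1) unfolding B_def by auto
  obtain z0 where "c z0 \<noteq> 0" using c(2) by (auto simp: fun_eq_iff)
  \<comment> \<open>For this V the function \<open>bilin L V\<close> is not zero on C, so its
    nonvanishing locus is a nonempty open set of targets.\<close>
  define V where "V = vp z0"
  have V: "V \<in> C" "V \<in> rep_space Q \<beta>" unfolding V_def by (rule base_pt_in)+
  have nz: "bilin L V (wp z0) \<noteq> 0" using \<open>c z0 \<noteq> 0\<close> by (simp add: L(2) V_def pullback_def)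
  \<comment> \<open>Here the injectivity hypothesis enters: it makes evaluation at (V, W) well
    defined on B. It is applied to the difference of the two tensors.\<close>
  have pullback_eq: "bilin L1 V W = bilin L2 V W"
    if L: "L1 \<in> tensors" "L2 \<in> tensors" "pullback L1 = pullback L2" and W: "W \<in> C" for L1 L2 W
  proof -
    let ?L = "L1 @ map (\<lambda>(c, m). (\<lambda>V. - c V, m)) L2"
    have "(\<lambda>V. - f V) \<in> poly_funs Q \<beta>" if "f \<in> poly_funs Q \<beta>" for f :: "_ \<Rightarrow> 'k"
      using poly_funs.mult[OF poly_funs.const[of "- 1"] that] by simp
    then have t: "?L \<in> tensors" using L by auto
    have "bilin ?L V (act Q \<beta> g V) = 0" if "g \<in> carrier (GL Q \<beta>)" "V \<in> C" for g V
      using fun_cong[OF L(3), of "(g, V)"] by (simp add: pullback_def base_pt_id that bilin_uminus)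
    from inj[OF t this V(1) W] show ?thesis by (simp add: bilin_uminus)
  qed
  have reach: "W \<in> orbit Q \<beta> V" if W: "W \<in> C" and nzW: "bilin L V W \<noteq> 0" for W
  proof -
    note Ws = C_rep_space[OF W]
    \<comment> \<open>Evaluation at (V, W), read off from any tensor that represents F.\<close>
    define \<phi> where "\<phi> F = bilin (SOME L. L \<in> tensors \<and> pullback L = F) V W" for F
    have \<phi>: "\<phi> (pullback L) = bilin L V W" if "L \<in> tensors" for L
    proof -
      have "\<exists>L'. L' \<in> tensors \<and> pullback L' = pullback L" using that by blast
      from someI_ex[OF this] show ?thesis
        unfolding \<phi>_def using pullback_eq[OF _ that _ W] by blast
    qed
    have \<phi>c: "\<phi> (\<lambda>_. c) = c" for c
    proof -
      have "(\<lambda>_. c) = pullback [(\<lambda>_. c, \<lambda>_. 1)]" by (simp add: pullback_def)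
      then show ?thesis using \<phi>[of "[(\<lambda>_. c, \<lambda>_. 1)]"] by (simp add: poly_funs.const)
    qed
    have hom: "hom_on B \<phi>"
      unfolding hom_on_def
    proof (intro conjI ballI)
      show "\<phi> 1 = 1" using \<phi>c[of 1] by (simp add: one_fun_def)
      fix f g assume "f \<in> B" "g \<in> B"
      then obtain L1 L2 where L12: "L1 \<in> tensors" "f = pullback L1" "L2 \<in> tensors" "g = pullback L2"
        unfolding B_def by auto
      have "L1 @ L2 \<in> tensors" using L12 by auto
      moreover have "f + g = pullback (L1 @ L2)" unfolding L12 by (simp add: pullback_def fun_eq_iff)
      ultimately show "\<phi> (f + g) = \<phi> f + \<phi> g" using \<phi> L12 by simp
      obtain L'' where L'': "set L'' \<subseteq> poly_funs Q \<beta> \<times> poly_funs Q \<beta>"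
        "\<forall>V W. bilin L'' V W = bilin L1 V W * bilin L2 V W"
        using bilin_mult[OF fun_alg_poly_funs, of L1 Q \<beta> L2] L12 by auto
      have "f * g = pullback L''" unfolding L12 using L''(2) by (simp add: pullback_def fun_eq_iff)
      then show "\<phi> (f * g) = \<phi> f * \<phi> g" using \<phi> L12 L'' by simp
    qed
    have "\<phi> c \<noteq> 0" using \<phi>[OF L(1)] nzW by (simp add: L(2))
    then obtain \<psi> where \<psi>: "hom_on A \<psi>" "\<And>b. b \<in> B \<Longrightarrow> \<psi> b = \<phi> b" "\<psi> v \<noteq> 0"
      using c(3)[OF hom] by auto
    \<comment> \<open>The images of the coordinate functions of g under \<open>\<psi>\<close> are
      the entries of the group element sought.\<close>
    define g where "g = (\<lambda>x\<in>verts Q. mat (\<beta> x) (\<beta> x) (\<lambda>(i, j). \<psi> (\<lambda>z. gp z x $$ (i, j))))"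
    have \<psi>c: "\<psi> (\<lambda>_. c) = c" for c
      using \<psi>(2)[OF fun_algD(1)[OF Ba]] \<phi>c by simp
    have det_g: "\<psi> (\<lambda>z. det (gp z x)) = det (g x)" if x: "x \<in> verts Q" for x
      using hom_on_det[OF \<psi>(1) Aa \<psi>c GL_carrier(1)[OF base_pt_in(1) x] YA[OF x]] x
      by (simp add: g_def)
    have "\<psi> v = (\<Prod>x\<in>verts Q. det (g x))"
      unfolding v_def det_prod_def
      by (rule trans[OF hom_on_fun_alg(3)[OF \<psi>(1) Aa detA] prod.cong[OF refl det_g]])
    then have gG: "g \<in> carrier (GL Q \<beta>)"
      using \<psi>(3) by (auto simp: GL_iff g_def)
    have "act Q \<beta> g V = W"
      unfolding act_eq_iff[OF gG V(2) Ws]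
    proof
      fix a assume a: "a \<in> arcs Q"
      let ?x = "head Q a" and ?y = "tail Q a"
      have vt: "?x \<in> verts Q" "?y \<in> verts Q" using a by auto
      show "g ?x * V a = W a * g ?y"
      proof (rule eq_matI)
        have dims: "dim_row (W a * g ?y) = \<beta> ?x" "dim_col (W a * g ?y) = \<beta> ?y"
          using rep_spaceD[OF Ws a] vt by (auto simp: g_def)
        show "dim_row (g ?x * V a) = dim_row (W a * g ?y)" "dim_col (g ?x * V a) = dim_col (W a * g ?y)"
          unfolding dims using rep_spaceD[OF V(2) a] vt by (auto simp: g_def)
        fix i j assume "i < dim_row (W a * g ?y)" "j < dim_col (W a * g ?y)"
        then have ij: "i < \<beta> ?x" "j < \<beta> ?y" unfolding dims .
        have vB: "(\<lambda>z. vp z a $$ (k, j)) \<in> B" "\<psi> (\<lambda>z. vp z a $$ (k, j)) = V a $$ (k, j)"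
          if k: "k < \<beta> ?x" for k
        proof -
          let ?L = "[(\<lambda>V. V a $$ (k, j), \<lambda>_. 1)]"
          have t: "?L \<in> tensors" using a k ij by (auto intro: poly_funs.intros)
          have e: "(\<lambda>z. vp z a $$ (k, j)) = pullback ?L" by (simp add: pullback_def)
          show "(\<lambda>z. vp z a $$ (k, j)) \<in> B" unfolding e B_def using t by (rule imageI)
          with \<psi>(2) have "\<psi> (\<lambda>z. vp z a $$ (k, j)) = \<phi> (pullback ?L)" by (simp add: e)
          then show "\<psi> (\<lambda>z. vp z a $$ (k, j)) = V a $$ (k, j)" unfolding \<phi>[OF t] by simp
        qed
        have wB: "(\<lambda>z. wp z a $$ (i, k)) \<in> B" "\<psi> (\<lambda>z. wp z a $$ (i, k)) = W a $$ (i, k)"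
          if k: "k < \<beta> ?y" for k
        proof -
          let ?L = "[(\<lambda>_. 1, \<lambda>V. V a $$ (i, k))]"
          have t: "?L \<in> tensors" using a k ij by (auto intro: poly_funs.intros)
          have e: "(\<lambda>z. wp z a $$ (i, k)) = pullback ?L" by (simp add: pullback_def)
          show "(\<lambda>z. wp z a $$ (i, k)) \<in> B" unfolding e B_def using t by (rule imageI)
          with \<psi>(2) have "\<psi> (\<lambda>z. wp z a $$ (i, k)) = \<phi> (pullback ?L)" by (simp add: e)
          then show "\<psi> (\<lambda>z. wp z a $$ (i, k)) = W a $$ (i, k)" unfolding \<phi>[OF t] by simp
        qed
        \<comment> \<open>The intertwining identity holds at every point of GL x C, so it is an
          identity in A. Applying \<open>\<psi>\<close> replaces the first representation by V and
          the second by W.\<close>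
        have pt: "(\<Sum>k<\<beta> ?x. gp z ?x $$ (i, k) * vp z a $$ (k, j)) = (\<Sum>k<\<beta> ?y. wp z a $$ (i, k) * gp z ?y $$ (k, j))" for z
        proof -
          have "gp z ?x * vp z a = wp z a * gp z ?y"
            using act_eq_iff[OF base_pt_in(1) base_pt_in(4,5), of z] a by blast
          then have "(gp z ?x * vp z a) $$ (i, j) = (wp z a * gp z ?y) $$ (i, j)" by simp
          then show ?thesis
            using GL_carrier(1)[OF base_pt_in(1) vt(1), of z] GL_carrier(1)[OF base_pt_in(1) vt(2), of z]
              rep_spaceD[OF base_pt_in(4) a, of z] rep_spaceD[OF base_pt_in(5) a, of z] ij
            by (auto simp: scalar_prod_def atLeast0LessThan)
        qed
        have BA: "f \<in> B \<Longrightarrow> f \<in> A" for f using Af(2) by blast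
        have "(\<Sum>k<\<beta> ?x. \<psi> (\<lambda>z. gp z ?x $$ (i, k)) * V a $$ (k, j)) =
            \<psi> (\<lambda>z. \<Sum>k<\<beta> ?x. gp z ?x $$ (i, k) * vp z a $$ (k, j))"
        proof -
          have m: "\<psi> (\<lambda>z. gp z ?x $$ (i, k) * vp z a $$ (k, j)) = \<psi> (\<lambda>z. gp z ?x $$ (i, k)) * V a $$ (k, j)"
            if "k \<in> {..<\<beta> ?x}" for k
            using hom_on_fun_alg(1)[OF \<psi>(1) Aa YA[OF vt(1) ij(1)] BA[OF vB(1)]] vB(2) that by auto
          have A': "(\<lambda>z. gp z ?x $$ (i, k) * vp z a $$ (k, j)) \<in> A" if "k \<in> {..<\<beta> ?x}" for k
            using that by (intro fun_algD(3)[OF Aa] YA vt BA vB ij) auto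
          show ?thesis
            by (rule trans[OF hom_on_fun_alg(2)[OF \<psi>(1) Aa A'] sum.cong[OF refl m], symmetric])
        qed
        also have "\<dots> = \<psi> (\<lambda>z. \<Sum>k<\<beta> ?y. wp z a $$ (i, k) * gp z ?y $$ (k, j))" unfolding pt ..
        also have "\<dots> = (\<Sum>k<\<beta> ?y. W a $$ (i, k) * \<psi> (\<lambda>z. gp z ?y $$ (k, j)))"
        proof -
          have m: "\<psi> (\<lambda>z. wp z a $$ (i, k) * gp z ?y $$ (k, j)) = W a $$ (i, k) * \<psi> (\<lambda>z. gp z ?y $$ (k, j))"
            if "k \<in> {..<\<beta> ?y}" for k
            using hom_on_fun_alg(1)[OF \<psi>(1) Aa BA[OF wB(1)] YA[OF vt(2) _ ij(2)]] wB(2) that by auto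
          have A': "(\<lambda>z. wp z a $$ (i, k) * gp z ?y $$ (k, j)) \<in> A" if "k \<in> {..<\<beta> ?y}" for k
            using that by (intro fun_algD(3)[OF Aa] YA vt BA wB ij) auto
          show ?thesis
            by (rule trans[OF hom_on_fun_alg(2)[OF \<psi>(1) Aa A'] sum.cong[OF refl m]])
        qed
        finally show "(g ?x * V a) $$ (i, j) = (W a * g ?y) $$ (i, j)"
          using rep_spaceD[OF V(2) a] rep_spaceD[OF Ws a] vt ij
          by (auto simp: scalar_prod_def atLeast0LessThan g_def)
      qed
    qed
    then show ?thesis unfolding orbit_def using gG by blast
  qed
  have "C = zariski Q \<beta> closure_of orbit Q \<beta> V"
  proof (rule orbit_closure_eqI[OF V(1)])
    fix f assume f: "f \<in> poly_funs Q \<beta>" "\<forall>g\<in>carrier (GL Q \<beta>). f (act Q \<beta> g V) = 0"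
    \<comment> \<open>Where the second factor is nonzero, W lies in the orbit and f vanishes.
      Irreducibility cancels that factor.\<close>
    have "f W * bilin L V W = 0" if "W \<in> C" for W
      using reach[OF that] f(2) by (auto simp: orbit_def)
    from C_domain[OF f(1) bilin_poly_fun[OF L(1)] this]
    show "\<forall>W\<in>C. f W = 0" using nz base_pt_in(3) by blast
  qed
  then show ?thesis using V(1) by blast
qed

end

section \<open>Invariant fractions\<close>

text \<open>Euclid's lemma for p and q, which are a and b divided by their gcd e. Since r b = a s,
  the element a = e p divides both r a and r b, hence their gcd, which is associated to r e.
  Cancelling e leaves p dividing r.\<close>

lemma (in factorial_monoid) divides_of_cross_product:
  assumes carr: "a \<in> carrier G" "b \<in> carrier G" "p \<in> carrier G" "q \<in> carrier G" "r \<in> carrier G" "s \<in> carrier G"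
    and a: "a = somegcd G a b \<otimes> p" and b: "b = somegcd G a b \<otimes> q" and cross: "p \<otimes> s = r \<otimes> q"
  shows "p divides r"
proof -
  let ?e = "somegcd G a b"
  have e: "?e \<in> carrier G" using carr by simp
  have "r \<otimes> b = ?e \<otimes> (r \<otimes> q)" using carr e by (subst b) (simp add: m_lcomm)
  also have "\<dots> = ?e \<otimes> (p \<otimes> s)" by (simp only: cross)
  also have "\<dots> = (?e \<otimes> p) \<otimes> s" using carr e by (simp add: m_assoc)
  also have "\<dots> = a \<otimes> s" by (simp only: a[symmetric])
  finally have "a divides r \<otimes> b" by (rule dividesI[rotated]) (use carr in simp)
  moreover have "a divides r \<otimes> a" using carr by (intro dividesI[of r]) (simp_all add: m_comm)
  ultimately have "a divides somegcd G (r \<otimes> a) (r \<otimes> b)"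
    using carr by (intro gcd_divides) auto
  moreover have "somegcd G (r \<otimes> a) (r \<otimes> b) \<sim> r \<otimes> ?e"
    using gcd_mult[of a b r] carr e by (auto intro: associated_sym)
  ultimately have "a divides r \<otimes> ?e"
    using carr e by (meson divides_cong_r m_closed gcd_closed)
  then obtain x where x: "x \<in> carrier G" "r \<otimes> ?e = a \<otimes> x" by (auto elim: dividesE)
  have "?e \<otimes> r = ?e \<otimes> (p \<otimes> x)"
    using x carr e a by (metis m_assoc m_comm)
  then have "r = p \<otimes> x" using carr e x by (simp add: l_cancel)
  then show ?thesis using x(1) by (rule dividesI[rotated])
qed

context quiver_component
begin

text \<open>A function on C x C that vanishes on the graph of the action but not everywhere.
  Indexing the terms by a finite set lets single terms be dropped.\<close>

definition graph_relation :: "nat set \<Rightarrow> (nat \<Rightarrow> ('e \<Rightarrow> 'k mat) \<Rightarrow> 'k) \<Rightarrow> (nat \<Rightarrow> ('e \<Rightarrow> 'k mat) \<Rightarrow> 'k) \<Rightarrow> bool" where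
  "graph_relation I c m \<longleftrightarrow> finite I \<and> (\<forall>i\<in>I. c i \<in> poly_funs Q \<beta> \<and> m i \<in> poly_funs Q \<beta>) \<and>
     (\<forall>g\<in>carrier (GL Q \<beta>). \<forall>V\<in>C. (\<Sum>i\<in>I. c i V * m i (act Q \<beta> g V)) = 0) \<and>
     (\<exists>V\<in>C. \<exists>W\<in>C. (\<Sum>i\<in>I. c i V * m i W) \<noteq> 0)"

lemma graph_relationI:
  assumes "finite I" "\<And>i. i \<in> I \<Longrightarrow> c i \<in> poly_funs Q \<beta>" "\<And>i. i \<in> I \<Longrightarrow> m i \<in> poly_funs Q \<beta>"
    "\<And>g V. g \<in> carrier (GL Q \<beta>) \<Longrightarrow> V \<in> C \<Longrightarrow> (\<Sum>i\<in>I. c i V * m i (act Q \<beta> g V)) = 0"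
    "V \<in> C" "W \<in> C" "(\<Sum>i\<in>I. c i V * m i W) \<noteq> 0"
  shows "graph_relation I c m"
  unfolding graph_relation_def using assms by auto

lemma graph_relationD:
  assumes "graph_relation I c m"
  shows "finite I" "i \<in> I \<Longrightarrow> c i \<in> poly_funs Q \<beta>" "i \<in> I \<Longrightarrow> m i \<in> poly_funs Q \<beta>"
    "g \<in> carrier (GL Q \<beta>) \<Longrightarrow> V \<in> C \<Longrightarrow> (\<Sum>i\<in>I. c i V * m i (act Q \<beta> g V)) = 0"
    "\<exists>V\<in>C. \<exists>W\<in>C. (\<Sum>i\<in>I. c i V * m i W) \<noteq> 0"
  using assms unfolding graph_relation_def by auto

lemma graph_relation_exists:
  assumes "\<not> (\<exists>V\<in>C. C = zariski Q \<beta> closure_of orbit Q \<beta> V)"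
  shows "\<exists>I c m. graph_relation I c m"
proof (rule ccontr)
  assume n: "\<nexists>I c m. graph_relation I c m"
  have "bilin L V W = 0" if L: "L \<in> tensors"
    and z: "\<And>g V. g \<in> carrier (GL Q \<beta>) \<Longrightarrow> V \<in> C \<Longrightarrow> bilin L V (act Q \<beta> g V) = 0"
    and VW: "V \<in> C" "W \<in> C" for L V W
  proof (rule ccontr)
    assume nz: "bilin L V W \<noteq> 0"
    have eq: "bilin L V W = (\<Sum>i\<in>{..<length L}. fst (L ! i) V * snd (L ! i) W)" for V W
      unfolding bilin_def by (subst sum_list_sum_nth) (simp add: split_beta atLeast0LessThan)
    have LP: "fst (L ! i) \<in> poly_funs Q \<beta>" "snd (L ! i) \<in> poly_funs Q \<beta>" if "i \<in> {..<length L}" for i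
    proof -
      have "L ! i \<in> poly_funs Q \<beta> \<times> poly_funs Q \<beta>" using L that nth_mem[of i L] by auto
      then show "fst (L ! i) \<in> poly_funs Q \<beta>" "snd (L ! i) \<in> poly_funs Q \<beta>" by auto
    qed
    have "graph_relation {..<length L} (\<lambda>i. fst (L ! i)) (\<lambda>i. snd (L ! i))"
      by (rule graph_relationI[OF _ LP _ VW]) (use z nz eq in simp_all)
    then show False using n by auto
  qed
  from dense_orbit_exists[OF this] show False using assms by simp
qed

text \<open>In a relation of minimal length the ratios of the coefficients \<open>c\<^sub>i\<close> are invariant: replacing \<open>V\<close> by
  \<open>kV\<close> gives another relation with the same \<open>m\<^sub>i\<close>, and eliminating one term must give zero.\<close>

lemma invariant_fraction:
  assumes ex: "\<not> (\<exists>V\<in>C. C = zariski Q \<beta> closure_of orbit Q \<beta> V)"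
  obtains c d where "c \<in> poly_funs Q \<beta>" "d \<in> poly_funs Q \<beta>"
    "\<And>g V. g \<in> carrier (GL Q \<beta>) \<Longrightarrow> V \<in> C \<Longrightarrow> c (act Q \<beta> g V) * d V = c V * d (act Q \<beta> g V)"
    "\<And>x y. (\<And>V. V \<in> C \<Longrightarrow> x * c V + y * d V = 0) \<Longrightarrow> x = 0 \<and> y = 0"
proof -
  interpret G: group "GL Q \<beta> :: ('v \<Rightarrow> 'k mat) monoid" by (rule group_GL)
  define P where "P n \<longleftrightarrow> (\<exists>I c m. graph_relation I c m \<and> card I = n)" for n
  have "\<exists>n. P n" unfolding P_def using graph_relation_exists[OF ex] by auto
  then have "P (LEAST n. P n)" by (rule LeastI_ex)
  then obtain I c m where rel: "graph_relation I c m" and cI: "card I = (LEAST n. P n)" unfolding P_def by auto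
  have small: "\<not> graph_relation J c' m'" if "card J < card I" for J c' m'
    using not_less_Least[of "card J" P] that unfolding cI P_def by auto
  note rel' = graph_relationD[OF rel]
  have fI: "finite I" by (rule rel')
  obtain V0 W0 where VW0: "V0 \<in> C" "W0 \<in> C" "(\<Sum>i\<in>I. c i V0 * m i W0) \<noteq> 0" using rel'(5) by auto
  \<comment> \<open>Minimality makes the functions \<open>m i\<close> linearly independent on C,
    since a dependence would eliminate one term of the relation.\<close>
  have indep: "a j = 0" if a: "\<And>W. W \<in> C \<Longrightarrow> (\<Sum>i\<in>I. a i * m i W) = 0" and j: "j \<in> I" for a :: "nat \<Rightarrow> 'k" and j
  proof (rule ccontr)
    assume nz: "a j \<noteq> 0"
    \<comment> \<open>Subtracting \<open>c j V / a j\<close> times the dependence leaves the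
      function on C x C unchanged. As \<open>b j = -1\<close>, the coefficient at j becomes
      0.\<close>
    define b where "b i = - (a i / a j)" for i
    define c' where "c' i = (\<lambda>V. c i V + b i * c j V)" for i
    have eq: "(\<Sum>i\<in>I - {j}. c' i V * m i W) = (\<Sum>i\<in>I. c i V * m i W)" if "W \<in> C" for V W
    proof -
      have "(\<Sum>i\<in>I - {j}. c' i V * m i W) = (\<Sum>i\<in>I. c' i V * m i W)"
        using fI nz by (intro sum.mono_neutral_left) (auto simp: c'_def b_def)
      also have "\<dots> = (\<Sum>i\<in>I. c i V * m i W - (c j V / a j) * (a i * m i W))"
        by (intro sum.cong refl) (simp add: c'_def b_def algebra_simps)
      also have "\<dots> = (\<Sum>i\<in>I. c i V * m i W) - (c j V / a j) * (\<Sum>i\<in>I. a i * m i W)"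
        by (simp add: sum_subtractf sum_distrib_left)
      finally show ?thesis using a[OF that] by simp
    qed
    have "graph_relation (I - {j}) c' m"
    proof (rule graph_relationI)
      show "V0 \<in> C" "W0 \<in> C" "(\<Sum>i\<in>I - {j}. c' i V0 * m i W0) \<noteq> 0" using VW0 eq by simp_all
      fix i assume "i \<in> I - {j}"
      then show "c' i \<in> poly_funs Q \<beta>" "m i \<in> poly_funs Q \<beta>"
        unfolding c'_def using j by (auto intro!: poly_funs.add poly_funs.mult poly_funs.const rel'(2,3))
    next
      fix g :: "'v \<Rightarrow> 'k mat" and V assume gV: "g \<in> carrier (GL Q \<beta>)" "V \<in> C"
      then show "(\<Sum>i\<in>I - {j}. c' i V * m i (act Q \<beta> g V)) = 0"
        using eq[OF act_in_C[OF gV(2,1)]] rel'(4)[OF gV] by simp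
    qed (use fI in simp)
    moreover have "card (I - {j}) < card I" using fI j by (rule card_Diff1_less)
    ultimately show False using small by simp
  qed
  have cross: "c j V * c i (act Q \<beta> k V) = c i V * c j (act Q \<beta> k V)"
    if ij: "i \<in> I" "j \<in> I" and k: "k \<in> carrier (GL Q \<beta>)" and V: "V \<in> C" for i j k V
  proof -
    have "\<forall>i\<in>I. \<exists>f. f \<in> poly_funs Q \<beta> \<and> (\<forall>V\<in>rep_space Q \<beta>. c i (act Q \<beta> k V) = f V)"
    proof
      fix i assume i: "i \<in> I"
      obtain f where "f \<in> poly_funs Q \<beta>" "\<And>V. V \<in> rep_space Q \<beta> \<Longrightarrow> c i (act Q \<beta> k V) = f V"
        by (rule poly_fun_actE[OF rel'(2)[OF i] k], rule that)
      then show "\<exists>f. f \<in> poly_funs Q \<beta> \<and> (\<forall>V\<in>rep_space Q \<beta>. c i (act Q \<beta> k V) = f V)" by auto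
    qed
    from bchoice[OF this] obtain ck where
      "\<forall>i\<in>I. ck i \<in> poly_funs Q \<beta> \<and> (\<forall>V\<in>rep_space Q \<beta>. c i (act Q \<beta> k V) = ck i V)" ..
    then have ck: "\<And>i. i \<in> I \<Longrightarrow> ck i \<in> poly_funs Q \<beta>"
      "\<And>i V. i \<in> I \<Longrightarrow> V \<in> C \<Longrightarrow> c i (act Q \<beta> k V) = ck i V" using C_rep_space by auto
    define e where "e i = (\<lambda>V. c j V * ck i V - c i V * ck j V)" for i
    have eP: "e i \<in> poly_funs Q \<beta>" if "i \<in> I" for i
      unfolding e_def by (intro fun_alg_diff[OF fun_alg_poly_funs] poly_funs.mult rel'(2) ck(1) ij that)
    have eq: "(\<Sum>i\<in>I - {j}. e i V * m i W) =
      c j V * (\<Sum>i\<in>I. c i (act Q \<beta> k V) * m i W) - ck j V * (\<Sum>i\<in>I. c i V * m i W)"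
      if "V \<in> C" for V W
    proof -
      have "(\<Sum>i\<in>I - {j}. e i V * m i W) = (\<Sum>i\<in>I. e i V * m i W)"
        using fI by (intro sum.mono_neutral_left) (auto simp: e_def)
      also have "\<dots> = (\<Sum>i\<in>I. c j V * (c i (act Q \<beta> k V) * m i W) - ck j V * (c i V * m i W))"
        using that by (intro sum.cong refl) (simp add: e_def ck(2) algebra_simps)
      also have "\<dots> = c j V * (\<Sum>i\<in>I. c i (act Q \<beta> k V) * m i W) - ck j V * (\<Sum>i\<in>I. c i V * m i W)"
        by (simp add: sum_subtractf sum_distrib_left)
      finally show ?thesis .
    qed
    have van: "(\<Sum>i\<in>I - {j}. e i V * m i (act Q \<beta> g V)) = 0" if g: "g \<in> carrier (GL Q \<beta>)" and V: "V \<in> C" for g V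
    proof -
      \<comment> \<open>Writing gV = (g k^-1)(kV), the relation at kV controls the translated
        coefficients against the same values m_i(gV).\<close>
      let ?h = "g \<otimes>\<^bsub>GL Q \<beta>\<^esub> inv\<^bsub>GL Q \<beta>\<^esub> k"
      have h: "?h \<in> carrier (GL Q \<beta>)" using g k by simp
      have "act Q \<beta> ?h (act Q \<beta> k V) = act Q \<beta> g V"
        using act_mult[OF g G.inv_closed[OF k] act_in_rep_space[OF k C_rep_space[OF V]]]
          act_inv(1)[OF k C_rep_space[OF V]] by simp
      then have "(\<Sum>i\<in>I. c i (act Q \<beta> k V) * m i (act Q \<beta> g V)) = 0"
        using rel'(4)[OF h act_in_C[OF V k]] by simp
      then show ?thesis unfolding eq[OF V] using rel'(4)[OF g V] by simp
    qed
    have "(\<Sum>i\<in>I - {j}. e i V * m i W) = 0" if VW: "V \<in> C" "W \<in> C" for V W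
    proof (rule ccontr)
      assume nz: "(\<Sum>i\<in>I - {j}. e i V * m i W) \<noteq> 0"
      have "graph_relation (I - {j}) e m"
        by (rule graph_relationI[where V = V and W = W]) (use fI eP rel'(3) van VW nz in auto)
      moreover have "card (I - {j}) < card I" using fI ij(2) by (rule card_Diff1_less)
      ultimately show False using small by simp
    qed
    moreover have "(\<Sum>i\<in>I - {j}. e i V * m i W) = (\<Sum>i\<in>I. e i V * m i W)" for V W
      using fI by (intro sum.mono_neutral_left) (auto simp: e_def)
    ultimately have "(\<Sum>i\<in>I. e i V * m i W) = 0" if "W \<in> C" for W using V that by simp
    from indep[OF this ij(1)] have "e i V = 0" .
    then show ?thesis using ck(2)[OF ij(1) V] ck(2)[OF ij(2) V] by (simp add: e_def)
  qed
  have "\<exists>j\<in>I. c j V0 \<noteq> 0"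
  proof (rule ccontr)
    assume "\<not> ?thesis"
    then have "(\<Sum>i\<in>I. c i V0 * m i W0) = 0" by (intro sum.neutral) auto
    then show False using VW0(3) by simp
  qed
  then obtain j where j: "j \<in> I" "c j V0 \<noteq> 0" by auto
  \<comment> \<open>If all coefficients were constant multiples of \<open>c j\<close>, the relation
    would factor as c_j(V) s(W). At g = 1 it says c_j s = 0 on C, so s = 0 by irreducibility, and
    the relation would be zero on C x C.\<close>
  have "\<exists>i\<in>I. \<forall>x y. (\<forall>V\<in>C. x * c i V + y * c j V = 0) \<longrightarrow> x = 0 \<and> y = 0"
  proof (rule ccontr)
    assume n: "\<not> ?thesis"
    have "\<forall>i\<in>I. \<exists>a. \<forall>V\<in>C. c i V = a * c j V"
    proof
      fix i assume "i \<in> I"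
      then obtain x y where xy: "\<forall>V\<in>C. x * c i V + y * c j V = 0" "\<not> (x = 0 \<and> y = 0)" using n by auto
      then have "x \<noteq> 0" using VW0(1) j(2) by auto
      then have "\<forall>V\<in>C. c i V = (- y / x) * c j V"
        using xy(1) by (auto simp: field_simps eq_neg_iff_add_eq_0)
      then show "\<exists>a. \<forall>V\<in>C. c i V = a * c j V" by (rule exI)
    qed
    from bchoice[OF this] obtain a where a: "\<forall>i\<in>I. \<forall>V\<in>C. c i V = a i * c j V" ..
    have eq: "(\<Sum>i\<in>I. c i V * m i W) = c j V * (\<Sum>i\<in>I. a i * m i W)" if "V \<in> C" for V W
      using a that by (simp add: sum_distrib_left mult_ac)
    define s where "s = (\<lambda>W. \<Sum>i\<in>I. a i * m i W)"
    have sP: "s \<in> poly_funs Q \<beta>"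
      unfolding s_def by (intro fun_alg_sum[OF fun_alg_poly_funs] poly_funs.mult poly_funs.const rel'(3))
    have "c j V * s V = 0" if V: "V \<in> C" for V
      using rel'(4)[OF G.one_closed V] act_one[OF C_rep_space[OF V]] eq[OF V] by (simp add: s_def)
    from C_domain[OF rel'(2)[OF j(1)] sP this] have "\<forall>V\<in>C. s V = 0" using j(2) VW0(1) by auto
    then show False using VW0 eq[OF VW0(1), of W0] by (simp add: s_def)
  qed
  then obtain i where i: "i \<in> I" "\<And>x y. (\<forall>V\<in>C. x * c i V + y * c j V = 0) \<Longrightarrow> x = 0 \<and> y = 0" by auto
  show thesis
  proof (rule that[OF rel'(2)[OF i(1)] rel'(2)[OF j(1)]])
    show "c i (act Q \<beta> g V) * c j V = c i V * c j (act Q \<beta> g V)" if "g \<in> carrier (GL Q \<beta>)" "V \<in> C" for g V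
      using cross[OF i(1) j(1) that] by (simp add: mult.commute)
    fix x y assume "\<And>V. V \<in> C \<Longrightarrow> x * c i V + y * c j V = 0"
    then show "x = 0 \<and> y = 0" by (intro i(2) ballI)
  qed
qed

text \<open>Dividing by the gcd makes p and q coprime in the coordinate ring, so p divides its
  translates. This divisibility is exported as invariance of the zero set of p.\<close>

lemma coprime_numerator:
  assumes fd: "factorial_domain (coord_ring Q \<beta> C)"
    and c: "c \<in> poly_funs Q \<beta>" "V1 \<in> C" "c V1 \<noteq> 0" and d: "d \<in> poly_funs Q \<beta>" "V2 \<in> C" "d V2 \<noteq> 0"
    and cross: "\<And>g V. g \<in> carrier (GL Q \<beta>) \<Longrightarrow> V \<in> C \<Longrightarrow> c (act Q \<beta> g V) * d V = c V * d (act Q \<beta> g V)"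
  obtains e p q where "e \<in> poly_funs Q \<beta>" "p \<in> poly_funs Q \<beta>" "q \<in> poly_funs Q \<beta>"
    "\<And>V. V \<in> C \<Longrightarrow> c V = e V * p V" "\<And>V. V \<in> C \<Longrightarrow> d V = e V * q V"
    "\<And>g V. g \<in> carrier (GL Q \<beta>) \<Longrightarrow> V \<in> C \<Longrightarrow> p (act Q \<beta> g V) * q V = p V * q (act Q \<beta> g V)"
    "\<And>g V. g \<in> carrier (GL Q \<beta>) \<Longrightarrow> V \<in> C \<Longrightarrow> p V = 0 \<Longrightarrow> p (act Q \<beta> g V) = 0"
proof -
  let ?A = "coord_ring Q \<beta> C" and ?r = "\<lambda>f :: ('e \<Rightarrow> 'k mat) \<Rightarrow> 'k. restrict f C"
  interpret A: factorial_domain ?A by (rule fd)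
  note fm = A.factorial_monoid_axioms
  have gm: "gcd_condition_monoid (mult_of ?A)"
    by (rule factorial_monoid.gcd_condition[OF fm])
  have carr: "x \<in> carrier ?A \<longleftrightarrow> (\<exists>f\<in>poly_funs Q \<beta>. x = ?r f)" for x
    by (auto simp: coord_ring_def)
  have eqA: "?r f = ?r h \<longleftrightarrow> (\<forall>V\<in>C. f V = h V)" for f h :: "('e \<Rightarrow> 'k mat) \<Rightarrow> 'k"
    by (auto simp: restrict_def fun_eq_iff)
  have mult: "?r f \<otimes>\<^bsub>?A\<^esub> ?r h = ?r (\<lambda>V. f V * h V)" for f h
    by (auto simp: coord_ring_def)
  have zero: "\<zero>\<^bsub>?A\<^esub> = ?r (\<lambda>_. 0)" by (simp add: coord_ring_def)
  have nzA: "?r f \<in> carrier (mult_of ?A) \<longleftrightarrow> (\<exists>V\<in>C. f V \<noteq> 0)" if "f \<in> poly_funs Q \<beta>" for f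
    using that by (auto simp: carr zero eqA)
  have cA: "?r c \<in> carrier (mult_of ?A)" and dA: "?r d \<in> carrier (mult_of ?A)"
    using nzA[OF c(1)] nzA[OF d(1)] c d by auto
  let ?e = "somegcd (mult_of ?A) (?r c) (?r d)"
  have eA: "?e \<in> carrier (mult_of ?A)" by (rule gcd_condition_monoid.gcd_closed[OF gm cA dA])
  obtain p' where p': "p' \<in> carrier (mult_of ?A)" "?r c = ?e \<otimes>\<^bsub>?A\<^esub> p'"
    using gcd_condition_monoid.gcd_divides_l[OF gm cA dA] unfolding factor_def by auto
  obtain q' where q': "q' \<in> carrier (mult_of ?A)" "?r d = ?e \<otimes>\<^bsub>?A\<^esub> q'"
    using gcd_condition_monoid.gcd_divides_r[OF gm cA dA] unfolding factor_def by auto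
  obtain e where e: "e \<in> poly_funs Q \<beta>" "?e = ?r e" using eA carr by auto
  obtain p where p: "p \<in> poly_funs Q \<beta>" "p' = ?r p" using p'(1) carr by auto
  obtain q where q: "q \<in> poly_funs Q \<beta>" "q' = ?r q" using q'(1) carr by auto
  have cV: "c V = e V * p V" if "V \<in> C" for V
    using p'(2) that unfolding e p mult eqA by simp
  have dV: "d V = e V * q V" if "V \<in> C" for V
    using q'(2) that unfolding e q mult eqA by simp
  have pq: "p (act Q \<beta> g V) * q V = p V * q (act Q \<beta> g V)"
    and dvd: "p V = 0 \<Longrightarrow> p (act Q \<beta> g V) = 0"
    if g: "g \<in> carrier (GL Q \<beta>)" and V: "V \<in> C" for g V
  proof -
    obtain eg where eg: "eg \<in> poly_funs Q \<beta>" "\<And>V. V \<in> rep_space Q \<beta> \<Longrightarrow> e (act Q \<beta> g V) = eg V"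
      by (rule poly_fun_actE[OF e(1) g], rule that)
    obtain pg where pg: "pg \<in> poly_funs Q \<beta>" "\<And>V. V \<in> rep_space Q \<beta> \<Longrightarrow> p (act Q \<beta> g V) = pg V"
      by (rule poly_fun_actE[OF p(1) g], rule that)
    obtain qg where qg: "qg \<in> poly_funs Q \<beta>" "\<And>V. V \<in> rep_space Q \<beta> \<Longrightarrow> q (act Q \<beta> g V) = qg V"
      by (rule poly_fun_actE[OF q(1) g], rule that)
    \<comment> \<open>Translation by g maps C onto C, so it sends nonzero functions to nonzero
      functions.\<close>
    have inv: "\<exists>U\<in>C. f (act Q \<beta> g U) \<noteq> 0" if "\<exists>U\<in>C. f U \<noteq> 0" for f :: "_ \<Rightarrow> 'k"
    proof -
      from that obtain U where U: "U \<in> C" "f U \<noteq> 0" by auto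
      have "act Q \<beta> (inv\<^bsub>GL Q \<beta>\<^esub> g) U \<in> C" by (rule act_in_C[OF U(1) GL_inv(1)[OF g]])
      then show ?thesis using act_inv(2)[OF g C_rep_space[OF U(1)]] U(2) by (intro bexI[where x = "act Q \<beta> (inv\<^bsub>GL Q \<beta>\<^esub> g) U"]) simp_all
    qed
    have nz: "\<exists>U\<in>C. e U \<noteq> 0" "\<exists>U\<in>C. p U \<noteq> 0" "\<exists>U\<in>C. q U \<noteq> 0"
      using eA p'(1) q'(1) nzA e p q by metis+
    have nzg: "\<exists>U\<in>C. eg U \<noteq> 0" "\<exists>U\<in>C. pg U \<noteq> 0" "\<exists>U\<in>C. qg U \<noteq> 0"
      using inv[OF nz(1)] inv[OF nz(2)] inv[OF nz(3)] eg(2) pg(2) qg(2) C_rep_space by auto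
    \<comment> \<open>The invariance of c/d, with the common factors displayed. Both e and its
      translate are nonzero on C, so they cancel one after the other.\<close>
    have "eg U * (e U * (pg U * q U + (-1) * (p U * qg U))) = 0" if "U \<in> C" for U
      using cross[OF g that] cV[OF that] dV[OF that] cV[OF act_in_C[OF that g]] dV[OF act_in_C[OF that g]]
        eg(2)[OF C_rep_space[OF that]] pg(2)[OF C_rep_space[OF that]] qg(2)[OF C_rep_space[OF that]]
      by (simp add: algebra_simps)
    moreover have pf: "(\<lambda>U. pg U * q U + (-1) * (p U * qg U)) \<in> poly_funs Q \<beta>"
      by (intro poly_funs.add poly_funs.mult poly_funs.const pg qg p q)
    ultimately have "\<forall>U\<in>C. e U * (pg U * q U + (-1) * (p U * qg U)) = 0"
      using C_domain[OF eg(1) poly_funs.mult[OF e(1) pf]] nzg(1) by auto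
    then have "\<forall>U\<in>C. pg U * q U + (-1) * (p U * qg U) = 0"
      using C_domain[OF e(1) pf] nz(1) by auto
    then have pqU: "\<forall>U\<in>C. pg U * q U = p U * qg U" by simp
    then show "p (act Q \<beta> g V) * q V = p V * q (act Q \<beta> g V)"
      using V pg(2) qg(2) C_rep_space by simp
    have "?r p divides\<^bsub>mult_of ?A\<^esub> ?r pg"
    proof (rule factorial_monoid.divides_of_cross_product[OF fm])
      show "?r c \<in> carrier (mult_of ?A)" "?r d \<in> carrier (mult_of ?A)" by (rule cA dA)+
      show "?r p \<in> carrier (mult_of ?A)" "?r q \<in> carrier (mult_of ?A)" using p' q' p q by simp_all
      show "?r pg \<in> carrier (mult_of ?A)" "?r qg \<in> carrier (mult_of ?A)"
        using nzA[OF pg(1)] nzA[OF qg(1)] nzg by simp_all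
      show "?r c = ?e \<otimes>\<^bsub>mult_of ?A\<^esub> ?r p" "?r d = ?e \<otimes>\<^bsub>mult_of ?A\<^esub> ?r q" using p'(2) q'(2) p q by simp_all
      show "?r p \<otimes>\<^bsub>mult_of ?A\<^esub> ?r qg = ?r pg \<otimes>\<^bsub>mult_of ?A\<^esub> ?r q" unfolding mult_mult_of mult eqA using pqU by simp
    qed
    then obtain u' where u': "u' \<in> carrier ?A" "?r pg = ?r p \<otimes>\<^bsub>?A\<^esub> u'" unfolding factor_def by auto
    then obtain u where u: "u' = ?r u" using carr by auto
    have "pg V = p V * u V" using u'(2) V unfolding u mult eqA by simp
    then show "p V = 0 \<Longrightarrow> p (act Q \<beta> g V) = 0" using pg(2)[OF C_rep_space[OF V]] by simp
  qed
  show thesis by (rule that[OF e(1) p(1) q(1) cV dV pq dvd])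
qed

end

section \<open>Semi-invariance\<close>

text \<open>Gaussian elimination by row operations. Row swaps are avoided: a zero pivot is repaired
  by adding a lower row, so transvections and diagonal matrices with one varying entry
  suffice.\<close>

lemma invertible_mat_elementary_induct:
  fixes A :: "'k::field mat"
  assumes A: "A \<in> carrier_mat n n" "det A \<noteq> 0"
    and one: "P (1\<^sub>m n)"
    and mult: "\<And>A B. A \<in> carrier_mat n n \<Longrightarrow> B \<in> carrier_mat n n \<Longrightarrow> det A \<noteq> 0 \<Longrightarrow> det B \<noteq> 0 \<Longrightarrow>
      P A \<Longrightarrow> P B \<Longrightarrow> P (A * B)"
    and addrow: "\<And>a i j. i < n \<Longrightarrow> j < n \<Longrightarrow> i \<noteq> j \<Longrightarrow> P (addrow_mat n a i j)"
    and multrow: "\<And>a i. i < n \<Longrightarrow> a \<noteq> 0 \<Longrightarrow> P (multrow_mat n i a)"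
  shows "P A"
proof -
  \<comment> \<open>\<open>red A B\<close> says that A is obtained from B by multiplying on the left
    with an invertible matrix satisfying P. It therefore suffices to reduce A to the
    identity.\<close>
  define red where "red A B \<longleftrightarrow> B \<in> carrier_mat n n \<and> (\<exists>E\<in>carrier_mat n n. P E \<and> det E \<noteq> 0 \<and> A = E * B)"
    for A B
  have red_trans: "red A B'" if "red A B" "red B B'" for A B B'
  proof -
    from that obtain E E' where E: "E \<in> carrier_mat n n" "P E" "det E \<noteq> 0" "A = E * B"
      and E': "E' \<in> carrier_mat n n" "P E'" "det E' \<noteq> 0" "B = E' * B'" and B': "B' \<in> carrier_mat n n"
      unfolding red_def by auto
    have "A = E * E' * B'" unfolding E(4) E'(4) using E E' B' by (intro assoc_mult_mat[symmetric])
    moreover have "P (E * E')" "det (E * E') \<noteq> 0" "E * E' \<in> carrier_mat n n"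
      using E E' mult by (auto simp: det_mult[OF E(1) E'(1)])
    ultimately show ?thesis unfolding red_def using B' by auto
  qed
  have red_refl: "red A A" if "A \<in> carrier_mat n n" for A
    unfolding red_def using that one by (intro conjI bexI[of _ "1\<^sub>m n"]) auto
  have red_addrow: "red A (mat_addrow a k l A)"
    if "A \<in> carrier_mat n n" "k < n" "l < n" "k \<noteq> l" for A a k l
  proof -
    have "addrow_mat n (- a) k l * (addrow_mat n a k l * A) = addrow_mat n (- a) k l * addrow_mat n (- (- a)) k l * A"
      using that by (simp add: assoc_mult_mat[of _ n n _ n _ n])
    also have "\<dots> = A" unfolding addrow_mat_inv[OF that(2,3,4)] using that(1) by simp
    finally show ?thesis
      unfolding red_def addrow_mat[OF that(1,3)] using that addrow[OF that(2,3,4)]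
      by (intro conjI bexI[of _ "addrow_mat n (- a) k l"]) (auto simp: det_addrow_mat)
  qed
  have red_multrow: "red A (mat_multrow k a A)"
    if "A \<in> carrier_mat n n" "k < n" "a \<noteq> 0" for A a k
  proof -
    have "multrow_mat n k (inverse a) * (multrow_mat n k a * A) = multrow_mat n k (inverse a) * multrow_mat n k (inverse (inverse a)) * A"
      using that by (simp add: assoc_mult_mat[of _ n n _ n _ n])
    also have "\<dots> = A"
      using multrow_mat_inv[OF that(2), of "inverse a"] that by simp
    finally show ?thesis
      unfolding red_def multrow_mat[OF that(1)] using that multrow[OF that(2), of "inverse a"]
      by (intro conjI bexI[of _ "multrow_mat n k (inverse a)"]) (auto simp: det_multrow_mat)
  qed
  define unit_cols where "unit_cols j A \<longleftrightarrow> (\<forall>c<j. \<forall>r<n. A $$ (r, c) = (if r = c then 1 else 0))"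
    for j and A :: "'k mat"
  have "P A" if "j \<le> n" "A \<in> carrier_mat n n" "det A \<noteq> 0" "unit_cols j A" for j A
    using that
  \<comment> \<open>The number j of columns in final form increases during elimination, so the
    induction runs downward from j = n, where A is the identity.\<close>
  proof (induction j arbitrary: A rule: inc_induct)
    case base
    then have "A = 1\<^sub>m n" by (intro eq_matI) (auto simp: unit_cols_def)
    then show ?case using one by simp
  next
    case (step j)
    note A = step.prems(1) and u = step.prems(3) and j = \<open>j < n\<close>
    have "\<exists>r. j \<le> r \<and> r < n \<and> A $$ (r, j) \<noteq> 0"
    proof (rule ccontr)
      assume z: "\<not> ?thesis"
      \<comment> \<open>Without a pivot, column j is supported in rows above j, where the earlier
        columns are unit vectors. It is a combination of them, and v records that
        dependence.\<close>
      define v where "v = vec n (\<lambda>c. if c < j then - A $$ (c, j) else if c = j then 1 else 0)"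
      have "A *\<^sub>v v = 0\<^sub>v n"
      proof (rule eq_vecI)
        fix r assume r: "r < dim_vec (0\<^sub>v n :: 'k vec)"
        then have r: "r < n" by simp
        have "(A *\<^sub>v v) $ r = (\<Sum>c<n. A $$ (r, c) * v $ c)"
          using A r by (auto simp: v_def scalar_prod_def atLeast0LessThan)
        also have "\<dots> = (\<Sum>c<n. (if c = r \<and> c < j then - A $$ (c, j) else 0) + (if c = j then A $$ (r, c) else 0))"
          using u r by (intro sum.cong refl) (auto simp: v_def unit_cols_def)
        also have "\<dots> = (if r < j then - A $$ (r, j) else 0) + A $$ (r, j)"
        proof -
          have "(\<Sum>c<n. if c = r \<and> c < j then - A $$ (c, j) else 0) = (\<Sum>c<n. if c = r then (if r < j then - A $$ (r, j) else 0) else 0)"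
            by (intro sum.cong) auto
          then show ?thesis using r j by (simp add: sum.distrib)
        qed
        also have "\<dots> = 0" using z r by auto
        finally show "(A *\<^sub>v v) $ r = 0\<^sub>v n $ r" using r by simp
      qed (use A in auto)
      moreover have "v \<in> carrier_vec n" "v \<noteq> 0\<^sub>v n"
      proof -
        show "v \<in> carrier_vec n" by (simp add: v_def)
        have "v $ j \<noteq> 0\<^sub>v n $ j" using j by (simp add: v_def)
        then show "v \<noteq> 0\<^sub>v n" by auto
      qed
      ultimately have "det A = 0" using det_0_iff_vec_prod_zero_field[OF A] by auto
      then show False using step.prems(2) by simp
    qed
    then obtain r where r: "j \<le> r" "r < n" "A $$ (r, j) \<noteq> 0" by auto
    obtain B where B: "red A B" "unit_cols j B" "B $$ (j, j) \<noteq> 0"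
    proof (cases "A $$ (j, j) = 0")
      case False
      then show ?thesis using that[OF red_refl[OF A] u] by simp
    next
      case True
      then have "r \<noteq> j" using r by auto
      \<comment> \<open>Row r is zero in the columns before j, so adding it to row j makes the pivot
        nonzero and leaves the finished columns intact.\<close>
      let ?B = "mat_addrow 1 j r A"
      have "red A ?B" using red_addrow[OF A j r(2)] \<open>r \<noteq> j\<close> by auto
      moreover have "unit_cols j ?B" using u A r j \<open>r \<noteq> j\<close> by (auto simp: unit_cols_def)
      moreover have "?B $$ (j, j) \<noteq> 0" using A r j True by simp
      ultimately show ?thesis by (rule that)
    qed
    have Bc: "B \<in> carrier_mat n n" using B(1) by (simp add: red_def)
    define D where "D = mat_multrow j (inverse (B $$ (j, j))) B"
    have D: "red A D"
      unfolding D_def by (rule red_trans[OF B(1)]) (use red_multrow[OF Bc j] B(3) in simp)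
    have Dc: "D \<in> carrier_mat n n" using D by (simp add: red_def)
    have Dj: "D $$ (j, j) = 1" and Du: "unit_cols j D"
      using B Bc j by (auto simp: D_def unit_cols_def)
    \<comment> \<open>The state after column j has been cleared in the rows of F; inserting one row
      into F is one row addition.\<close>
    define clear where "clear F = mat n n (\<lambda>(r, c). if r \<in> F then D $$ (r, c) - D $$ (r, j) * D $$ (j, c) else D $$ (r, c))" for F
    have "red D (clear F)" if "finite F" "F \<subseteq> {..<n} - {j}" for F
      using that
    proof (induction F rule: finite_induct)
      case empty
      have "clear {} = D" using Dc by (intro eq_matI) (auto simp: clear_def)
      then show ?case using red_refl[OF Dc] by simp
    next
      case (insert r F)
      then have r: "r < n" "r \<noteq> j" "r \<notin> F" "j \<notin> F" by auto
      have "clear (insert r F) = mat_addrow (- D $$ (r, j)) r j (clear F)"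
        using r j by (intro eq_matI) (auto simp: clear_def)
      moreover have "red (clear F) (mat_addrow (- D $$ (r, j)) r j (clear F))"
        by (rule red_addrow) (use r j in \<open>auto simp: clear_def\<close>)
      moreover have "red D (clear F)" using insert by auto
      ultimately show ?case using red_trans by metis
    qed
    from this[of "{..<n} - {j}"] have rc: "red A (clear ({..<n} - {j}))"
      using red_trans[OF D] by auto
    moreover have "unit_cols (Suc j) (clear ({..<n} - {j}))"
      using Du Dj j unfolding unit_cols_def less_Suc_eq by (auto simp: clear_def)
    moreover obtain E where E: "E \<in> carrier_mat n n" "P E" "det E \<noteq> 0" "A = E * clear ({..<n} - {j})"
      and cc: "clear ({..<n} - {j}) \<in> carrier_mat n n"
      using rc unfolding red_def by auto
    moreover have dc: "det (clear ({..<n} - {j})) \<noteq> 0"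
      using step.prems(2) unfolding E(4) det_mult[OF E(1) cc] by auto
    ultimately have "P (clear ({..<n} - {j}))" using step.IH by auto
    then show ?case unfolding E(4) using E(1-3) cc dc by (intro mult)
  qed
  from this[of 0 A] A show ?thesis by (simp add: unit_cols_def)
qed

text \<open>After splitting off the largest power of the variable, the cofactor has no root at all
  and is constant. The conclusion compares two coefficients because these will be functions on
  C.\<close>

lemma poly_no_nonzero_root_monom:
  fixes R :: "'k::alg_closed_field poly"
  assumes nz: "\<And>t. t \<noteq> 0 \<Longrightarrow> poly R t \<noteq> 0" and ij: "coeff R i \<noteq> 0" "coeff R j \<noteq> 0"
  shows "i = j"
proof -
  have "R \<noteq> 0" using ij by auto
  from order_decomp[OF this, of 0] obtain q where q: "R = [:- 0, 1:] ^ order 0 R * q" "\<not> [:- 0, 1:] dvd q"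
    by auto
  have "poly q t \<noteq> 0" for t
  proof (cases "t = 0")
    case True
    then show ?thesis using q(2) poly_eq_0_iff_dvd[of q 0] by auto
  next
    case False
    then show ?thesis using nz[OF False] by (subst (asm) q(1)) auto
  qed
  then have "degree q = 0" using alg_closed_imp_poly_has_root[of q] by auto
  then obtain c where "q = [:c:]" by (metis degree_eq_zeroE)
  then have "R = monom c (order 0 R)" using q(1) by (simp add: monom_altdef mult.commute)
  then have "coeff R m \<noteq> 0 \<Longrightarrow> m = order 0 R" for m by (metis coeff_monom)
  then show ?thesis using ij by metis
qed

lemma fun_power_apply: "(f ^ n) z = f z ^ n"
  by (induction n) auto

section \<open>Group elements concentrated at one vertex\<close>

context quiver
begin

definition at_vertex :: "'v \<Rightarrow> 'k::field mat \<Rightarrow> 'v \<Rightarrow> 'k mat" where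
  "at_vertex x A = (\<lambda>y\<in>verts Q. if y = x then A else 1\<^sub>m (\<beta> y))"

lemma GL_eqI:
  fixes g h :: "'v \<Rightarrow> 'k::field mat"
  assumes "g \<in> carrier (GL Q \<beta>)" "h \<in> carrier (GL Q \<beta>)" "\<And>x. x \<in> verts Q \<Longrightarrow> g x = h x"
  shows "g = h"
  using assms by (auto simp: GL_iff intro: extensionalityI)

lemma at_vertex_in_GL:
  assumes "x \<in> verts Q" "A \<in> carrier_mat (\<beta> x) (\<beta> x)" "det A \<noteq> 0"
  shows "at_vertex x A \<in> carrier (GL Q \<beta>)"
  using assms by (auto simp: GL_iff at_vertex_def)

lemma at_vertex_mult:
  fixes A B :: "'k::field mat"
  assumes x: "x \<in> verts Q" and A: "A \<in> carrier_mat (\<beta> x) (\<beta> x)" "det A \<noteq> 0"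
    and B: "B \<in> carrier_mat (\<beta> x) (\<beta> x)" "det B \<noteq> 0"
  shows "at_vertex x (A * B) = at_vertex x A \<otimes>\<^bsub>GL Q \<beta>\<^esub> at_vertex x B"
proof (rule GL_eqI)
  interpret G: group "GL Q \<beta> :: ('v \<Rightarrow> 'k mat) monoid" by (rule group_GL)
  show "at_vertex x (A * B) \<in> carrier (GL Q \<beta>)"
    using A B by (intro at_vertex_in_GL x mult_carrier_mat) (auto simp: det_mult[OF A(1) B(1)])
  show "at_vertex x A \<otimes>\<^bsub>GL Q \<beta>\<^esub> at_vertex x B \<in> carrier (GL Q \<beta>)"
    by (intro G.m_closed at_vertex_in_GL x A B)
  fix y assume "y \<in> verts Q"
  then show "at_vertex x (A * B) y = (at_vertex x A \<otimes>\<^bsub>GL Q \<beta>\<^esub> at_vertex x B) y"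
    by (simp add: GL_mult_apply at_vertex_def)
qed

lemma at_vertex_one: "at_vertex x (1\<^sub>m (\<beta> x)) = (\<one>\<^bsub>GL Q \<beta>\<^esub> :: 'v \<Rightarrow> 'k::field mat)"
proof (rule GL_eqI)
  interpret G: group "GL Q \<beta> :: ('v \<Rightarrow> 'k mat) monoid" by (rule group_GL)
  show "\<one>\<^bsub>GL Q \<beta>\<^esub> \<in> carrier (GL Q \<beta> :: ('v \<Rightarrow> 'k mat) monoid)" by simp
  show "at_vertex x (1\<^sub>m (\<beta> x)) \<in> carrier (GL Q \<beta> :: ('v \<Rightarrow> 'k mat) monoid)"
    by (auto simp: GL_iff at_vertex_def)
qed (auto simp: at_vertex_def GL_one_apply)

lemma at_vertex_inv:
  fixes A B :: "'k::field mat"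
  assumes x: "x \<in> verts Q" and A: "A \<in> carrier_mat (\<beta> x) (\<beta> x)" "det A \<noteq> 0"
    and B: "B \<in> carrier_mat (\<beta> x) (\<beta> x)" "det B \<noteq> 0" and AB: "B * A = 1\<^sub>m (\<beta> x)"
  shows "inv\<^bsub>GL Q \<beta>\<^esub> (at_vertex x A) = at_vertex x B"
proof -
  interpret G: group "GL Q \<beta> :: ('v \<Rightarrow> 'k mat) monoid" by (rule group_GL)
  show ?thesis
    using at_vertex_mult[OF x B A] AB at_vertex_one[of x, where ?'k = 'k]
    by (intro G.inv_equality at_vertex_in_GL x A B) simp
qed

lemma act_at_vertex_index:
  fixes A B :: "'k::field mat"
  assumes x: "x \<in> verts Q" and A: "A \<in> carrier_mat (\<beta> x) (\<beta> x)" "det A \<noteq> 0"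
    and B: "B \<in> carrier_mat (\<beta> x) (\<beta> x)" "det B \<noteq> 0" and AB: "B * A = 1\<^sub>m (\<beta> x)"
    and V: "V \<in> rep_space Q \<beta>" and a: "a \<in> arcs Q" and ij: "i < \<beta> (head Q a)" "j < \<beta> (tail Q a)"
  shows "act Q \<beta> (at_vertex x A) V a $$ (i, j) = (\<Sum>k<\<beta> (head Q a). \<Sum>l<\<beta> (tail Q a).
    at_vertex x A (head Q a) $$ (i, k) * V a $$ (k, l) * at_vertex x B (tail Q a) $$ (l, j))"
  using act_index[OF at_vertex_in_GL[OF x A] V a ij] unfolding at_vertex_inv[OF x A B AB] .

text \<open>The inverse enters the action, so the inverse family N is supplied explicitly and its
  entries are checked like those of M. For transvections they are polynomial in the parameter, for
  one-parameter tori Laurent polynomial.\<close>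

lemma fun_alg_act_at_vertex:
  fixes M N :: "'z \<Rightarrow> 'k::field mat" and V :: "'z \<Rightarrow> 'e \<Rightarrow> 'k mat"
  assumes S: "fun_alg S" and f: "f \<in> poly_funs Q \<beta>" and x: "x \<in> verts Q"
    and M: "\<And>z. M z \<in> carrier_mat (\<beta> x) (\<beta> x)" "\<And>z. det (M z) \<noteq> 0"
    and N: "\<And>z. N z \<in> carrier_mat (\<beta> x) (\<beta> x)" "\<And>z. det (N z) \<noteq> 0"
    and NM: "\<And>z. N z * M z = 1\<^sub>m (\<beta> x)"
    and V: "\<And>z. V z \<in> rep_space Q \<beta>"
    and MS: "\<And>i j. i < \<beta> x \<Longrightarrow> j < \<beta> x \<Longrightarrow> (\<lambda>z. M z $$ (i, j)) \<in> S"
    and NS: "\<And>i j. i < \<beta> x \<Longrightarrow> j < \<beta> x \<Longrightarrow> (\<lambda>z. N z $$ (i, j)) \<in> S"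
    and VS: "\<And>a i j. a \<in> arcs Q \<Longrightarrow> i < \<beta> (head Q a) \<Longrightarrow> j < \<beta> (tail Q a) \<Longrightarrow> (\<lambda>z. V z a $$ (i, j)) \<in> S"
  shows "(\<lambda>z. f (act Q \<beta> (at_vertex x (M z)) (V z))) \<in> S"
proof (rule fun_alg_compose_poly_fun[OF f S])
  fix a i j assume a: "a \<in> arcs Q" and ij: "i < \<beta> (head Q a)" "j < \<beta> (tail Q a)"
  have e: "(\<lambda>z. at_vertex x (M z) y $$ (k, l)) \<in> S" "(\<lambda>z. at_vertex x (N z) y $$ (k, l)) \<in> S"
    if "y \<in> verts Q" "k < \<beta> y" "l < \<beta> y" for y k l
    using MS NS that fun_algD(1)[OF S] by (cases "y = x"; simp add: at_vertex_def)+
  show "(\<lambda>z. act Q \<beta> (at_vertex x (M z)) (V z) a $$ (i, j)) \<in> S"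
    unfolding act_at_vertex_index[OF x M N NM V a ij]
    using a ij by (intro fun_alg_sum[OF S] fun_algD(3)[OF S] e VS) auto
qed

end

section \<open>The character by which the numerator is scaled\<close>

context quiver_component
begin

definition scales :: "(('e \<Rightarrow> 'k mat) \<Rightarrow> 'k) \<Rightarrow> ('v \<Rightarrow> 'k mat) \<Rightarrow> 'k \<Rightarrow> bool" where
  "scales p g s \<longleftrightarrow> (\<forall>V\<in>C. p (act Q \<beta> g V) = s * p V)"

lemma scales_mult:
  assumes "g \<in> carrier (GL Q \<beta>)" "h \<in> carrier (GL Q \<beta>)" "scales p g s" "scales p h r"
  shows "scales p (g \<otimes>\<^bsub>GL Q \<beta>\<^esub> h) (s * r)"
  unfolding scales_def
proof
  fix V assume V: "V \<in> C"
  show "p (act Q \<beta> (g \<otimes>\<^bsub>GL Q \<beta>\<^esub> h) V) = s * r * p V"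
    using assms(3,4) V act_in_C[OF V assms(2)]
    unfolding act_mult[OF assms(1,2) C_rep_space[OF V]] scales_def by simp
qed

lemma scales_one: "scales p \<one>\<^bsub>GL Q \<beta>\<^esub> 1"
  by (simp add: scales_def act_one C_rep_space)

lemma scales_inv:
  assumes g: "g \<in> carrier (GL Q \<beta>)" and s: "scales p g s" "s \<noteq> 0"
  shows "scales p (inv\<^bsub>GL Q \<beta>\<^esub> g) (inverse s)"
  unfolding scales_def
proof
  fix V assume V: "V \<in> C"
  have "p V = s * p (act Q \<beta> (inv\<^bsub>GL Q \<beta>\<^esub> g) V)"
    using s(1) act_in_C[OF V GL_inv(1)[OF g]] act_inv(2)[OF g C_rep_space[OF V]] unfolding scales_def by metis
  then show "p (act Q \<beta> (inv\<^bsub>GL Q \<beta>\<^esub> g) V) = inverse s * p V" using s(2) by simp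
qed

context
  fixes p :: "('e \<Rightarrow> 'k mat) \<Rightarrow> 'k" and V0
  assumes p: "p \<in> poly_funs Q \<beta>" and V0: "V0 \<in> C" "p V0 \<noteq> 0"
    and zero: "\<And>g V. g \<in> carrier (GL Q \<beta>) \<Longrightarrow> V \<in> C \<Longrightarrow> p V = 0 \<Longrightarrow> p (act Q \<beta> g V) = 0"
begin

text \<open>Apply \<open>zero\<close> to g^-1 at the point gV.\<close>

lemma act_nonzero:
  assumes g: "g \<in> carrier (GL Q \<beta>)" and V: "V \<in> C" "p V \<noteq> 0"
  shows "p (act Q \<beta> g V) \<noteq> 0"
  using zero[OF GL_inv(1)[OF g] act_in_C[OF V(1) g]] act_inv(1)[OF g C_rep_space[OF V(1)]] V(2) by auto

text \<open>Along a one-parameter group of transvections \<open>p\<close> is a polynomial without zeros.\<close>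

lemma scales_addrow:
  assumes x: "x \<in> verts Q" and ij: "i < \<beta> x" "j < \<beta> x" "i \<noteq> j"
  shows "scales p (at_vertex x (addrow_mat (\<beta> x) t i j)) 1"
  unfolding scales_def
proof
  fix V assume V: "V \<in> C"
  let ?g = "\<lambda>t :: 'k. at_vertex x (addrow_mat (\<beta> x) t i j)"
  let ?S = "{F :: 'k \<Rightarrow> 'k. \<exists>p. \<forall>t. F t = poly p t}"
  have det: "det (addrow_mat (\<beta> x) t i j) \<noteq> 0" for t :: 'k
    by (simp add: det_addrow_mat[OF ij(3)])
  have g: "?g t \<in> carrier (GL Q \<beta>)" for t by (intro at_vertex_in_GL x det) simp
  \<comment> \<open>The factor s is 1 for the transvection and -1 for its inverse.\<close>
  have e: "(\<lambda>t. addrow_mat (\<beta> x) (s * t) i j $$ (k, l)) \<in> ?S" if "k < \<beta> x" "l < \<beta> x" for k l s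
    using that
    by (intro CollectI exI[of _ "if i = k \<and> j = l then [:if k = l then 1 else 0, s:] else [:if k = l then 1 else 0:]"])
      (auto simp: mult.commute)
  have "(\<lambda>t. p (act Q \<beta> (?g t) V)) \<in> ?S"
  proof (rule fun_alg_act_at_vertex[OF fun_alg_polys p x, where N = "\<lambda>t. addrow_mat (\<beta> x) (- t) i j"])
    show "addrow_mat (\<beta> x) (- t) i j * addrow_mat (\<beta> x) t i j = 1\<^sub>m (\<beta> x)" for t :: 'k
      using addrow_mat_inv[OF ij, of "- t"] by simp
    show "(\<lambda>t. addrow_mat (\<beta> x) t i j $$ (k, l)) \<in> ?S" "(\<lambda>t. addrow_mat (\<beta> x) (- t) i j $$ (k, l)) \<in> ?S"
      if "k < \<beta> x" "l < \<beta> x" for k l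
      using e[OF that, of 1] e[OF that, of "-1"] by simp_all
    show "(\<lambda>z. V a $$ (k, l)) \<in> ?S" for a k l by (rule fun_algD(1)[OF fun_alg_polys])
  qed (use det C_rep_space[OF V] in simp_all)
  then obtain R where R: "\<And>t. p (act Q \<beta> (?g t) V) = poly R t" by auto
  have "addrow_mat (\<beta> x) 0 i j = (1\<^sub>m (\<beta> x) :: 'k mat)" by (intro eq_matI) auto
  then have R0: "poly R 0 = p V"
    using R[of 0] act_one[OF C_rep_space[OF V]] at_vertex_one[of x, where ?'k = 'k] by simp
  show "p (act Q \<beta> (?g t) V) = 1 * p V"
  \<comment> \<open>At a zero of p both sides vanish. Elsewhere R has no root, so it is constant
    with value R(0) = p(V).\<close>
  proof (cases "p V = 0")
    case True
    then show ?thesis using zero[OF g V] by simp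
  next
    case False
    then have "poly R t \<noteq> 0" for t using act_nonzero[OF g V, of t] R[of t] by simp
    then have "degree R = 0" using alg_closed_imp_poly_has_root[of R] by auto
    then obtain c where "R = [:c:]" by (metis degree_eq_zeroE)
    then show ?thesis using R[of t] R0 by simp
  qed
qed

text \<open>Along a one-parameter torus \<open>p\<close> is a Laurent polynomial without zeros, hence a monomial; since
  \<open>C\<close> is irreducible the exponent does not depend on the representation.\<close>

lemma scales_multrow:
  assumes x: "x \<in> verts Q" and i: "i < \<beta> x"
  shows "\<exists>e. \<forall>t. t \<noteq> 0 \<longrightarrow> scales p (at_vertex x (multrow_mat (\<beta> x) i t)) (t powi e)"
proof -
  let ?n = "\<beta> x" and ?P = "poly_funs Q \<beta> :: (('e \<Rightarrow> 'k mat) \<Rightarrow> 'k) set"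
  let ?g = "\<lambda>t :: 'k. at_vertex x (multrow_mat ?n i t)"
  note Pr = fun_alg_is_subring[OF fun_alg_poly_funs[of Q \<beta>]]
  note PP = is_subringD[OF is_subring_polys_over[OF Pr]]
  \<comment> \<open>Laurent polynomials in t whose coefficients are polynomial functions of V. The
    denominator is cleared by t^N, and P has functions as coefficients, so it is evaluated at the
    constant function t.\<close>
  define S where "S = {F :: 'k \<times> ('e \<Rightarrow> 'k mat) \<Rightarrow> 'k. \<exists>N P. P \<in> polys_over ?P \<and>
    (\<forall>t V. t \<noteq> 0 \<longrightarrow> V \<in> C \<longrightarrow> F (t, V) * t ^ N = poly P (\<lambda>_. t) V)}"
  have SI: "F \<in> S" if "P \<in> polys_over ?P" "\<And>t V. t \<noteq> 0 \<Longrightarrow> V \<in> C \<Longrightarrow> F (t, V) * t ^ N = poly P (\<lambda>_. t) V" for F N P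
    unfolding S_def using that by auto
  have mono: "monom (\<lambda>_. c) N \<in> polys_over ?P" for c N
    by (rule polys_over_monom[OF Pr poly_funs.const])
  have mono': "poly (monom (\<lambda>_. c) N) (\<lambda>_. t) V = c * t ^ N" for c t :: 'k and N and V :: "'e \<Rightarrow> 'k mat"
    by (simp add: poly_monom fun_power_apply)
  have Sa: "fun_alg S"
    unfolding fun_alg_def
  proof (intro conjI allI ballI)
    fix c show "(\<lambda>_. c) \<in> S" by (rule SI[of "monom (\<lambda>_. c) 0" _ 0, OF mono]) (simp add: mono')
  next
    fix F H assume F: "F \<in> S" and H: "H \<in> S"
    obtain N P where P0: "P \<in> polys_over ?P" "\<forall>t V. t \<noteq> 0 \<longrightarrow> V \<in> C \<longrightarrow> F (t, V) * t ^ N = poly P (\<lambda>_. t) V"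
      using F[unfolded S_def, THEN CollectD] by (elim exE conjE) (rule that)
    obtain M R where R0: "R \<in> polys_over ?P" "\<forall>t V. t \<noteq> 0 \<longrightarrow> V \<in> C \<longrightarrow> H (t, V) * t ^ M = poly R (\<lambda>_. t) V"
      using H[unfolded S_def, THEN CollectD] by (elim exE conjE) (rule that)
    note P = P0(1) P0(2)[rule_format] and R = R0(1) R0(2)[rule_format]
    show "(\<lambda>z. F z + H z) \<in> S"
      by (rule SI[of "P * monom (\<lambda>_. 1) M + R * monom (\<lambda>_. 1) N" _ "N + M"])
        (auto simp: mono' P(2)[symmetric] R(2)[symmetric] power_add algebra_simps intro!: PP P(1) R(1) mono)
    show "(\<lambda>z. F z * H z) \<in> S"
      by (rule SI[of "P * R" _ "N + M"])
        (auto simp: P(2)[symmetric] R(2)[symmetric] power_add algebra_simps intro!: PP P(1) R(1))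
  qed
  \<comment> \<open>A retraction onto K^* x C, so that the matrices are invertible for every
    argument of the type.\<close>
  define pr where "pr z = (if fst z \<noteq> 0 \<and> snd z \<in> C then z else (1, V0))" for z :: "'k \<times> ('e \<Rightarrow> 'k mat)"
  have pr: "fst (pr z) \<noteq> 0" "snd (pr z) \<in> C" for z using V0 by (auto simp: pr_def)
  have pr_id: "t \<noteq> 0 \<Longrightarrow> V \<in> C \<Longrightarrow> pr (t, V) = (t, V)" for t V by (simp add: pr_def)
  have det: "t \<noteq> 0 \<Longrightarrow> det (multrow_mat ?n i t) \<noteq> 0" for t :: 'k using i by (simp add: det_multrow_mat)
  have g: "t \<noteq> 0 \<Longrightarrow> ?g t \<in> carrier (GL Q \<beta>)" for t by (intro at_vertex_in_GL x det) simp
  have "(\<lambda>z. p (act Q \<beta> (?g (fst (pr z))) (snd (pr z)))) \<in> S"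
  proof (rule fun_alg_act_at_vertex[OF Sa p x, where N = "\<lambda>z. multrow_mat ?n i (inverse (fst (pr z)))"])
    show "multrow_mat ?n i (inverse (fst (pr z))) * multrow_mat ?n i (fst (pr z)) = 1\<^sub>m ?n" for z
      using multrow_mat_inv[OF i, of "inverse (fst (pr z))"] pr(1)[of z] by simp
    fix k l assume kl: "k < ?n" "l < ?n"
    show "(\<lambda>z. multrow_mat ?n i (fst (pr z)) $$ (k, l)) \<in> S"
      by (rule SI[of "monom (\<lambda>_. if k = l then 1 else 0) (if i = k then 1 else 0)" _ 0, OF mono])
        (use kl in \<open>auto simp: mono' pr_id\<close>)
    \<comment> \<open>With one factor t cleared, the entry t^-1 at position i becomes t^0 and the
      other diagonal entries become t^1.\<close>
    show "(\<lambda>z. multrow_mat ?n i (inverse (fst (pr z))) $$ (k, l)) \<in> S"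
      by (rule SI[of "monom (\<lambda>_. if k = l then 1 else 0) (if i = k then 0 else 1)" _ 1, OF mono])
        (use kl in \<open>auto simp: mono' pr_id\<close>)
  next
    fix a k l assume a: "a \<in> arcs Q" "k < \<beta> (head Q a)" "l < \<beta> (tail Q a)"
    have "monom (\<lambda>V. V a $$ (k, l)) 0 \<in> polys_over ?P"
      by (rule polys_over_monom[OF Pr poly_funs.coord[OF a]])
    then show "(\<lambda>z. snd (pr z) a $$ (k, l)) \<in> S"
      by (rule SI[of "monom (\<lambda>V. V a $$ (k, l)) 0" _ 0]) (simp add: pr_id poly_monom)
  qed (use det pr C_rep_space in simp_all)
  then have "\<exists>N P. P \<in> polys_over ?P \<and> (\<forall>t V. t \<noteq> 0 \<longrightarrow> V \<in> C \<longrightarrow>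
      p (act Q \<beta> (?g (fst (pr (t, V)))) (snd (pr (t, V)))) * t ^ N = poly P (\<lambda>_. t) V)"
    unfolding S_def by (rule CollectD)
  then obtain N P where P0: "P \<in> polys_over ?P" "\<forall>t V. t \<noteq> 0 \<longrightarrow> V \<in> C \<longrightarrow>
      p (act Q \<beta> (?g (fst (pr (t, V)))) (snd (pr (t, V)))) * t ^ N = poly P (\<lambda>_. t) V"
    by (elim exE conjE) (rule that)
  have P: "P \<in> polys_over ?P"
    "\<And>t V. t \<noteq> 0 \<Longrightarrow> V \<in> C \<Longrightarrow> p (act Q \<beta> (?g t) V) * t ^ N = poly P (\<lambda>_. t) V"
    using P0(1) P0(2)[rule_format] by (simp_all add: pr_id)
  have cP: "coeff P m \<in> ?P" for m using P(1) by (simp add: polys_over_def)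
  \<comment> \<open>The slice of P at V, now an ordinary polynomial over the field, to which the
    monomial criterion applies.\<close>
  define R where "R V = (\<Sum>m\<le>degree P. monom (coeff P m V) m)" for V
  have cR: "coeff (R V) m = coeff P m V" for V m
    by (simp add: R_def coeff_sum coeff_eq_0)
  have pR: "poly (R V) t = poly P (\<lambda>_. t) V" for V t
    by (simp add: R_def poly_sum poly_monom poly_altdef[of P] sum_apply fun_power_apply)
  have mon: "m = m'" if "V \<in> C" "p V \<noteq> 0" "coeff P m V \<noteq> 0" "coeff P m' V \<noteq> 0" for V m m'
  proof (rule poly_no_nonzero_root_monom[of "R V"])
    fix t :: 'k assume t: "t \<noteq> 0"
    show "poly (R V) t \<noteq> 0"
      using act_nonzero[OF g[OF t] that(1,2)] P(2)[OF t that(1)] t unfolding pR by auto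
  qed (use that cR in simp_all)
  have one: "p (act Q \<beta> (?g 1) V) = p V" if "V \<in> C" for V
  proof -
    have "multrow_mat ?n i 1 = (1\<^sub>m ?n :: 'k mat)" by (intro eq_matI) auto
    then show ?thesis using act_one[OF C_rep_space[OF that]] at_vertex_one[of x, where ?'k = 'k] by simp
  qed
  have "\<exists>e. coeff P e V0 \<noteq> 0"
  proof (rule ccontr)
    assume "\<not> ?thesis"
    then have "R V0 = 0" by (intro poly_eqI) (simp add: cR)
    then show False using P(2)[of 1 V0] one[OF V0(1)] V0 pR[of V0 1] by simp
  qed
  then obtain e where e: "coeff P e V0 \<noteq> 0" by auto
  \<comment> \<open>Where p is nonzero only one coefficient survives, so the product of the
    coefficients at m and e with p vanishes on all of C. By irreducibility the coefficient at m is
    zero, since the one at e and p are both nonzero at \<open>V0\<close>.\<close>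
  have ce: "coeff P m V = 0" if m: "m \<noteq> e" and V: "V \<in> C" for m V
  proof -
    have "coeff P m V * (coeff P e V * p V) = 0" if "V \<in> C" for V
      using mon[OF that, of m e] m by auto
    from C_domain[OF cP poly_funs.mult[OF cP p] this] show ?thesis using e V0 V by auto
  qed
  have val: "p (act Q \<beta> (?g t) V) * t ^ N = coeff P e V * t ^ e" if "t \<noteq> 0" "V \<in> C" for t V
  proof -
    have "R V = monom (coeff P e V) e" by (intro poly_eqI) (use ce that in \<open>simp add: cR\<close>)
    then show ?thesis using P(2)[OF that] pR[of V t] by (simp add: poly_monom)
  qed
  have "scales p (?g t) (t powi (int e - int N))" if t: "t \<noteq> 0" for t
    unfolding scales_def
  proof
    fix V assume V: "V \<in> C"
    \<comment> \<open>The value t = 1, where the group element is the identity, identifies the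
      surviving coefficient.\<close>
    have "coeff P e V = p V" using val[of 1 V] one[OF V] V by simp
    then show "p (act Q \<beta> (?g t) V) = t powi (int e - int N) * p V"
      using val[OF t V] t by (simp add: power_int_diff field_simps)
  qed
  then show ?thesis by (intro exI[of _ "int e - int N"]) simp
qed

text \<open>The exponent found at diagonal position 0 serves all positions, because the
  corresponding tori are conjugate by a product of transvections, which leaves p unchanged. Gaussian
  elimination extends the formula to every invertible matrix.\<close>

lemma scales_at_vertex:
  assumes x: "x \<in> verts Q"
  shows "\<exists>e. \<forall>A\<in>carrier_mat (\<beta> x) (\<beta> x). det A \<noteq> 0 \<longrightarrow> scales p (at_vertex x A) (det A powi e)"
proof (cases "\<beta> x = 0")
  case True
  have "scales p (at_vertex x A) (det A powi 0)" if "A \<in> carrier_mat (\<beta> x) (\<beta> x)" for A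
  proof -
    have "A = 1\<^sub>m (\<beta> x)" using that True by (intro eq_matI) auto
    then show ?thesis using scales_one at_vertex_one[of x, where ?'k = 'k] by simp
  qed
  then show ?thesis by (intro exI[of _ 0]) simp
next
  case False
  interpret G: group "GL Q \<beta> :: ('v \<Rightarrow> 'k mat) monoid" by (rule group_GL)
  let ?n = "\<beta> x"
  from False have n0: "0 < ?n" by simp
  obtain e where e: "\<And>t. t \<noteq> 0 \<Longrightarrow> scales p (at_vertex x (multrow_mat ?n 0 t)) (t powi e)"
    using scales_multrow[OF x n0] by auto
  have ml: "scales p (at_vertex x (multrow_mat ?n l t)) (t powi e)" if l: "l < ?n" and t: "t \<noteq> 0" for l t
  proof (cases "l = 0")
    case True
    then show ?thesis using e[OF t] by simp
  next
    case False
    let ?E = "addrow_mat ?n 1 0 l :: 'k mat" and ?F = "addrow_mat ?n (-1) l 0 :: 'k mat"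
    \<comment> \<open>On the rows (a, b) at positions 0 and l this acts as (a, b) \<mapsto> (a + b,
      b) \<mapsto> (a + b, -a) \<mapsto> (b, -a), a swap up to sign.\<close>
    let ?W = "?E * (?F * ?E)"
    let ?m = "\<lambda>k. multrow_mat ?n k t"
    have c: "?E \<in> carrier_mat ?n ?n" "?F \<in> carrier_mat ?n ?n" "?F * ?E \<in> carrier_mat ?n ?n" "?W \<in> carrier_mat ?n ?n"
      by (auto intro!: mult_carrier_mat)
    have d: "det ?E \<noteq> 0" "det ?F \<noteq> 0" using False l n0 by (simp_all add: det_addrow_mat)
    have d': "det (?F * ?E) \<noteq> 0" using d by (simp add: det_mult[OF c(2,1)])
    have d'': "det ?W \<noteq> 0" using d d' by (simp add: det_mult[OF c(1,3)])
    have sE: "scales p (at_vertex x ?E) 1" "scales p (at_vertex x ?F) 1"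
      using scales_addrow[OF x] False l n0 by auto
    have sFE: "scales p (at_vertex x (?F * ?E)) (1 * 1)"
      unfolding at_vertex_mult[OF x c(2) d(2) c(1) d(1)]
      by (intro scales_mult at_vertex_in_GL x c d sE)
    have sW: "scales p (at_vertex x ?W) (1 * (1 * 1))"
      unfolding at_vertex_mult[OF x c(1) d(1) c(3) d']
      by (intro scales_mult at_vertex_in_GL x c d d' sE sFE)
    have rows: "?W * M = mat_addrow 1 0 l (mat_addrow (-1) l 0 (mat_addrow 1 0 l M))" if M: "M \<in> carrier_mat ?n ?n" for M
    proof -
      have "?W * M = ?E * (?F * ?E * M)" using c M by (intro assoc_mult_mat)
      also have "?F * ?E * M = ?F * (?E * M)" using c M by (intro assoc_mult_mat)
      also have "?E * M = mat_addrow 1 0 l M" by (rule addrow_mat[OF M l, symmetric])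
      also have "?F * mat_addrow 1 0 l M = mat_addrow (-1) l 0 (mat_addrow 1 0 l M)"
        by (rule addrow_mat[OF _ n0, symmetric]) (use M in simp)
      also have "?E * mat_addrow (-1) l 0 (mat_addrow 1 0 l M) = mat_addrow 1 0 l (mat_addrow (-1) l 0 (mat_addrow 1 0 l M))"
        by (rule addrow_mat[OF _ l, symmetric]) (use M in simp)
      finally show ?thesis .
    qed
    have W1: "?W = mat_addrow 1 0 l (mat_addrow (-1) l 0 (mat_addrow 1 0 l (1\<^sub>m ?n)))"
      using rows[of "1\<^sub>m ?n"] c(4) by simp
    have mc: "?m k \<in> carrier_mat ?n ?n" for k by simp
    have md: "det (?m 0) \<noteq> 0" "det (?m l) \<noteq> 0" using t l n0 by (simp_all add: det_multrow_mat)
    \<comment> \<open>Scaling row 0 before the signed swap is scaling row l after it, so W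
      conjugates one torus into the other.\<close>
    have "?W * ?m 0 = mat_multrow l t ?W"
      unfolding rows[OF mc] unfolding W1 using False l n0 by (intro eq_matI) auto
    also have "\<dots> = ?m l * ?W" by (rule multrow_mat[OF c(4)])
    finally have "at_vertex x ?W \<otimes>\<^bsub>GL Q \<beta>\<^esub> at_vertex x (?m 0) = at_vertex x (?m l) \<otimes>\<^bsub>GL Q \<beta>\<^esub> at_vertex x ?W"
      using at_vertex_mult[OF x c(4) d'' mc md(1)] at_vertex_mult[OF x mc md(2) c(4) d''] by simp
    then have eq: "at_vertex x (?m l) = at_vertex x ?W \<otimes>\<^bsub>GL Q \<beta>\<^esub> at_vertex x (?m 0) \<otimes>\<^bsub>GL Q \<beta>\<^esub> inv\<^bsub>GL Q \<beta>\<^esub> (at_vertex x ?W)"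
      using at_vertex_in_GL[OF x c(4) d''] at_vertex_in_GL[OF x mc md(1)] at_vertex_in_GL[OF x mc md(2)]
      by (simp add: G.m_assoc)
    have "scales p (at_vertex x (?m l)) (1 * (1 * 1) * (t powi e) * inverse (1 * (1 * 1)))"
      unfolding eq
      by (intro scales_mult scales_inv G.m_closed G.inv_closed at_vertex_in_GL x c d'' mc md sW e t) simp
    then show ?thesis by simp
  qed
  have "scales p (at_vertex x A) (det A powi e)" if A: "A \<in> carrier_mat ?n ?n" "det A \<noteq> 0" for A
    using A
  proof (rule invertible_mat_elementary_induct)
    show "scales p (at_vertex x (1\<^sub>m ?n)) (det (1\<^sub>m ?n) powi e)"
      using scales_one at_vertex_one[of x, where ?'k = 'k] by simp
    show "scales p (at_vertex x (A * B)) (det (A * B) powi e)"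
      if AB: "A \<in> carrier_mat ?n ?n" "B \<in> carrier_mat ?n ?n" "det A \<noteq> 0" "det B \<noteq> 0"
        "scales p (at_vertex x A) (det A powi e)" "scales p (at_vertex x B) (det B powi e)" for A B
    proof -
      have "scales p (at_vertex x A \<otimes>\<^bsub>GL Q \<beta>\<^esub> at_vertex x B) (det A powi e * det B powi e)"
        by (intro scales_mult at_vertex_in_GL x AB)
      then show ?thesis
        unfolding at_vertex_mult[OF x AB(1,3) AB(2,4)] det_mult[OF AB(1,2)] by (simp add: power_int_mult_distrib)
    qed
    show "scales p (at_vertex x (addrow_mat ?n a i j)) (det (addrow_mat ?n a i j) powi e)"
      if "i < ?n" "j < ?n" "i \<noteq> j" for a i j
      using scales_addrow[OF x that, of a] det_addrow_mat[OF that(3), of ?n a] by simp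
    show "scales p (at_vertex x (multrow_mat ?n i a)) (det (multrow_mat ?n i a) powi e)"
      if "i < ?n" "a \<noteq> 0" for a i
      using ml[OF that] that by (simp add: det_multrow_mat)
  qed
  then show ?thesis by auto
qed

lemma semi_invariant:
  "\<exists>n. \<forall>g\<in>carrier (GL Q \<beta>). scales p g (\<Prod>x\<in>verts Q. det (g x) powi n x)"
proof -
  interpret G: group "GL Q \<beta> :: ('v \<Rightarrow> 'k mat) monoid" by (rule group_GL)
  have "\<forall>x\<in>verts Q. \<exists>e. \<forall>A\<in>carrier_mat (\<beta> x) (\<beta> x). det A \<noteq> 0 \<longrightarrow> scales p (at_vertex x A) (det A powi e)"
    using scales_at_vertex by auto
  from bchoice[OF this] obtain n where n: "\<And>x A. x \<in> verts Q \<Longrightarrow> A \<in> carrier_mat (\<beta> x) (\<beta> x) \<Longrightarrow>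
    det A \<noteq> 0 \<Longrightarrow> scales p (at_vertex x A) (det A powi n x)" by auto
  have "scales p g (\<Prod>x\<in>verts Q. det (g x) powi n x)" if g: "g \<in> carrier (GL Q \<beta>)" for g
  proof -
    \<comment> \<open>h F keeps the components of g at the vertices in F only; adding a vertex
      multiplies by one factor concentrated there.\<close>
    define h where "h F = (\<lambda>y\<in>verts Q. if y \<in> F then g y else 1\<^sub>m (\<beta> y))" for F
    have hG: "h F \<in> carrier (GL Q \<beta>)" for F
      using GL_carrier[OF g] by (auto simp: GL_iff h_def)
    have "scales p (h F) (\<Prod>x\<in>F. det (g x) powi n x)" if "F \<subseteq> verts Q" for F
      using finite_subset[OF that finite_verts] that
    proof (induction F rule: finite_induct)
      case empty
      have "h {} = \<one>\<^bsub>GL Q \<beta>\<^esub>"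
        by (rule GL_eqI[OF hG]) (auto simp: h_def GL_one_apply)
      then show ?case using scales_one by simp
    next
      case (insert x F)
      then have x: "x \<in> verts Q" by simp
      note gx = GL_carrier[OF g x]
      have "h (insert x F) = at_vertex x (g x) \<otimes>\<^bsub>GL Q \<beta>\<^esub> h F"
      proof (rule GL_eqI[OF hG G.m_closed[OF at_vertex_in_GL[OF x gx] hG]])
        fix y assume y: "y \<in> verts Q"
        then show "h (insert x F) y = (at_vertex x (g x) \<otimes>\<^bsub>GL Q \<beta>\<^esub> h F) y"
          using GL_carrier(1)[OF g y] insert.hyps(2)
          by (auto simp: GL_mult_apply h_def at_vertex_def)
      qed
      moreover have "scales p (at_vertex x (g x) \<otimes>\<^bsub>GL Q \<beta>\<^esub> h F) (det (g x) powi n x * (\<Prod>x\<in>F. det (g x) powi n x))"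
        by (intro scales_mult at_vertex_in_GL x gx hG n insert.IH) (use insert.prems in simp)
      ultimately show ?case using insert.hyps by simp
    qed
    from this[of "verts Q"] have "scales p (h (verts Q)) (\<Prod>x\<in>verts Q. det (g x) powi n x)" by simp
    moreover have "h (verts Q) = g" by (rule GL_eqI[OF hG g]) (simp add: h_def)
    ultimately show ?thesis by simp
  qed
  then show ?thesis by auto
qed

end

end

section \<open>Weight spaces of dimension at least two\<close>

context quiver_component
begin

text \<open>The exponents change sign because the group acts on functions through g^-1.\<close>

lemma restrict_in_SI_weight:
  assumes f: "f \<in> poly_funs Q \<beta>"
    and s: "\<And>g. g \<in> carrier (GL Q \<beta>) \<Longrightarrow> scales f g (\<Prod>x\<in>verts Q. det (g x) powi n x)"
  shows "restrict f C \<in> SI_weight Q \<beta> C (\<lambda>x. - n x)"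
proof -
  have "fun_act Q \<beta> C g (restrict f C) = (\<lambda>V\<in>C. weight_char Q (\<lambda>x. - n x) g * restrict f C V)"
    if g: "g \<in> carrier (GL Q \<beta>)" for g
  proof (rule ext)
    fix V
    let ?h = "inv\<^bsub>GL Q \<beta>\<^esub> g"
    have "det (?h x) = inverse (det (g x))" if x: "x \<in> verts Q" for x
    proof -
      have "det (g x) * det (?h x) = 1"
        using det_mult[OF GL_carrier(1)[OF g x] GL_inv(2)[OF g x]] GL_inv(3)[OF g x] by simp
      then show ?thesis by (metis inverse_unique)
    qed
    then have w: "(\<Prod>x\<in>verts Q. det (?h x) powi n x) = weight_char Q (\<lambda>x. - n x) g"
      unfolding weight_char_def by (intro prod.cong refl) (simp add: power_int_minus power_int_inverse)
    show "fun_act Q \<beta> C g (restrict f C) V = (\<lambda>V\<in>C. weight_char Q (\<lambda>x. - n x) g * restrict f C V) V"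
      using s[OF GL_inv(1)[OF g]] act_in_C[OF _ GL_inv(1)[OF g], of V]
      unfolding w by (simp add: fun_act_def scales_def)
  qed
  moreover have "restrict f C \<in> carrier (coord_ring Q \<beta> C)" using f by (simp add: coord_ring_def)
  ultimately show ?thesis unfolding SI_weight_def by simp
qed

text \<open>An independent pair bounds every finite dimension of the weight space from below. If
  there is none, the infimum of the empty set is infinite and the bound holds as well.\<close>

lemma SI_weight_dim_ge_2:
  assumes f: "restrict p C \<in> SI_weight Q \<beta> C \<theta>" "restrict q C \<in> SI_weight Q \<beta> C \<theta>"
    and indep: "\<And>x y. (\<And>V. V \<in> C \<Longrightarrow> x * p V + y * q V = 0) \<Longrightarrow> x = 0 \<and> y = 0"
  shows "SI_weight_dim Q \<beta> C \<theta> \<ge> 2"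
proof -
  let ?A = "coord_ring Q \<beta> C" and ?K = "constants C"
  interpret A: cring ?A by (rule cring_coord_ring)
  have sf: "subfield ?K ?A" by (rule subfield_constants[OF C_nonempty])
  have carr: "restrict p C \<in> carrier ?A" "restrict q C \<in> carrier ?A" using f by (auto simp: SI_weight_def)
  have q0: "restrict q C \<notin> {\<zero>\<^bsub>?A\<^esub>}"
  proof
    assume "restrict q C \<in> {\<zero>\<^bsub>?A\<^esub>}"
    then have "restrict q C V = (\<lambda>V\<in>C. 0) V" for V by (simp add: coord_ring_def)
    from this have "q V = 0" if "V \<in> C" for V using that by (metis restrict_apply')
    then show False using indep[of 0 1] by simp
  qed
  have ps: "restrict p C \<notin> A.Span ?K [restrict q C]"
  proof
    \<comment> \<open>The span of one element unfolds to its constant multiples plus the zero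
      element.\<close>
    assume "restrict p C \<in> A.Span ?K [restrict q C]"
    then obtain k where k: "k \<in> ?K" "restrict p C = k \<otimes>\<^bsub>?A\<^esub> restrict q C \<oplus>\<^bsub>?A\<^esub> \<zero>\<^bsub>?A\<^esub>"
      by (auto simp: A.line_extension_def set_add_def set_mult_def r_coset_def)
    then obtain x where x: "k = (\<lambda>V\<in>C. x)" by (auto simp: constants_def)
    have "1 * p V + (- x) * q V = 0" if V: "V \<in> C" for V
      using fun_cong[OF k(2), of V] V by (simp add: coord_ring_def x)
    then show False using indep[of 1 "- x"] by auto
  qed
  have ind: "A.independent ?K [restrict p C, restrict q C]"
    by (intro A.li_Cons A.li_Nil carr ps) (use q0 in simp)
  have "2 \<le> n" if "A.dimension n ?K (SI_weight Q \<beta> C \<theta>)" for n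
    using A.independent_length_le_dimension[OF sf that ind] f by simp
  then show ?thesis
    unfolding SI_weight_dim_def by (intro Inf_greatest) (auto simp: numeral_eq_enat)
qed

lemma not_multiplicity_free:
  assumes ex: "\<not> (\<exists>V\<in>C. C = zariski Q \<beta> closure_of orbit Q \<beta> V)"
    and fd: "factorial_domain (coord_ring Q \<beta> C)"
  shows "\<not> SI_multiplicity_free Q \<beta> C"
proof (rule invariant_fraction[OF ex])
  fix c d
  assume c: "c \<in> poly_funs Q \<beta>" and d: "d \<in> poly_funs Q \<beta>"
    and cd: "\<And>g V. g \<in> carrier (GL Q \<beta>) \<Longrightarrow> V \<in> C \<Longrightarrow> c (act Q \<beta> g V) * d V = c V * d (act Q \<beta> g V)"
    and indep: "\<And>x y. (\<And>V. V \<in> C \<Longrightarrow> x * c V + y * d V = 0) \<Longrightarrow> x = 0 \<and> y = 0"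
  have "\<exists>V\<in>C. c V \<noteq> 0"
  proof (rule ccontr)
    assume "\<not> ?thesis"
    then show False using indep[of 1 0] by simp
  qed
  then obtain V1 where V1: "V1 \<in> C" "c V1 \<noteq> 0" by auto
  have "\<exists>V\<in>C. d V \<noteq> 0"
  proof (rule ccontr)
    assume "\<not> ?thesis"
    then show False using indep[of 0 1] by simp
  qed
  then obtain V2 where V2: "V2 \<in> C" "d V2 \<noteq> 0" by auto
  show ?thesis
  proof (rule coprime_numerator[OF fd c V1 d V2])
    show "c (act Q \<beta> g V) * d V = c V * d (act Q \<beta> g V)" if "g \<in> carrier (GL Q \<beta>)" "V \<in> C" for g V
      by (rule cd[OF that])
  next
    fix e p q
    assume e: "e \<in> poly_funs Q \<beta>" and p: "p \<in> poly_funs Q \<beta>" and q: "q \<in> poly_funs Q \<beta>"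
      and cp: "\<And>V. V \<in> C \<Longrightarrow> c V = e V * p V" and dq: "\<And>V. V \<in> C \<Longrightarrow> d V = e V * q V"
      and pq: "\<And>g V. g \<in> carrier (GL Q \<beta>) \<Longrightarrow> V \<in> C \<Longrightarrow> p (act Q \<beta> g V) * q V = p V * q (act Q \<beta> g V)"
      and z: "\<And>g V. g \<in> carrier (GL Q \<beta>) \<Longrightarrow> V \<in> C \<Longrightarrow> p V = 0 \<Longrightarrow> p (act Q \<beta> g V) = 0"
    have pV1: "p V1 \<noteq> 0" using V1 cp by auto
    have "\<exists>n. \<forall>g\<in>carrier (GL Q \<beta>). scales p g (\<Prod>x\<in>verts Q. det (g x) powi n x)"
      by (rule semi_invariant[OF p V1(1) pV1]) (rule z)
    then obtain n where n0: "\<forall>g\<in>carrier (GL Q \<beta>). scales p g (\<Prod>x\<in>verts Q. det (g x) powi n x)"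
      by (elim exE) (rule that)
    note n = bspec[OF n0]
    \<comment> \<open>Inserting p(gV) = s p(V) into p(gV) q(V) = p(V) q(gV) gives p(V) (q(gV) - s
      q(V)) = 0, and irreducibility cancels p.\<close>
    have nq: "scales q g (\<Prod>x\<in>verts Q. det (g x) powi n x)" if g: "g \<in> carrier (GL Q \<beta>)" for g
    proof -
      let ?s = "\<Prod>x\<in>verts Q. det (g x) powi n x"
      obtain qg where qg: "qg \<in> poly_funs Q \<beta>" "\<And>V. V \<in> rep_space Q \<beta> \<Longrightarrow> q (act Q \<beta> g V) = qg V"
        by (rule poly_fun_actE[OF q g], rule that)
      have "p V * (qg V - ?s * q V) = 0" if V: "V \<in> C" for V
        using pq[OF g V] n[OF g] V qg(2)[OF C_rep_space[OF V]] by (auto simp: scales_def algebra_simps)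
      moreover have "(\<lambda>V. qg V - ?s * q V) \<in> poly_funs Q \<beta>"
        by (intro fun_alg_diff[OF fun_alg_poly_funs] qg poly_funs.mult poly_funs.const q)
      ultimately have "\<forall>V\<in>C. qg V - ?s * q V = 0" using C_domain[OF p, of "\<lambda>V. qg V - ?s * q V"] V1(1) pV1 by auto
      then show ?thesis using qg(2) C_rep_space by (simp add: scales_def)
    qed
    have "SI_weight_dim Q \<beta> C (\<lambda>x. - n x) \<ge> 2"
    proof (rule SI_weight_dim_ge_2[OF restrict_in_SI_weight[OF p n] restrict_in_SI_weight[OF q nq]])
      fix x y assume xy: "\<And>V. V \<in> C \<Longrightarrow> x * p V + y * q V = 0"
      \<comment> \<open>A dependence of p and q becomes one of c and d after multiplication by the
        common factor e.\<close>
      have "x * c V + y * d V = 0" if V: "V \<in> C" for V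
      proof -
        have "x * c V + y * d V = e V * (x * p V + y * q V)" using cp[OF V] dq[OF V] by (simp add: algebra_simps)
        then show ?thesis using xy[OF V] by simp
      qed
      then show "x = 0 \<and> y = 0" by (rule indep)
    qed
    then show ?thesis unfolding not_SI_multiplicity_free_iff by auto
  qed
qed

end

theorem theorem3:
  fixes Q :: "('v, 'e) pre_digraph"
    and R :: "(('v, 'e) quiver_path \<Rightarrow>\<^sub>0 'k::{alg_closed_field, field_char_0}) set"
    and \<beta> :: "'v \<Rightarrow> nat"
    and C :: "('e \<Rightarrow> 'k mat) set"
  assumes "fin_digraph Q"
    and "admissible_ideal Q R"
    and "irreducible_component (subtopology (zariski Q \<beta>) (rep_variety Q R \<beta>)) C"
    and "\<not> (\<exists>V\<in>rep_variety Q R \<beta>. C = zariski Q \<beta> closure_of orbit Q \<beta> V)"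
    and "factorial_domain (coord_ring Q \<beta> C)"
  shows "\<not> SI_multiplicity_free Q \<beta> C"
proof -
  interpret fin_digraph Q by fact
  interpret quiver_component Q \<beta> R C by unfold_locales fact
  show ?thesis
    using assms(4) C_variety by (intro not_multiplicity_free assms(5)) auto
qed

end
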